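(* There exists $\lambda_0>0$ such that for every $\lambda\ge\lambda_0$ and every maximizer $\omega^\lambda$ of $E$ over $K_\lambda$, the function $\omega^\lambda$ is a weak solution of the steady vorticity equation, i.e. with $\psi^\lambda(x)=\int_D G(x,y)\omega^\lambda(y)\,dy$, $$\int_D \omega^\lambda\,\partial(\xi,\psi^\lambda)\,dx=0\qquad\text{for all }\xi\in C_0^\infty(D),$$ where $\partial(f,g)=\partial_1 f\,\partial_2 g-\partial_2 f\,\partial_1 g$.
   Context: $D\subset\mathbb R^2$ is a bounded simply connected domain with smooth boundary; $G$ is the Green function of $-\Delta$ in $D$ with zero Dirichlet boundary condition, written $G(x,y)=\frac1{2\pi}\ln\frac1{|x-y|}-h(x,y)$, where $h$ is the regular part. Real numbers $\kappa_1>0$ and $\kappa_2<0$ are fixed, and the Kirchhoff–Routh function is $H(x_1,x_2)=-2\kappa_1\kappa_2G(x_1,x_2)+\sum_{i=1}^2\kappa_i^2h(x_i,x_i)$ for $x_1,x_2\in D$, $x_1\ne x_2$. The point $(\bar x_1,\bar x_2)\in D\times D$, $\bar x_1\neq\bar x_2$, is a strict local minimum point of $H$. A number $\delta>0$ is fixed so small that, writing $B_i=B_\delta(\bar x_i)$: $\overline{B_i}\subset D$ for $i=1,2$; $\overline{B_1}\cap\overline{B_2}=\varnothing$; and $(\bar x_1,\bar x_2)$ is the unique minimum point of $H$ in $\overline{B_1}\times\overline{B_2}$. For $\lambda>0$, $K_\lambda$ is the set of all $\omega=\omega_1+\omega_2$ with $\omega_i\in L^\infty(D)$, $0\le \mathrm{sgn}(\kappa_i)\omega_i\le\lambda$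 a.e., $\int_D\omega_i=\kappa_i$, and $\omega_i$ supported in $B_i$ (meaning $\omega_i=0$ a.e. in $D\setminus B_i$), $i=1,2$. The kinetic energy is $E(\omega)=\frac12\int_D\int_DG(x,y)\omega(x)\omega(y)\,dx\,dy$. A maximizer $\omega^\lambda$ of $E$ over $K_\lambda$ exists whenever $K_\lambda\neq\varnothing$. If $\lambda\pi\delta^2>\max(|\kappa_1|,|\kappa_2|)$, every maximizer $\omega^\lambda$ of $E$ over $K_\lambda$ satisfies $\omega^\lambda I_{B_i}=\mathrm{sgn}(\kappa_i)\lambda I_{\Omega_i}$ a.e. with $\Omega_i=\{\mathrm{sgn}(\kappa_i)\psi^\lambda>\mu_i^\lambda\}\cap B_i$ for uniquely determined real numbers $\mu_i^\lambda$, $i=1,2$ ($I_A$ is the characteristic function of $A$). The number $\delta$ is moreover chosen so small that $\mu_1^\lambda>0$ and $\mu_2^\lambda>0$ for every maximizer $\omega^\lambda$ and all sufficiently large $\lambda$ (such a choice is possible). *)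

theory Defs
  imports "HOL-Analysis.Analysis"
begin

section \<open>Smooth functions and domains in the plane\<close>

definition partial_deriv :: "2 \<Rightarrow> (real^2 \<Rightarrow> real) \<Rightarrow> real^2 \<Rightarrow> real" where
  "partial_deriv i f x = deriv (\<lambda>t. f (x + t *\<^sub>R axis i 1)) 0"

text \<open>Intended for open \<open>S\<close>, where existence and continuity of all partial derivatives up to
  order \<open>k\<close> is the usual notion of a \<open>k\<close> times continuously differentiable function.\<close>

primrec Ck_on :: "nat \<Rightarrow> (real^2) set \<Rightarrow> (real^2 \<Rightarrow> real) \<Rightarrow> bool" where
  "Ck_on 0 S f \<longleftrightarrow> continuous_on S f"
| "Ck_on (Suc k) S f \<longleftrightarrow> continuous_on S f \<and>
     (\<forall>i. (\<forall>x\<in>S. (\<lambda>t. f (x + t *\<^sub>R axis i 1)) differentiable (at 0)) \<and>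
          Ck_on k S (partial_deriv i f))"

definition smooth_on :: "(real^2) set \<Rightarrow> (real^2 \<Rightarrow> real) \<Rightarrow> bool" where
  "smooth_on S f \<longleftrightarrow> (\<forall>k. Ck_on k S f)"

definition harmonic_on :: "(real^2) set \<Rightarrow> (real^2 \<Rightarrow> real) \<Rightarrow> bool" where
  "harmonic_on S f \<longleftrightarrow> Ck_on 2 S f \<and>
     (\<forall>x\<in>S. (\<Sum>i\<in>UNIV. partial_deriv i (partial_deriv i f) x) = 0)"

text \<open>Near each boundary point, \<open>D\<close> is the sublevel set of a smooth defining function without
  critical points; the sign condition puts \<open>D\<close> on one side of its boundary.\<close>

definition smooth_boundary :: "(real^2) set \<Rightarrow> bool" where
  "smooth_boundary D \<longleftrightarrow>
     (\<forall>p\<in>frontier D. \<exists>U \<rho>. open U \<and> p \<in> U \<and> smooth_on U \<rho> \<and>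
        (\<forall>x\<in>U. \<exists>i. partial_deriv i \<rho> x \<noteq> 0) \<and> D \<inter> U = {x\<in>U. \<rho> x < 0})"

definition test_function :: "(real^2) set \<Rightarrow> (real^2 \<Rightarrow> real) \<Rightarrow> bool" where
  "test_function D \<xi> \<longleftrightarrow> smooth_on UNIV \<xi> \<and>
     compact (closure {x. \<xi> x \<noteq> 0}) \<and> closure {x. \<xi> x \<noteq> 0} \<subseteq> D"

definition jacobian :: "(real^2 \<Rightarrow> real) \<Rightarrow> (real^2 \<Rightarrow> real) \<Rightarrow> real^2 \<Rightarrow> real" where
  "jacobian f g x = partial_deriv 1 f x * partial_deriv 2 g x - partial_deriv 2 f x * partial_deriv 1 g x"

section \<open>Green function and Kirchhoff--Routh function\<close>

text \<open>\<open>G\<close> is the Dirichlet Green function of the negative Laplacian in \<open>D\<close> and \<open>h\<close> its regular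
  part. By the maximum principle this determines \<open>h x y\<close> for \<open>x \<in> D\<close>, \<open>y \<in> closure D\<close>, and \<open>G x y\<close>
  for such \<open>x \<noteq> y\<close>; the value \<open>G x x\<close> is left unspecified and is irrelevant below.\<close>

definition is_green_function ::
    "(real^2) set \<Rightarrow> (real^2 \<Rightarrow> real^2 \<Rightarrow> real) \<Rightarrow> (real^2 \<Rightarrow> real^2 \<Rightarrow> real) \<Rightarrow> bool" where
  "is_green_function D G h \<longleftrightarrow>
     (\<forall>x\<in>D. (\<forall>y\<in>closure D. y \<noteq> x \<longrightarrow> G x y = 1 / (2 * pi) * ln (1 / norm (x - y)) - h x y) \<and>
            harmonic_on D (h x) \<and> continuous_on (closure D) (h x) \<and>
            (\<forall>y\<in>frontier D. G x y = 0))"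

definition kirchhoff_routh ::
    "(real^2 \<Rightarrow> real^2 \<Rightarrow> real) \<Rightarrow> (real^2 \<Rightarrow> real^2 \<Rightarrow> real) \<Rightarrow> real \<Rightarrow> real \<Rightarrow>
     (real^2) \<times> (real^2) \<Rightarrow> real" where
  "kirchhoff_routh G h \<kappa>1 \<kappa>2 = (\<lambda>(x1, x2).
     - 2 * \<kappa>1 * \<kappa>2 * G x1 x2 + (\<kappa>1\<^sup>2 * h x1 x1 + \<kappa>2\<^sup>2 * h x2 x2))"

definition strict_local_min_on :: "('a::metric_space) set \<Rightarrow> ('a \<Rightarrow> real) \<Rightarrow> 'a \<Rightarrow> bool" where
  "strict_local_min_on S f z \<longleftrightarrow>
     z \<in> S \<and> (\<exists>e>0. \<forall>w\<in>S. w \<noteq> z \<and> dist w z < e \<longrightarrow> f z < f w)"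

definition unique_min_on :: "'a set \<Rightarrow> ('a \<Rightarrow> real) \<Rightarrow> 'a \<Rightarrow> bool" where
  "unique_min_on S f z \<longleftrightarrow> z \<in> S \<and> (\<forall>w\<in>S. w \<noteq> z \<longrightarrow> f z < f w)"

section \<open>Vorticity classes, stream function and energy\<close>

text \<open>Elements of \<open>L\<^sup>\<infinity>(D)\<close> are represented by functions on the whole plane, of which only the values
  almost everywhere on \<open>D\<close> matter.\<close>

definition Linfty :: "(real^2) set \<Rightarrow> (real^2 \<Rightarrow> real) set" where
  "Linfty D = {f \<in> borel_measurable (lebesgue_on D). \<exists>C. AE x in lebesgue_on D. \<bar>f x\<bar> \<le> C}"

definition vortex_component ::
    "(real^2) set \<Rightarrow> real \<Rightarrow> real \<Rightarrow> (real^2) set \<Rightarrow> (real^2 \<Rightarrow> real) set" where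
  "vortex_component D lam \<kappa> B = {\<omega> \<in> Linfty D.
     (AE x in lebesgue_on D. 0 \<le> sgn \<kappa> * \<omega> x \<and> sgn \<kappa> * \<omega> x \<le> lam) \<and>
     (LINT x|lebesgue_on D. \<omega> x) = \<kappa> \<and>
     (AE x in lebesgue_on D. x \<notin> B \<longrightarrow> \<omega> x = 0)}"

definition K_class ::
    "(real^2) set \<Rightarrow> real \<Rightarrow> real \<Rightarrow> (real^2) set \<Rightarrow> (real^2) set \<Rightarrow> real \<Rightarrow> (real^2 \<Rightarrow> real) set" where
  "K_class D \<kappa>1 \<kappa>2 B1 B2 lam =
     {\<lambda>x. \<omega>1 x + \<omega>2 x | \<omega>1 \<omega>2.
        \<omega>1 \<in> vortex_component D lam \<kappa>1 B1 \<and> \<omega>2 \<in> vortex_component D lam \<kappa>2 B2}"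

definition stream_function ::
    "(real^2) set \<Rightarrow> (real^2 \<Rightarrow> real^2 \<Rightarrow> real) \<Rightarrow> (real^2 \<Rightarrow> real) \<Rightarrow> real^2 \<Rightarrow> real" where
  "stream_function D G \<omega> x = (LINT y|lebesgue_on D. G x y * \<omega> y)"

definition kinetic_energy ::
    "(real^2) set \<Rightarrow> (real^2 \<Rightarrow> real^2 \<Rightarrow> real) \<Rightarrow> (real^2 \<Rightarrow> real) \<Rightarrow> real" where
  "kinetic_energy D G \<omega> =
     1 / 2 * (LINT x|lebesgue_on D. (LINT y|lebesgue_on D. G x y * \<omega> x * \<omega> y))"

definition energy_maximizer ::
    "(real^2) set \<Rightarrow> (real^2 \<Rightarrow> real^2 \<Rightarrow> real) \<Rightarrow> real \<Rightarrow> real \<Rightarrow> (real^2) set \<Rightarrow> (real^2) set \<Rightarrow>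
     real \<Rightarrow> (real^2 \<Rightarrow> real) \<Rightarrow> bool" where
  "energy_maximizer D G \<kappa>1 \<kappa>2 B1 B2 lam \<omega> \<longleftrightarrow>
     is_arg_max (kinetic_energy D G) (\<lambda>w. w \<in> K_class D \<kappa>1 \<kappa>2 B1 B2 lam) \<omega>"

text \<open>For a maximizer and all large \<open>lam\<close> there is exactly one such \<open>\<mu>\<close> for each of the two components.\<close>

definition is_patch_level ::
    "(real^2) set \<Rightarrow> (real^2 \<Rightarrow> real^2 \<Rightarrow> real) \<Rightarrow> real \<Rightarrow> (real^2 \<Rightarrow> real) \<Rightarrow> real \<Rightarrow> (real^2) set \<Rightarrow>
     real \<Rightarrow> bool" where
  "is_patch_level D G lam \<omega> \<kappa> B \<mu> \<longleftrightarrow>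
     (AE x in lebesgue_on D. \<omega> x * indicator B x =
        sgn \<kappa> * lam * indicator ({z. sgn \<kappa> * stream_function D G \<omega> z > \<mu>} \<inter> B) x)"

definition weak_steady_solution ::
    "(real^2) set \<Rightarrow> (real^2 \<Rightarrow> real^2 \<Rightarrow> real) \<Rightarrow> (real^2 \<Rightarrow> real) \<Rightarrow> bool" where
  "weak_steady_solution D G \<omega> \<longleftrightarrow>
     (\<forall>\<xi>. test_function D \<xi> \<longrightarrow>
        (LINT x|lebesgue_on D. \<omega> x * jacobian \<xi> (stream_function D G \<omega>) x) = 0)"

end

theory Submission
  imports Defs
begin

text \<open>Write a maximizer as \<open>\<omega> = a - b\<close> with \<open>a, b \<ge> 0\<close> supported in the two discs. The first
  variation of the energy shows that \<open>a = lam\<close> where \<open>\<psi> > \<mu>\<close> and \<open>a = 0\<close> where \<open>\<psi> < \<mu>\<close>, and similarly for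
  \<open>b\<close> and \<open>- \<psi>\<close>. If \<open>a\<close> vanishes near the boundary of its disc, then so does \<open>max 0 (\<psi> - \<mu>)\<close>, whose
  Jacobian with a test function integrates to zero; as \<open>\<nabla>\<psi> = 0\<close> almost everywhere on \<open>{\<psi> = \<mu>}\<close>, this is
  the weak equation. So the point is to keep the supports away from the circles. Comparison with two
  discs of mass \<open>\<kappa>\<^sub>i\<close> bounds the logarithmic self-energies from below, and this forces each support
  into a disc of radius \<open>O(lam\<^bsup>-1/2\<^esup>)\<close>. Moving both supports to the minimum point of the Kirchhoff--Routh
  function \<open>H\<close> leaves the self-energies unchanged and alters the remaining energy by the drop of \<open>H\<close> up
  to \<open>o(1)\<close>, so they already lie close to that point.

  The analysis needs the symmetry of \<open>h\<close>. In its second argument \<open>h\<close> is harmonic by definition; in the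
  first one its five-point Laplacian is \<open>O(r\<^sup>4)\<close>, by the maximum principle in the second argument, and
  this suffices to apply the maximum principle to \<open>h y x - h x y\<close>.\<close>

section \<open>The maximum principle and the symmetry of the Green function\<close>

text \<open>The hypotheses describe \<open>h x y\<close> only as a function of \<open>y\<close>,
  while the stream function is differentiated in \<open>x\<close> and the first variation needs a
  symmetric kernel. Everything about the first argument therefore has to be carried over from the
  boundary values of \<open>h x\<close>, which are explicit logarithms. The length
  \<open>lam\<close> to the power -1/2 is the radius \<epsilon> of the disc that carries mass m at
  density \<open>lam\<close>. With the factor 2 pi, its logarithmic energy is m squared times ln
  (1/\<epsilon>) up to a bounded error, and no density between 0 and \<open>lam\<close> of mass m
  has more than that up to a bounded error. Maximality thus fixes each self-energy up to a constant
  independent of \<open>lam\<close>, and such a defect costs only a constant factor in the radius of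
  the support. Since the supports shrink while \<open>h\<close> and the mutual interaction are
  uniformly continuous, the remaining energy can be read off from H at two points. The stream
  function is only known to be Lipschitz with pointwise partial derivatives, so integration by parts
  is done on finite differences.\<close>

definition discrete_laplacian :: "real \<Rightarrow> (real^2 \<Rightarrow> real) \<Rightarrow> real^2 \<Rightarrow> real" where
  "discrete_laplacian r u x =
     (\<Sum>i\<in>UNIV. u (x + r *\<^sub>R axis i 1) + u (x - r *\<^sub>R axis i 1) - 2 * u x)"

text \<open>Harmonicity tested on second differences alone. It makes sense for functions whose
  differentiability is unknown, such as \<open>h x y\<close> in \<open>x\<close>, and it is all that
  the maximum principle uses.\<close>

definition asymptotically_harmonic_on :: "(real^2) set \<Rightarrow> (real^2 \<Rightarrow> real) \<Rightarrow> bool" where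
  "asymptotically_harmonic_on D u \<longleftrightarrow>
     (\<forall>x\<in>D. ((\<lambda>r. discrete_laplacian r u x / r\<^sup>2) \<longlongrightarrow> 0) (at_right 0))"

lemma discrete_laplacian_add:
  "discrete_laplacian r (\<lambda>x. u x + v x) x = discrete_laplacian r u x + discrete_laplacian r v x"
  by (simp add: discrete_laplacian_def sum.distrib[symmetric] algebra_simps)

lemma discrete_laplacian_cmult:
  "discrete_laplacian r (\<lambda>x. c * u x) x = c * discrete_laplacian r u x"
  by (simp add: discrete_laplacian_def sum_distrib_left algebra_simps)

lemma discrete_laplacian_sum:
  "discrete_laplacian r (\<lambda>x. \<Sum>j\<in>I. u j x) x = (\<Sum>j\<in>I. discrete_laplacian r (u j) x)"
proof (induction I rule: infinite_finite_induct)
  case (insert j I)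
  then show ?case by (simp add: discrete_laplacian_add)
qed (simp_all add: discrete_laplacian_def)

lemma discrete_laplacian_norm_square:
  "discrete_laplacian r (\<lambda>x. (norm x)\<^sup>2) x = 4 * r\<^sup>2"
proof -
  have "norm (x + r *\<^sub>R axis i 1) ^ 2 + norm (x - r *\<^sub>R axis i 1) ^ 2 - 2 * norm x ^ 2 = 2 * r\<^sup>2" for i :: 2
    unfolding power2_norm_eq_inner by (simp add: algebra_simps inner_axis_axis power2_eq_square)
  then show ?thesis
    unfolding discrete_laplacian_def by simp
qed

lemma asymptotically_harmonic_on_sum:
  assumes "\<And>j. j \<in> I \<Longrightarrow> asymptotically_harmonic_on D (u j)"
  shows "asymptotically_harmonic_on D (\<lambda>x. \<Sum>j\<in>I. c j * u j x)"
  unfolding asymptotically_harmonic_on_def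
proof
  fix x assume x: "x \<in> D"
  have "((\<lambda>r. \<Sum>j\<in>I. c j * (discrete_laplacian r (u j) x / r\<^sup>2)) \<longlongrightarrow> (\<Sum>j\<in>I. c j * 0)) (at_right 0)"
    using assms x by (intro tendsto_intros) (auto simp: asymptotically_harmonic_on_def)
  then show "((\<lambda>r. discrete_laplacian r (\<lambda>x. \<Sum>j\<in>I. c j * u j x) x / r\<^sup>2) \<longlongrightarrow> 0) (at_right 0)"
    by (simp add: discrete_laplacian_sum discrete_laplacian_cmult sum_divide_distrib)
qed

lemma asymptotically_harmonic_on_diff:
  assumes "asymptotically_harmonic_on D u" "asymptotically_harmonic_on D v"
  shows "asymptotically_harmonic_on D (\<lambda>x. u x - v x)"
  unfolding asymptotically_harmonic_on_def
proof
  fix x assume x: "x \<in> D"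
  have "((\<lambda>r. discrete_laplacian r u x / r\<^sup>2 + (-1) * (discrete_laplacian r v x / r\<^sup>2)) \<longlongrightarrow> 0 + (-1) * 0) (at_right 0)"
    using assms x by (intro tendsto_intros) (auto simp: asymptotically_harmonic_on_def)
  then show "((\<lambda>r. discrete_laplacian r (\<lambda>x. u x - v x) x / r\<^sup>2) \<longlongrightarrow> 0) (at_right 0)"
    using discrete_laplacian_add[of _ u "\<lambda>x. (-1) * v x"] discrete_laplacian_cmult[of _ "-1" v]
    by (simp add: add_divide_distrib diff_divide_distrib)
qed

lemma asymptotically_harmonic_on_subset:
  "asymptotically_harmonic_on D u \<Longrightarrow> E \<subseteq> D \<Longrightarrow> asymptotically_harmonic_on E u"
  by (auto simp: asymptotically_harmonic_on_def)

text \<open>At an interior maximum of \<open>u x + e * (norm x)\<^sup>2\<close> the second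
  differences are nonpositive, but the quadratic contributes \<open>4 * e * r\<^sup>2\<close>
  against an error \<open>o(r\<^sup>2)\<close> from \<open>u\<close>. The boundary condition is a
  one-sided eventual bound, so that \<open>u\<close> need not extend continuously to the frontier
  and may tend to minus infinity at a puncture.\<close>

lemma maximum_principle:
  assumes "open D" "bounded D" and cont: "continuous_on D u"
    and harm: "asymptotically_harmonic_on D u"
    and bdry: "\<And>p \<eta>. p \<in> frontier D \<Longrightarrow> \<eta> > 0 \<Longrightarrow> \<forall>\<^sub>F y in at p within D. u y \<le> c + \<eta>"
    and x0: "x0 \<in> D"
  shows "u x0 \<le> c"
proof (rule ccontr)
  assume "\<not> u x0 \<le> c"
  then have gap: "u x0 - c > 0" by simp
  obtain M where M: "M > 0" "\<And>x. x \<in> D \<Longrightarrow> norm x \<le> M"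
    using assms(2) bounded_pos by blast
  \<comment> \<open>The quadratic adds at most a quarter of the gap on \<open>D\<close>, and near
    the frontier \<open>u\<close> exceeds \<open>c\<close> by at most half of it; together they stay
    below \<open>u x0\<close>.\<close>
  define e where "e = (u x0 - c) / (4 * M\<^sup>2)"
  have e: "e > 0" "e * M\<^sup>2 = (u x0 - c) / 4" using gap M(1) by (auto simp: e_def)
  define v where "v = (\<lambda>x. u x + e * (norm x)\<^sup>2)"
  have contv: "continuous_on D v" unfolding v_def by (intro continuous_intros cont)
  \<comment> \<open>This superlevel set is compact although \<open>v\<close> is uncontrolled on the
    frontier: a sequence in it that converges to a frontier point would violate the boundary
    condition.\<close>
  define K where "K = {x \<in> D. v x \<ge> v x0}"
  have "closed K"
    unfolding closed_sequential_limits
  proof (intro allI impI, elim conjE)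
    fix f z assume f: "\<forall>n. f n \<in> K" and lim: "f \<longlonglongrightarrow> z"
    have fD: "f n \<in> D" and fv: "v (f n) \<ge> v x0" for n using f by (auto simp: K_def)
    have zc: "z \<in> closure D" using fD lim closure_sequential by blast
    have zD: "z \<in> D"
    proof (rule ccontr)
      assume zn: "z \<notin> D"
      then have zf: "z \<in> frontier D" using zc assms(1) by (simp add: frontier_def interior_open)
      have ev: "\<forall>\<^sub>F y in at z within D. u y \<le> c + (u x0 - c) / 2"
        using bdry[OF zf, of "(u x0 - c) / 2"] gap by simp
      have fl: "filterlim f (at z within D) sequentially"
        unfolding filterlim_at using lim fD zn by (auto intro!: always_eventually)
      have "\<forall>\<^sub>F n in sequentially. u (f n) \<le> c + (u x0 - c) / 2"
        using ev fl by (rule eventually_compose_filterlim)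
      then obtain n where n: "u (f n) \<le> c + (u x0 - c) / 2"
        unfolding eventually_sequentially by blast
      have "(norm (f n))\<^sup>2 \<le> M\<^sup>2" using M(2)[OF fD] by (intro power_mono) auto
      then have "e * (norm (f n))\<^sup>2 \<le> (u x0 - c) / 4" using e by (metis less_eq_real_def mult_left_mono)
      moreover have "v x0 \<ge> u x0" using e by (simp add: v_def)
      moreover have "v (f n) = u (f n) + e * (norm (f n))\<^sup>2" by (simp add: v_def)
      ultimately show False using n fv[of n] gap by argo
    qed
    have "(\<lambda>n. v (f n)) \<longlonglongrightarrow> v z"
      using contv lim zD fD by (simp add: continuous_on_sequentially o_def)
    then have "v x0 \<le> v z" using fv by (intro tendsto_lowerbound[of _ _ sequentially]) auto
    then show "z \<in> K" using zD by (simp add: K_def)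
  qed
  moreover have "bounded K" using assms(2) by (rule bounded_subset) (auto simp: K_def)
  ultimately have "compact K" by (simp add: compact_eq_bounded_closed)
  moreover have "K \<noteq> {}" using x0 by (auto simp: K_def)
  moreover have "continuous_on K v" using contv by (rule continuous_on_subset) (auto simp: K_def)
  ultimately obtain y where y: "y \<in> K" "\<And>x. x \<in> K \<Longrightarrow> v x \<le> v y"
    using continuous_attains_sup by metis
  have yD: "y \<in> D" and ymax: "\<And>x. x \<in> D \<Longrightarrow> v x \<le> v y"
    using y by (auto simp: K_def) (metis (mono_tags, lifting) le_cases order_trans)
  obtain d where d: "d > 0" "ball y d \<subseteq> D" using assms(1) yD openE by blast
  have lim: "((\<lambda>r. discrete_laplacian r u y / r\<^sup>2) \<longlongrightarrow> 0) (at_right 0)"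
    using harm yD by (auto simp: asymptotically_harmonic_on_def)
  have "\<forall>\<^sub>F r in at_right 0. discrete_laplacian r u y / r\<^sup>2 > - e"
    using order_tendstoD(1)[OF lim, of "-e"] e by simp
  moreover have "\<forall>\<^sub>F r in at_right (0::real). 0 < r \<and> r < d"
    using d by (auto simp: eventually_at_right_field)
  ultimately have "\<forall>\<^sub>F r in at_right 0. discrete_laplacian r u y / r\<^sup>2 > - e \<and> 0 < r \<and> r < d"
    by eventually_elim auto
  then obtain r where r: "discrete_laplacian r u y / r\<^sup>2 > - e" "0 < r" "r < d"
    using eventually_happens trivial_limit_at_right_real by blast
  have "v (y + r *\<^sub>R axis i 1) \<le> v y" "v (y - r *\<^sub>R axis i 1) \<le> v y" for i :: 2
    by (rule ymax, rule subsetD[OF d(2)], use r in \<open>simp add: dist_norm\<close>)+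
  then have "discrete_laplacian r v y \<le> 0"
    unfolding discrete_laplacian_def by (intro sum_nonpos) (smt (verit))
  moreover have "discrete_laplacian r v y = discrete_laplacian r u y + e * (4 * r\<^sup>2)"
    unfolding v_def by (simp add: discrete_laplacian_add discrete_laplacian_cmult discrete_laplacian_norm_square)
  moreover have "discrete_laplacian r u y > - e * r\<^sup>2" using r by (simp add: field_simps)
  moreover have "e * r\<^sup>2 > 0" using e(1) r(2) by simp
  ultimately show False by simp
qed

text \<open>One application of l'Hospital's rule reduces the claim to the symmetric difference
  quotient of \<open>f'\<close>, which converges as soon as \<open>f'\<close> is differentiable at
  the single point 0.\<close>

lemma second_difference_tendsto:
  fixes f f' :: "real \<Rightarrow> real"
  assumes d: "d > 0" and f: "\<And>t. \<bar>t\<bar> < d \<Longrightarrow> (f has_real_derivative f' t) (at t)"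
    and f': "(f' has_real_derivative c) (at 0)"
  shows "((\<lambda>r. (f r + f (- r) - 2 * f 0) / r\<^sup>2) \<longlongrightarrow> c) (at_right 0)"
proof (rule lhopital_right_0[where f' = "\<lambda>r. f' r - f' (- r)" and g' = "\<lambda>r. 2 * r"])
  have c0: "isCont f 0" using f[of 0] d by (simp add: DERIV_isCont)
  have c1: "isCont (\<lambda>r. f (- r)) 0" using isCont_o2[where f = uminus and a = "0::real" and g = f] c0 by simp
  have "((\<lambda>r. f r + f (- r) - 2 * f 0) \<longlongrightarrow> f 0 + f (- 0) - 2 * f 0) (at 0)"
    by (intro tendsto_add tendsto_diff tendsto_const c0[unfolded isCont_def] c1[unfolded isCont_def])
  then have "((\<lambda>r. f r + f (- r) - 2 * f 0) \<longlongrightarrow> 0) (at 0)" by simp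
  then show "((\<lambda>r. f r + f (- r) - 2 * f 0) \<longlongrightarrow> 0) (at_right 0)"
    by (rule tendsto_mono[rotated]) (simp add: at_le)
  show "((\<lambda>r::real. r\<^sup>2) \<longlongrightarrow> 0) (at_right 0)" by (auto intro!: tendsto_eq_intros)
  show "\<forall>\<^sub>F r in at_right (0::real). r\<^sup>2 \<noteq> 0" by (auto simp: eventually_at_right_field intro!: exI[of _ 1])
  show "\<forall>\<^sub>F r in at_right (0::real). 2 * r \<noteq> 0" by (auto simp: eventually_at_right_field intro!: exI[of _ 1])
  have "\<forall>\<^sub>F r in at_right 0. 0 < r \<and> r < d" using d by (auto simp: eventually_at_right_field)
  then show "\<forall>\<^sub>F r in at_right 0. ((\<lambda>r. f r + f (- r) - 2 * f 0) has_real_derivative f' r - f' (- r)) (at r)"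
  proof eventually_elim
    case (elim r)
    have "((\<lambda>r. f (- r)) has_real_derivative f' (- r) * (- 1)) (at r)"
      by (rule DERIV_chain2[of f "f' (- r)" uminus]) (use elim in \<open>auto intro!: f derivative_eq_intros\<close>)
    then show ?case using elim by (auto intro!: derivative_eq_intros f)
  qed
  show "\<forall>\<^sub>F r in at_right (0::real). ((\<lambda>r. r\<^sup>2) has_real_derivative 2 * r) (at r)"
    by (auto intro!: always_eventually derivative_eq_intros)
  have 1: "((\<lambda>r. (f' r - f' 0) / r) \<longlongrightarrow> c) (at 0)"
    using f' by (simp add: DERIV_def)
  have 2: "((\<lambda>r. (f' (- r) - f' 0) / (- r)) \<longlongrightarrow> c) (at 0)"
    by (rule filterlim_compose[OF 1]) (simp add: filterlim_def filtermap_at_minus)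
  have "((\<lambda>r. ((f' r - f' 0) / r + (f' (- r) - f' 0) / (- r)) / 2) \<longlongrightarrow> (c + c) / 2) (at 0)"
    by (intro tendsto_intros 1 2) simp
  moreover have "((f' r - f' 0) / r + (f' (- r) - f' 0) / (- r)) / 2 = (f' r - f' (- r)) / (2 * r)" for r
    by (simp add: diff_divide_distrib)
  ultimately have "((\<lambda>r. (f' r - f' (- r)) / (2 * r)) \<longlongrightarrow> (c + c) / 2) (at 0)" by (simp only:)
  then have "((\<lambda>r. (f' r - f' (- r)) / (2 * r)) \<longlongrightarrow> c) (at 0)" by simp
  then show "((\<lambda>r. (f' r - f' (- r)) / (2 * r)) \<longlongrightarrow> c) (at_right 0)"
    by (rule tendsto_mono[rotated]) (simp add: at_le)
qed

lemma Ck_on_Suc_has_derivative: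
  assumes "open D" "Ck_on (Suc k) D u" "x + t *\<^sub>R axis i 1 \<in> D"
  shows "((\<lambda>t. u (x + t *\<^sub>R axis i 1)) has_real_derivative partial_deriv i u (x + t *\<^sub>R axis i 1)) (at t)"
proof -
  let ?y = "x + t *\<^sub>R axis i 1"
  have "(\<lambda>s. u (?y + s *\<^sub>R axis i 1)) differentiable (at 0)" using assms by auto
  then have "((\<lambda>s. u (?y + s *\<^sub>R axis i 1)) has_real_derivative partial_deriv i u ?y) (at 0)"
    unfolding partial_deriv_def by (metis DERIV_deriv_iff_real_differentiable)
  then have "((\<lambda>s. u (x + (s + t) *\<^sub>R axis i 1)) has_real_derivative partial_deriv i u ?y) (at 0)"
    by (simp add: algebra_simps)
  then show ?thesis using DERIV_shift[of "\<lambda>t. u (x + t *\<^sub>R axis i 1)" _ 0 t] by simp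
qed

lemma harmonic_on_imp_asymptotically:
  assumes "open D" "harmonic_on D u"
  shows "asymptotically_harmonic_on D u"
  unfolding asymptotically_harmonic_on_def
proof
  fix x assume x: "x \<in> D"
  obtain d where d: "d > 0" "ball x d \<subseteq> D" using assms(1) x openE by blast
  have C2: "Ck_on (Suc (Suc 0)) D u" using assms(2) by (simp add: harmonic_on_def numeral_2_eq_2)
  have 1: "((\<lambda>r. (u (x + r *\<^sub>R axis i 1) + u (x - r *\<^sub>R axis i 1) - 2 * u x) / r\<^sup>2)
          \<longlongrightarrow> partial_deriv i (partial_deriv i u) x) (at_right 0)" for i
  proof -
    have in_D: "x + t *\<^sub>R axis i 1 \<in> D" if "\<bar>t\<bar> < d" for t
      using that d(2) by (auto simp: dist_norm)
    have "((\<lambda>t. u (x + t *\<^sub>R axis i 1)) has_real_derivative partial_deriv i u (x + t *\<^sub>R axis i 1)) (at t)"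
      if "\<bar>t\<bar> < d" for t
      by (rule Ck_on_Suc_has_derivative[OF assms(1) C2 in_D[OF that]])
    moreover have "((\<lambda>t. partial_deriv i u (x + t *\<^sub>R axis i 1)) has_real_derivative
        partial_deriv i (partial_deriv i u) x) (at 0)"
      using Ck_on_Suc_has_derivative[OF assms(1), of 0 "partial_deriv i u" x 0 i] C2 x by auto
    ultimately show ?thesis
      using second_difference_tendsto[OF d(1), of "\<lambda>t. u (x + t *\<^sub>R axis i 1)"
          "\<lambda>t. partial_deriv i u (x + t *\<^sub>R axis i 1)"] by simp
  qed
  have "((\<lambda>r. \<Sum>i\<in>UNIV. (u (x + r *\<^sub>R axis i 1) + u (x - r *\<^sub>R axis i 1) - 2 * u x) / r\<^sup>2)
          \<longlongrightarrow> (\<Sum>i\<in>UNIV. partial_deriv i (partial_deriv i u) x)) (at_right 0)"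
    by (intro tendsto_intros 1)
  then show "((\<lambda>r. discrete_laplacian r u x / r\<^sup>2) \<longlongrightarrow> 0) (at_right 0)"
    using assms(2) x by (simp add: harmonic_on_def discrete_laplacian_def sum_divide_distrib)
qed

lemma discrete_laplacian_translate:
  "discrete_laplacian r (\<lambda>x. f (x - y)) x = discrete_laplacian r f (x - y)"
  by (simp add: discrete_laplacian_def algebra_simps)

text \<open>The product \<open>P\<close> of the four squared distances differs from \<open>(norm z)\<^sup>8\<close> only by terms of order \<open>r\<^sup>4\<close>.\<close>

lemma discrete_laplacian_ln_norm:
  assumes r: "r > 0" "2 * r \<le> norm z"
  shows "\<bar>discrete_laplacian r (\<lambda>z. ln (norm z)) z\<bar> \<le> 7 * r ^ 4 / norm z ^ 4"
proof -
  define s where "s = (norm z)\<^sup>2"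
  have s_def': "s = (z $ 1)\<^sup>2 + (z $ 2)\<^sup>2"
    unfolding s_def power2_norm_eq_inner inner_vec_def sum_2 by (simp add: power2_eq_square)
  have "4 * r\<^sup>2 \<le> s" using power_mono[OF r(2), of 2] r by (simp add: s_def power_mult_distrib)
  then have s: "s > 0" "4 * r\<^sup>2 \<le> s" using r by (auto intro: less_le_trans[of 0 "4 * r\<^sup>2"])
  have np: "(norm (z + r *\<^sub>R axis i 1))\<^sup>2 = s + r\<^sup>2 + 2 * r * z $ i"
    and nm: "(norm (z - r *\<^sub>R axis i 1))\<^sup>2 = s + r\<^sup>2 - 2 * r * z $ i" for i :: 2
    unfolding s_def power2_norm_eq_inner
    by (simp_all add: algebra_simps inner_axis_axis inner_axis inner_axis' power2_eq_square)
  have pp: "norm (z + r *\<^sub>R axis i 1) > 0" and pm: "norm (z - r *\<^sub>R axis i 1) > 0" for i :: 2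
  proof -
    have na: "norm (r *\<^sub>R (axis i 1 :: real^2)) = r" using r by simp
    have "norm z \<le> norm (z + r *\<^sub>R axis i 1) + norm (r *\<^sub>R (axis i 1 :: real^2))"
      using norm_triangle_ineq4[of "z + r *\<^sub>R axis i 1" "r *\<^sub>R axis i 1"] by (simp only: add_diff_cancel_right')
    then show "norm (z + r *\<^sub>R axis i 1) > 0" using r na by linarith
    have "norm z \<le> norm (z - r *\<^sub>R axis i 1) + norm (r *\<^sub>R (axis i 1 :: real^2))"
      using norm_triangle_ineq[of "z - r *\<^sub>R axis i 1" "r *\<^sub>R axis i 1"] by (simp only: diff_add_cancel)
    then show "norm (z - r *\<^sub>R axis i 1) > 0" using r na by linarith
  qed
  have nz: "norm z > 0" using r by linarith
  have ln4: "ln (a * b * c * d) = ln a + ln b + ln c + ln d"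
    if "a > 0" "b > 0" "c > 0" "d > 0" for a b c d :: real using that by (simp add: ln_mult_pos)
  have ln2: "2 * ln t = ln (t\<^sup>2)" if "t > 0" for t :: real using that by (simp add: ln_realpow)
  define t where "t = r ^ 4 / s\<^sup>2"
  define P where "P = (s + r\<^sup>2 + 2 * r * z $ 1) * (s + r\<^sup>2 - 2 * r * z $ 1) *
      (s + r\<^sup>2 + 2 * r * z $ 2) * (s + r\<^sup>2 - 2 * r * z $ 2)"
  have pos: "s + r\<^sup>2 + 2 * r * z $ i > 0" "s + r\<^sup>2 - 2 * r * z $ i > 0" for i :: 2
    using pp[of i] pm[of i] by (simp_all flip: np nm)
  then have "P > 0" unfolding P_def by (intro mult_pos_pos)
  have "2 * discrete_laplacian r (\<lambda>z. ln (norm z)) z = ln P - 4 * ln s"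
  proof -
    have "2 * discrete_laplacian r (\<lambda>z. ln (norm z)) z =
       (\<Sum>i\<in>UNIV. 2 * ln (norm (z + r *\<^sub>R axis i 1)) + 2 * ln (norm (z - r *\<^sub>R axis i 1)) - 2 * (2 * ln (norm z)))"
      unfolding discrete_laplacian_def sum_distrib_left by (intro sum.cong) auto
    also have "\<dots> = (\<Sum>i\<in>UNIV. ln (s + r\<^sup>2 + 2 * r * z $ i) + ln (s + r\<^sup>2 - 2 * r * z $ i) - 2 * ln s)"
      unfolding ln2[OF pp] ln2[OF pm] ln2[OF nz] np nm s_def[symmetric] ..
    also have "\<dots> = ln P - 4 * ln s"
      unfolding P_def sum_2 ln4[OF pos pos] by simp
    finally show ?thesis .
  qed
  also have "\<dots> = ln (P / s ^ 4)" using \<open>P > 0\<close> s by (simp add: ln_div ln_realpow)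
  finally have eq: "2 * discrete_laplacian r (\<lambda>z. ln (norm z)) z = ln (1 + (P / s ^ 4 - 1))" by simp
  have Peq: "P = s ^ 4 - 2 * s\<^sup>2 * r ^ 4 + r ^ 8 + 16 * r ^ 4 * ((z $ 1)\<^sup>2 * (z $ 2)\<^sup>2)"
    unfolding P_def s_def' by algebra
  \<comment> \<open>The arithmetic-geometric mean inequality for the two squared
    coordinates.\<close>
  have ab: "(z $ 1)\<^sup>2 * (z $ 2)\<^sup>2 \<le> s\<^sup>2 / 4" "0 \<le> (z $ 1)\<^sup>2 * (z $ 2)\<^sup>2"
    using zero_le_power2[of "(z $ 1)\<^sup>2 - (z $ 2)\<^sup>2"] unfolding s_def' by (auto simp: power2_sum power2_diff)
  have t: "0 \<le> t" "t \<le> 1 / 16"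
  proof -
    have "(4 * r\<^sup>2)\<^sup>2 \<le> s\<^sup>2" using s r by (intro power_mono) auto
    then show "t \<le> 1 / 16" using s by (simp add: t_def field_simps power_mult_distrib flip: power_mult)
  qed (simp add: t_def)
  have Pt: "P / s ^ 4 - 1 = - 2 * t + t\<^sup>2 + 16 * t * ((z $ 1)\<^sup>2 * (z $ 2)\<^sup>2 / s\<^sup>2)"
    using s unfolding Peq t_def by (simp add: field_simps flip: power_mult power_add)
  define w where "w = (z $ 1)\<^sup>2 * (z $ 2)\<^sup>2 / s\<^sup>2"
  have w: "0 \<le> w" "w \<le> 1 / 4" using ab s by (auto simp: w_def field_simps)
  have tw: "0 \<le> t * w" "t * w \<le> t / 4" using w t mult_left_mono[of w "1/4" t] by auto
  have tt: "0 \<le> t\<^sup>2" "t\<^sup>2 \<le> t / 16" using t mult_left_mono[of t "1/16" t] by (auto simp: power2_eq_square)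
  define q where "q = P / s ^ 4 - 1"
  \<comment> \<open>The constant 7 is generous; what matters is \<open>7 / 16 \<le> 1 / 2\<close>,
    so that the quadratic remainder bound for \<open>ln (1 + q)\<close> applies. It gives a factor
    2, which cancels against the factor 2 in \<open>eq\<close>.\<close>
  have u: "\<bar>q\<bar> \<le> 7 * t" unfolding q_def Pt w_def[symmetric] mult.assoc abs_le_iff using tw tt t by linarith
  have q2: "\<bar>q\<bar> \<le> 1 / 2" using u t by linarith
  then have "\<bar>ln (1 + q) - q\<bar> \<le> 2 * q\<^sup>2"
    by (rule abs_ln_one_plus_x_minus_x_bound)
  moreover have "q\<^sup>2 \<le> \<bar>q\<bar> * (1/2)"
    using mult_left_mono[OF q2, of "\<bar>q\<bar>"] by (simp add: power2_eq_square abs_mult_self_eq)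
  ultimately have "\<bar>ln (1 + q)\<bar> \<le> 2 * \<bar>q\<bar>" by linarith
  then have "\<bar>discrete_laplacian r (\<lambda>z. ln (norm z)) z\<bar> \<le> 7 * t" using eq u unfolding q_def[symmetric] by linarith
  then show ?thesis by (simp add: t_def s_def flip: power_mult)
qed

section \<open>The logarithmic kernel and the closed form of the maximum principle\<close>

definition log_kernel :: "real^2 \<Rightarrow> real^2 \<Rightarrow> real" where
  "log_kernel x y = 1 / (2 * pi) * ln (1 / norm (x - y))"

text \<open>Valid on the diagonal too, where the default values of division and \<open>ln\<close>
  make both sides 0.\<close>

lemma log_kernel_eq: "log_kernel x y = - ln (norm (x - y)) / (2 * pi)"
  by (cases "x = y") (simp_all add: log_kernel_def ln_div)

lemma log_kernel_commute: "log_kernel x y = log_kernel y x"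
  by (simp add: log_kernel_def norm_minus_commute)

lemma log_kernel_translate: "log_kernel (x + v) (y + v) = log_kernel x y"
  by (simp add: log_kernel_def)

lemma discrete_laplacian_log_kernel:
  assumes "r > 0" "2 * r \<le> norm (x - y)"
  shows "\<bar>discrete_laplacian r (\<lambda>x. log_kernel x y) x\<bar> \<le> 7 * r ^ 4 / norm (x - y) ^ 4"
proof -
  have "discrete_laplacian r (\<lambda>x. log_kernel x y) x = (- 1 / (2 * pi)) * discrete_laplacian r (\<lambda>z. ln (norm z)) (x - y)"
    unfolding discrete_laplacian_translate[symmetric] discrete_laplacian_cmult[symmetric] by (simp add: log_kernel_eq)
  then have "\<bar>discrete_laplacian r (\<lambda>x. log_kernel x y) x\<bar> = (1 / (2 * pi)) * \<bar>discrete_laplacian r (\<lambda>z. ln (norm z)) (x - y)\<bar>"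
    by (simp add: abs_mult)
  also have "\<dots> \<le> 1 * \<bar>discrete_laplacian r (\<lambda>z. ln (norm z)) (x - y)\<bar>"
    using pi_gt3 by (intro mult_right_mono) auto
  also have "\<dots> \<le> 7 * r ^ 4 / norm (x - y) ^ 4" using discrete_laplacian_ln_norm[OF assms] by simp
  finally show ?thesis .
qed

lemma tendsto_discrete_laplacian_quotient:
  assumes "\<rho> > 0" and "\<And>r. 0 < r \<Longrightarrow> 2 * r \<le> \<rho> \<Longrightarrow> \<bar>discrete_laplacian r u x\<bar> \<le> C * r ^ 4"
  shows "((\<lambda>r. discrete_laplacian r u x / r\<^sup>2) \<longlongrightarrow> 0) (at_right 0)"
proof (rule Lim_null_comparison)
  have "\<forall>\<^sub>F r in at_right (0::real). 0 < r \<and> r < \<rho> / 2"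
    using assms(1) by (auto simp: eventually_at_right_field intro!: exI[of _ "\<rho> / 2"])
  then show "\<forall>\<^sub>F r in at_right 0. norm (discrete_laplacian r u x / r\<^sup>2) \<le> C * r\<^sup>2"
  proof eventually_elim
    case (elim r)
    then have "\<bar>discrete_laplacian r u x\<bar> / r\<^sup>2 \<le> C * r ^ 4 / r\<^sup>2"
      using assms(2)[of r] by (intro divide_right_mono) auto
    also have "C * r ^ 4 / r\<^sup>2 = C * r\<^sup>2" using elim by (simp add: field_simps flip: power_add)
    finally show ?case by simp
  qed
  show "((\<lambda>r. C * r\<^sup>2) \<longlongrightarrow> 0) (at_right 0)" by (auto intro!: tendsto_eq_intros)
qed

lemma asymptotically_harmonic_on_log_kernel:
  "asymptotically_harmonic_on (- {x}) (log_kernel x)"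
  unfolding asymptotically_harmonic_on_def
proof
  fix y assume y: "y \<in> - {x}"
  have "log_kernel x = (\<lambda>y. log_kernel y x)" by (auto simp: log_kernel_commute)
  then show "((\<lambda>r. discrete_laplacian r (log_kernel x) y / r\<^sup>2) \<longlongrightarrow> 0) (at_right 0)"
    using y discrete_laplacian_log_kernel[of _ y x]
    by (intro tendsto_discrete_laplacian_quotient[of "norm (y - x)" _ _ "7 / norm (y - x) ^ 4"]) auto
qed

lemma abs_ln_diff_le:
  fixes a b :: real
  assumes "a > 0" "b > 0"
  shows "\<bar>ln a - ln b\<bar> \<le> \<bar>a - b\<bar> * (1 / a + 1 / b)"
proof -
  have 1: "ln a - ln b \<le> (a - b) / b" if "a > 0" "b > 0" for a b :: real
    using ln_le_minus_one[of "a / b"] that by (simp add: ln_div field_simps)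
  have 2: "(a - b) / b \<le> \<bar>a - b\<bar> * (1 / a + 1 / b)" if "a > 0" "b > 0" for a b :: real
  proof -
    have "(a - b) / b \<le> \<bar>a - b\<bar> / b" using that by (intro divide_right_mono) auto
    also have "\<dots> \<le> \<bar>a - b\<bar> * (1 / a + 1 / b)" using that by (simp add: distrib_left)
    finally show ?thesis .
  qed
  show ?thesis using 1[of a b] 2[of a b] 1[of b a] 2[of b a] assms
    by (simp add: abs_le_iff abs_minus_commute add.commute)
qed

text \<open>Applying a bound for \<open>ln\<close> to the two distances, instead of the mean value
  theorem along the segment from \<open>x\<close> to \<open>x'\<close>, allows \<open>y\<close> to
  lie on or near that segment. The two reciprocals are integrated separately later.\<close>

lemma abs_log_kernel_diff_le:
  assumes "x \<noteq> y" "x' \<noteq> y"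
  shows "\<bar>log_kernel x y - log_kernel x' y\<bar> \<le> norm (x - x') * (1 / norm (x - y) + 1 / norm (x' - y))"
proof -
  let ?a = "norm (x - y)" and ?b = "norm (x' - y)"
  have "\<bar>log_kernel x y - log_kernel x' y\<bar> = (1 / (2 * pi)) * \<bar>ln ?b - ln ?a\<bar>"
    by (simp add: log_kernel_eq abs_mult flip: diff_divide_distrib)
  also have "\<dots> \<le> 1 * \<bar>ln ?b - ln ?a\<bar>" using pi_gt3 by (intro mult_right_mono) auto
  also have "\<dots> \<le> \<bar>?b - ?a\<bar> * (1 / ?b + 1 / ?a)" using abs_ln_diff_le[of ?b ?a] assms by simp
  also have "\<dots> \<le> norm (x - x') * (1 / ?b + 1 / ?a)"
    using norm_triangle_ineq3[of "x' - y" "x - y"] by (intro mult_right_mono) (auto simp: norm_minus_commute)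
  finally show ?thesis by (simp add: add.commute)
qed

lemma asymptotically_harmonic_on_add:
  assumes "asymptotically_harmonic_on D u" "asymptotically_harmonic_on D v"
  shows "asymptotically_harmonic_on D (\<lambda>x. u x + v x)"
  unfolding asymptotically_harmonic_on_def
proof
  fix x assume x: "x \<in> D"
  have "((\<lambda>r. discrete_laplacian r u x / r\<^sup>2 + discrete_laplacian r v x / r\<^sup>2) \<longlongrightarrow> 0 + 0) (at_right 0)"
    using assms x by (intro tendsto_intros) (auto simp: asymptotically_harmonic_on_def)
  then show "((\<lambda>r. discrete_laplacian r (\<lambda>x. u x + v x) x / r\<^sup>2) \<longlongrightarrow> 0) (at_right 0)"
    by (simp add: discrete_laplacian_add add_divide_distrib)
qed

lemma asymptotically_harmonic_on_cmult:
  assumes "asymptotically_harmonic_on D u"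
  shows "asymptotically_harmonic_on D (\<lambda>x. c * u x)"
  using asymptotically_harmonic_on_sum[of "{()}" D "\<lambda>_. u" "\<lambda>_. c"] assms by simp

lemma maximum_principle_closure:
  assumes "open D" "bounded D" "continuous_on (closure D) u" "asymptotically_harmonic_on D u"
    and "\<And>p. p \<in> frontier D \<Longrightarrow> u p \<le> c" and "x \<in> D"
  shows "u x \<le> c"
proof (rule maximum_principle[OF assms(1,2) _ assms(4) _ assms(6)])
  show "continuous_on D u" using assms(3) closure_subset by (rule continuous_on_subset)
  fix p \<eta> assume p: "p \<in> frontier D" and "\<eta> > (0::real)"
  have "p \<in> closure D" using p by (simp add: frontier_def)
  then have "(u \<longlongrightarrow> u p) (at p within closure D)" using assms(3) by (simp add: continuous_on)
  then have "(u \<longlongrightarrow> u p) (at p within D)" by (rule tendsto_within_subset) (rule closure_subset)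
  then have "\<forall>\<^sub>F y in at p within D. u y < c + \<eta>"
    by (rule order_tendstoD) (use assms(5)[OF p] \<open>\<eta> > 0\<close> in linarith)
  then show "\<forall>\<^sub>F y in at p within D. u y \<le> c + \<eta>" by eventually_elim simp
qed

lemma maximum_principle_abs:
  assumes "open D" "bounded D" "continuous_on (closure D) u" "asymptotically_harmonic_on D u"
    and "\<And>p. p \<in> frontier D \<Longrightarrow> \<bar>u p\<bar> \<le> c" and "x \<in> D"
  shows "\<bar>u x\<bar> \<le> c"
proof -
  have "u x \<le> c" by (rule maximum_principle_closure[OF assms(1-4) _ assms(6)]) (use assms(5) abs_le_D1 in blast)
  moreover have "(-1) * u x \<le> c"
    by (rule maximum_principle_closure[OF assms(1,2) _ asymptotically_harmonic_on_cmult[OF assms(4)] _ assms(6)])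
      (auto intro!: continuous_intros assms(3) dest!: assms(5))
  ultimately show ?thesis by simp
qed

lemma log_kernel_ge:
  assumes "x \<noteq> y" "norm (x - y) \<le> exp (- (2 * pi * M))"
  shows "log_kernel x y \<ge> M"
proof -
  have "ln (norm (x - y)) \<le> ln (exp (- (2 * pi * M)))" using assms by (subst ln_le_cancel_iff) auto
  then show ?thesis by (simp add: log_kernel_eq field_simps)
qed

lemma continuous_on_log_kernel:
  "continuous_on {(x, y). x \<noteq> y} (\<lambda>(x, y). log_kernel x y)"
  unfolding log_kernel_eq case_prod_unfold by (intro continuous_intros) auto

lemma continuous_on_log_kernel':
  assumes "continuous_on S f" "continuous_on S g" "\<And>x. x \<in> S \<Longrightarrow> f x \<noteq> g x"
  shows "continuous_on S (\<lambda>x. log_kernel (f x) (g x))"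
  unfolding log_kernel_eq using assms by (intro continuous_intros) auto

section \<open>Regularity, positivity and symmetry derived from the boundary values of the regular
  part\<close>

locale green_function =
  fixes D :: "(real^2) set" and G h :: "real^2 \<Rightarrow> real^2 \<Rightarrow> real"
  assumes open_D: "open D" and bounded_D: "bounded D" and green: "is_green_function D G h"
begin

lemma G_eq: "x \<in> D \<Longrightarrow> y \<in> closure D \<Longrightarrow> y \<noteq> x \<Longrightarrow> G x y = log_kernel x y - h x y"
  using green by (simp add: is_green_function_def log_kernel_def)

lemma continuous_h: "x \<in> D \<Longrightarrow> continuous_on (closure D) (h x)"
  using green by (simp add: is_green_function_def)

lemma harmonic_h: "x \<in> D \<Longrightarrow> harmonic_on D (h x)"
  using green by (simp add: is_green_function_def)

lemma asymptotically_harmonic_h: "x \<in> D \<Longrightarrow> asymptotically_harmonic_on D (h x)"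
  using harmonic_on_imp_asymptotically[OF open_D] harmonic_h by blast

lemma not_in_frontier: "x \<in> D \<Longrightarrow> x \<notin> frontier D"
  using open_D by (simp add: frontier_def interior_open)

lemma h_frontier:
  assumes "x \<in> D" "z \<in> frontier D" shows "h x z = log_kernel x z"
proof -
  have "z \<noteq> x" using assms not_in_frontier by blast
  moreover have "z \<in> closure D" using assms by (simp add: frontier_def)
  moreover have "G x z = 0" using green assms by (simp add: is_green_function_def)
  ultimately show ?thesis using G_eq[of x z] assms by simp
qed

text \<open>As a function of \<open>y\<close> the difference is harmonic, with a difference of
  logarithms as boundary values; these are Lipschitz in \<open>x\<close> away from the frontier, and
  the maximum principle carries the bound inside.\<close>

lemma h_diff_le:
  assumes "x \<in> D" "x' \<in> D" "\<rho> > 0" "y \<in> D"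
    and "\<And>z. z \<in> frontier D \<Longrightarrow> norm (x - z) \<ge> \<rho>" "\<And>z. z \<in> frontier D \<Longrightarrow> norm (x' - z) \<ge> \<rho>"
  shows "\<bar>h x y - h x' y\<bar> \<le> norm (x - x') * (2 / \<rho>)"
proof (rule maximum_principle_abs[OF open_D bounded_D _ _ _ assms(4)])
  show "continuous_on (closure D) (\<lambda>y. h x y - h x' y)"
    by (intro continuous_intros continuous_h assms)
  show "asymptotically_harmonic_on D (\<lambda>y. h x y - h x' y)"
    by (intro asymptotically_harmonic_on_diff asymptotically_harmonic_h assms)
  fix z assume z: "z \<in> frontier D"
  have n: "norm (x - z) \<ge> \<rho>" "norm (x' - z) \<ge> \<rho>" using assms z by auto
  then have ne: "x \<noteq> z" "x' \<noteq> z" using \<open>\<rho> > 0\<close> by auto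
  have "1 / norm (x - z) + 1 / norm (x' - z) \<le> 1 / \<rho> + 1 / \<rho>"
    using n \<open>\<rho> > 0\<close> by (intro add_mono frac_le) auto
  then have "norm (x - x') * (1 / norm (x - z) + 1 / norm (x' - z)) \<le> norm (x - x') * (2 / \<rho>)"
    by (intro mult_left_mono) auto
  then show "\<bar>h x z - h x' z\<bar> \<le> norm (x - x') * (2 / \<rho>)"
    using abs_log_kernel_diff_le[OF ne] z assms by (simp add: h_frontier)
qed

lemma frontier_distance:
  assumes "ball x \<rho> \<subseteq> D" "z \<in> frontier D" shows "norm (x - z) \<ge> \<rho>"
  using assms not_in_frontier by (metis dist_norm in_mono linorder_not_le mem_ball)

lemma h_locally_lipschitz:
  assumes "ball x (2 * \<rho>) \<subseteq> D" "\<rho> > 0" "x1 \<in> ball x \<rho>" "x2 \<in> ball x \<rho>" "y \<in> D"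
  shows "\<bar>h x1 y - h x2 y\<bar> \<le> norm (x1 - x2) * (2 / \<rho>)"
proof -
  have sub: "ball w \<rho> \<subseteq> D" if "w \<in> ball x \<rho>" for w
  proof
    fix v assume "v \<in> ball w \<rho>"
    then have "dist x v < 2 * \<rho>" using that dist_triangle[of x v w] by simp
    then show "v \<in> D" using assms(1) by auto
  qed
  then have "w \<in> D" if "w \<in> ball x \<rho>" for w using that assms(2) by (meson centre_in_ball subsetD)
  then show ?thesis
    using assms sub frontier_distance by (intro h_diff_le) auto
qed

text \<open>For fixed \<open>x\<close> and \<open>r\<close> this is a finite linear combination of
  functions harmonic in \<open>y\<close>. On the frontier it equals the five-point Laplacian of the
  logarithm, whose pole is at distance at least \<open>\<rho>\<close> from \<open>x\<close>.\<close>

lemma discrete_laplacian_h_fst: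
  assumes x: "x \<in> D" "cball x \<rho> \<subseteq> D" and y: "y \<in> D" and r: "0 < r" "2 * r \<le> \<rho>"
  shows "\<bar>discrete_laplacian r (\<lambda>x. h x y) x\<bar> \<le> 7 / \<rho> ^ 4 * r ^ 4"
proof -
  have \<rho>: "\<rho> > 0" using r by simp
  have inD: "x + r *\<^sub>R axis i 1 \<in> D" "x - r *\<^sub>R axis i 1 \<in> D" for i :: 2
    by (rule subsetD[OF x(2)], use r in \<open>simp add: dist_norm\<close>)+
  show ?thesis
    unfolding discrete_laplacian_def
  proof (rule maximum_principle_abs[OF open_D bounded_D _ _ _ y])
    show "continuous_on (closure D) (\<lambda>y. \<Sum>i\<in>UNIV. h (x + r *\<^sub>R axis i 1) y + h (x - r *\<^sub>R axis i 1) y - 2 * h x y)"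
      by (intro continuous_intros continuous_h inD x)
    have "asymptotically_harmonic_on D (\<lambda>y. \<Sum>i\<in>UNIV. 1 * (h (x + r *\<^sub>R axis i 1) y + h (x - r *\<^sub>R axis i 1) y - 2 * h x y))"
      by (intro asymptotically_harmonic_on_sum asymptotically_harmonic_on_diff asymptotically_harmonic_on_add
          asymptotically_harmonic_on_cmult asymptotically_harmonic_h inD x)
    then show "asymptotically_harmonic_on D (\<lambda>y. \<Sum>i\<in>UNIV. h (x + r *\<^sub>R axis i 1) y + h (x - r *\<^sub>R axis i 1) y - 2 * h x y)"
      by simp
    fix z assume z: "z \<in> frontier D"
    have n: "norm (x - z) \<ge> \<rho>" using frontier_distance[OF order_trans[OF ball_subset_cball x(2)] z] .
    have "7 * r ^ 4 / norm (x - z) ^ 4 \<le> 7 * r ^ 4 / \<rho> ^ 4"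
      using n \<rho> by (intro frac_le power_mono) auto
    moreover have "\<bar>discrete_laplacian r (\<lambda>x. log_kernel x z) x\<bar> \<le> 7 * r ^ 4 / norm (x - z) ^ 4"
      using n r by (intro discrete_laplacian_log_kernel) auto
    ultimately show "\<bar>\<Sum>i\<in>UNIV. h (x + r *\<^sub>R axis i 1) z + h (x - r *\<^sub>R axis i 1) z - 2 * h x z\<bar> \<le> 7 / \<rho> ^ 4 * r ^ 4"
      using z inD x by (simp add: discrete_laplacian_def h_frontier)
  qed
qed

lemma cball_in_D: assumes "x \<in> D" obtains \<rho> where "\<rho> > 0" "cball x \<rho> \<subseteq> D"
  using assms open_D open_contains_cball by blast

lemma asymptotically_harmonic_h_fst:
  assumes y: "y \<in> D" shows "asymptotically_harmonic_on D (\<lambda>x. h x y)"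
  unfolding asymptotically_harmonic_on_def
proof
  fix x assume x: "x \<in> D"
  obtain \<rho> where "\<rho> > 0" "cball x \<rho> \<subseteq> D" using cball_in_D[OF x] .
  then show "((\<lambda>r. discrete_laplacian r (\<lambda>x. h x y) x / r\<^sup>2) \<longlongrightarrow> 0) (at_right 0)"
    by (intro tendsto_discrete_laplacian_quotient[of \<rho> _ _ "7 / \<rho> ^ 4"] discrete_laplacian_h_fst x y)
qed

text \<open>Continuity in \<open>y\<close> for the fixed point \<open>x\<close>, together with a
  Lipschitz bound in the first argument that is uniform in the second.\<close>

lemma continuous_on_h_joint: "continuous_on (D \<times> D) (\<lambda>(x, y). h x y)"
  unfolding continuous_on
proof
  fix p assume "p \<in> D \<times> D"
  then obtain x y where p: "p = (x, y)" and x: "x \<in> D" and y: "y \<in> D" by auto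
  obtain \<rho>' where \<rho>': "\<rho>' > 0" "cball x \<rho>' \<subseteq> D" using cball_in_D[OF x] .
  define \<rho> where "\<rho> = \<rho>' / 2"
  have \<rho>: "\<rho> > 0" "ball x (2 * \<rho>) \<subseteq> D" using \<rho>' by (auto simp: \<rho>_def)
  have lim1: "((\<lambda>q. fst q) \<longlongrightarrow> x) (at p within D \<times> D)" "((\<lambda>q. snd q) \<longlongrightarrow> y) (at p within D \<times> D)"
    using p by (auto intro!: tendsto_eq_intros)
  have "isCont (h x) y"
    using continuous_on_subset[OF continuous_h[OF x] closure_subset] y open_D
    by (simp add: continuous_on_eq_continuous_at)
  then have c2: "((\<lambda>q. h x (snd q)) \<longlongrightarrow> h x y) (at p within D \<times> D)"
    by (rule isCont_tendsto_compose[OF _ lim1(2)])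
  have "((\<lambda>q. h (fst q) (snd q) - h x (snd q)) \<longlongrightarrow> 0) (at p within D \<times> D)"
  proof (rule Lim_null_comparison)
    have "\<forall>\<^sub>F q in at p within D \<times> D. fst q \<in> ball x \<rho>"
      using lim1(1) \<rho>(1) by (intro topological_tendstoD) auto
    moreover have "\<forall>\<^sub>F q in at p within D \<times> D. q \<in> D \<times> D" by (simp add: eventually_at_filter)
    ultimately show "\<forall>\<^sub>F q in at p within D \<times> D. norm (h (fst q) (snd q) - h x (snd q)) \<le> norm (fst q - x) * (2 / \<rho>)"
    proof eventually_elim
      case (elim q)
      then show ?case using h_locally_lipschitz[OF \<rho>(2,1), of "fst q" x "snd q"] \<rho>(1) by auto
    qed
    show "((\<lambda>q. norm (fst q - x) * (2 / \<rho>)) \<longlongrightarrow> 0) (at p within D \<times> D)"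
      by (rule tendsto_eq_intros lim1 refl | simp)+
  qed
  from tendsto_add[OF this c2]
  show "((\<lambda>(x, y). h x y) \<longlongrightarrow> (case p of (x, y) \<Rightarrow> h x y)) (at p within D \<times> D)"
    by (simp add: p case_prod_unfold)
qed

text \<open>This is the nonnegativity of the Green function. The maximum principle is applied on
  \<open>D - {x}\<close>: the difference tends to 0 at the frontier of \<open>D\<close>, and at the
  puncture the logarithm outgrows the continuous function \<open>h x\<close>.\<close>

lemma h_le_log_kernel:
  assumes x: "x \<in> D" and y: "y \<in> D" "y \<noteq> x"
  shows "h x y \<le> log_kernel x y"
proof -
  have "h x y - log_kernel x y \<le> 0"
  proof (rule maximum_principle[where D = "D - {x}" and u = "\<lambda>y. h x y - log_kernel x y"])
    show "open (D - {x})" "bounded (D - {x})" "y \<in> D - {x}"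
      using open_D bounded_D y by (auto intro: bounded_subset)
    have c: "continuous_on (closure D - {x}) (\<lambda>y. h x y - log_kernel x y)"
      by (intro continuous_intros continuous_on_log_kernel' continuous_on_subset[OF continuous_h[OF x]]) auto
    then show "continuous_on (D - {x}) (\<lambda>y. h x y - log_kernel x y)"
      by (rule continuous_on_subset) (use closure_subset in auto)
    show "asymptotically_harmonic_on (D - {x}) (\<lambda>y. h x y - log_kernel x y)"
      by (intro asymptotically_harmonic_on_diff asymptotically_harmonic_on_subset[OF asymptotically_harmonic_h[OF x]]
          asymptotically_harmonic_on_subset[OF asymptotically_harmonic_on_log_kernel]) auto
    fix p \<eta> assume p: "p \<in> frontier (D - {x})" and \<eta>: "\<eta> > (0::real)"
    show "\<forall>\<^sub>F y in at p within D - {x}. h x y - log_kernel x y \<le> 0 + \<eta>"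
    proof (cases "p = x")
      case True
      have "isCont (h x) x"
        using continuous_on_subset[OF continuous_h[OF x] closure_subset] x open_D
        by (simp add: continuous_on_eq_continuous_at)
      then have "(h x \<longlongrightarrow> h x x) (at x within D - {x})"
        by (simp add: isCont_def tendsto_within_subset[of _ _ _ UNIV])
      then have 1: "\<forall>\<^sub>F y in at x within D - {x}. h x y < h x x + 1" by (rule order_tendstoD) simp
      \<comment> \<open>Within this radius the logarithm is at least \<open>h x x + 1\<close>, while
        \<open>h x\<close> stays below that value.\<close>
      have 2: "\<forall>\<^sub>F y in at x within D - {x}. y \<noteq> x \<and> dist y x < exp (- (2 * pi * (h x x + 1)))"
        by (auto simp: eventually_at intro!: exI[of _ "exp (- (2 * pi * (h x x + 1)))"])
      show ?thesis unfolding True using 1 2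
      proof eventually_elim
        case (elim y)
        then have "log_kernel x y \<ge> h x x + 1" by (intro log_kernel_ge) (auto simp: dist_norm norm_minus_commute)
        then show ?case using elim \<eta> by simp
      qed
    next
      case False
      have "p \<in> closure D" "p \<notin> D - {x}"
        using p interior_open[OF open_delete[OF open_D, of x]] closure_mono[of "D - {x}" D] by (auto simp: frontier_def)
      then have pD: "p \<in> frontier D" using False open_D by (simp add: frontier_def interior_open)
      have "((\<lambda>y. h x y - log_kernel x y) \<longlongrightarrow> h x p - log_kernel x p) (at p within closure D - {x})"
        using c \<open>p \<in> closure D\<close> False by (simp add: continuous_on)
      then have "((\<lambda>y. h x y - log_kernel x y) \<longlongrightarrow> 0) (at p within D - {x})"
        using pD x by (auto simp: h_frontier intro: tendsto_within_subset closure_subset[THEN subsetD])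
      then have "\<forall>\<^sub>F y in at p within D - {x}. h x y - log_kernel x y < \<eta>" using \<eta> by (rule order_tendstoD)
      then show ?thesis by eventually_elim simp
    qed
  qed
  then show ?thesis by simp
qed

text \<open>At the boundary \<open>h y x - h x y\<close> is at most \<open>G x y\<close>, which vanishes there; hence no boundary
  regularity of \<open>h\<close> in its first argument is needed.\<close>

lemma h_le_h_swap:
  assumes x: "x \<in> D" and y: "y \<in> D"
  shows "h y x \<le> h x y"
proof -
  have "h y x - h x y \<le> 0"
  proof (rule maximum_principle[OF open_D bounded_D, where u = "\<lambda>y. h y x - h x y"])
    have "continuous_on D (\<lambda>y. (\<lambda>(x, y). h x y) (y, x) - h x y)"
      using x by (intro continuous_intros continuous_on_compose2[OF continuous_on_h_joint]
          continuous_on_subset[OF continuous_h[OF x] closure_subset]) auto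
    then show "continuous_on D (\<lambda>y. h y x - h x y)" by simp
    show "asymptotically_harmonic_on D (\<lambda>y. h y x - h x y)"
      by (intro asymptotically_harmonic_on_diff asymptotically_harmonic_h asymptotically_harmonic_h_fst x)
    fix p \<eta> assume p: "p \<in> frontier D" and \<eta>: "\<eta> > (0::real)"
    have px: "p \<noteq> x" "p \<in> closure D" using p x not_in_frontier by (auto simp: frontier_def)
    have "continuous_on (closure D - {x}) (\<lambda>y. log_kernel x y - h x y)"
      by (intro continuous_intros continuous_on_log_kernel' continuous_on_subset[OF continuous_h[OF x]]) auto
    then have "((\<lambda>y. log_kernel x y - h x y) \<longlongrightarrow> log_kernel x p - h x p) (at p within closure D - {x})"
      using px by (simp add: continuous_on)
    then have "((\<lambda>y. log_kernel x y - h x y) \<longlongrightarrow> 0) (at p within D - {x})"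
      using p x by (auto simp: h_frontier intro: tendsto_within_subset closure_subset[THEN subsetD])
    then have "\<forall>\<^sub>F y in at p within D - {x}. log_kernel x y - h x y < \<eta>" using \<eta> by (rule order_tendstoD)
    then have ev: "\<forall>\<^sub>F y in at p within D. y \<noteq> x \<longrightarrow> log_kernel x y - h x y < \<eta>"
      by (auto simp: eventually_at_filter elim!: eventually_mono)
    have "\<forall>\<^sub>F y in at p within D. y \<in> D" by (simp add: eventually_at_filter)
    moreover have "\<forall>\<^sub>F y in at p within D. y \<noteq> x"
      using px(1) by (auto simp: eventually_at_topological intro!: exI[of _ "- {x}"])
    ultimately show "\<forall>\<^sub>F y in at p within D. h y x - h x y \<le> 0 + \<eta>" using ev
    proof eventually_elim
      case (elim y)
      then show ?case using h_le_log_kernel[of y x] x by (simp add: log_kernel_commute)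
    qed
  qed (rule y)
  then show ?thesis by simp
qed

lemma h_commute: "x \<in> D \<Longrightarrow> y \<in> D \<Longrightarrow> h x y = h y x"
  using h_le_h_swap[of x y] h_le_h_swap[of y x] by simp

text \<open>Symmetry turns the derivative in the first argument into one of the harmonic function
  \<open>h y\<close>.\<close>

lemma h_fst_differentiable:
  assumes "x \<in> D" "y \<in> D"
  shows "\<exists>c. ((\<lambda>t. h (x + t *\<^sub>R axis i 1) y) has_real_derivative c) (at 0)"
proof -
  obtain \<rho> where \<rho>: "\<rho> > 0" "cball x \<rho> \<subseteq> D" using cball_in_D[OF assms(1)] .
  have C2: "Ck_on (Suc (Suc 0)) D (h y)"
    using harmonic_h[OF assms(2)] by (simp add: harmonic_on_def numeral_2_eq_2)
  have *: "((\<lambda>t. h y (x + t *\<^sub>R axis i 1)) has_real_derivative partial_deriv i (h y) (x + 0 *\<^sub>R axis i 1)) (at 0)"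
    by (rule Ck_on_Suc_has_derivative[OF open_D C2]) (use assms in simp)
  have "((\<lambda>t. h (x + t *\<^sub>R axis i 1) y) has_real_derivative partial_deriv i (h y) (x + 0 *\<^sub>R axis i 1)) (at 0)"
  proof (rule DERIV_cong_ev[THEN iffD1, OF refl _ refl *])
    have "\<forall>\<^sub>F t in nhds (0::real). \<bar>t\<bar> < \<rho>"
      using \<rho> by (auto simp: eventually_nhds_metric dist_norm)
    then show "\<forall>\<^sub>F t in nhds 0. h y (x + t *\<^sub>R axis i 1) = h (x + t *\<^sub>R axis i 1) y"
    proof eventually_elim
      case (elim t)
      then have "x + t *\<^sub>R axis i 1 \<in> D" by (intro subsetD[OF \<rho>(2)]) (simp add: dist_norm)
      then show ?case using h_commute assms by simp
    qed
  qed
  then show ?thesis by blast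
qed

end

section \<open>Weakly singular kernels and logarithmic potentials\<close>

text \<open>Dyadic annuli replace polar coordinates: where the distance lies between
  \<open>R / 2 ^ Suc n\<close> and \<open>R / 2 ^ n\<close>, the integrand is at most
  \<open>2 ^ Suc n / R\<close>, and the enclosing disc has area
  \<open>pi * R\<^sup>2 / 4 ^ n\<close>. The geometric series gives \<open>4 * pi * R\<close>, twice
  the exact value.\<close>

lemma nn_integral_inverse_norm_ball:
  fixes x :: "real^2"
  assumes "R \<ge> 0"
  shows "(\<integral>\<^sup>+y. ennreal (1 / norm (x - y)) * indicator (ball x R) y \<partial>lborel) \<le> ennreal (4 * pi * R)"
proof (cases "R = 0")
  case False
  then have R: "R > 0" using assms by simp
  have pw: "ennreal (1 / norm (x - y)) * indicator (ball x R) y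
      \<le> (\<Sum>n. ennreal (2 ^ Suc n / R) * indicator (ball x (R / 2 ^ n)) y)" for y
  proof (cases "y \<in> ball x R \<and> y \<noteq> x")
    case True
    define s where "s = norm (x - y)"
    have s: "s > 0" "s < R" using True by (auto simp: s_def dist_norm)
    have "\<exists>n. R / 2 ^ Suc n \<le> s"
    proof -
      obtain n where "R / s < 2 ^ n" using real_arch_pow[of 2 "R / s"] by auto
      then have "R / 2 ^ Suc n \<le> s" using s R by (simp add: field_simps)
      then show ?thesis ..
    qed
    then obtain n where n: "R / 2 ^ Suc n \<le> s" and least: "\<And>m. m < n \<Longrightarrow> \<not> R / 2 ^ Suc m \<le> s"
      using exists_least_iff[of "\<lambda>n. R / 2 ^ Suc n \<le> s"] by blast
    have "s < R / 2 ^ n"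
    proof (cases n)
      case (Suc m)
      then show ?thesis using least[of m] by simp
    qed (use s in simp)
    then have "y \<in> ball x (R / 2 ^ n)" by (simp add: s_def dist_norm)
    moreover have "1 / s \<le> 2 ^ Suc n / R" using n s R by (simp add: field_simps)
    ultimately have "ennreal (1 / norm (x - y)) * indicator (ball x R) y
        \<le> ennreal (2 ^ Suc n / R) * indicator (ball x (R / 2 ^ n)) y"
      using True by (simp add: s_def ennreal_leI)
    also have "\<dots> \<le> (\<Sum>n. ennreal (2 ^ Suc n / R) * indicator (ball x (R / 2 ^ n)) y)"
      using sum_le_suminf[of "\<lambda>n. ennreal (2 ^ Suc n / R) * indicator (ball x (R / 2 ^ n)) y" "{n}"]
      by (simp del: sum_mult_indicator)
    finally show ?thesis .
  qed auto
  have area: "emeasure lborel (ball x r) = ennreal (pi * r\<^sup>2)" if "r \<ge> 0" for r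
    using emeasure_ball[OF that, of x] by (simp add: unit_ball_vol_2)
  have [measurable]: "ball x r \<in> sets borel" for r by simp
  have "(\<integral>\<^sup>+y. ennreal (1 / norm (x - y)) * indicator (ball x R) y \<partial>lborel)
      \<le> (\<integral>\<^sup>+y. (\<Sum>n. ennreal (2 ^ Suc n / R) * indicator (ball x (R / 2 ^ n)) y) \<partial>lborel)"
    by (intro nn_integral_mono pw)
  also have "\<dots> = (\<Sum>n. \<integral>\<^sup>+y. ennreal (2 ^ Suc n / R) * indicator (ball x (R / 2 ^ n)) y \<partial>lborel)"
    by (intro nn_integral_suminf) measurable
  also have "\<dots> = (\<Sum>n. ennreal (2 ^ Suc n / R) * emeasure lborel (ball x (R / 2 ^ n)))"
    by (simp add: nn_integral_cmult_indicator)
  also have "\<dots> = (\<Sum>n. ennreal (2 * pi * R * (1 / 2) ^ n))"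
  proof (rule suminf_cong)
    fix n
    show "ennreal (2 ^ Suc n / R) * emeasure lborel (ball x (R / 2 ^ n)) = ennreal (2 * pi * R * (1 / 2) ^ n)"
      using R by (simp add: area power2_eq_square power_divide flip: ennreal_mult')
  qed
  also have "\<dots> = ennreal (\<Sum>n. 2 * pi * R * (1 / 2) ^ n)"
    using R by (intro suminf_ennreal2 summable_mult summable_geometric) auto
  also have "(\<Sum>n. 2 * pi * R * (1 / 2) ^ n) = 2 * pi * R * (\<Sum>n. (1 / 2) ^ n)"
    by (intro suminf_mult summable_geometric) simp
  also have "\<dots> = 4 * pi * R" by (subst suminf_geometric) auto
  finally show ?thesis .
qed simp

lemma inverse_norm_ball:
  fixes x :: "real^2"
  assumes "R \<ge> 0"
  shows integrable_inverse_norm_ball: "integrable lborel (\<lambda>y. indicator (ball x R) y * (1 / norm (x - y)))" (is ?I)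
    and integral_inverse_norm_ball: "(LINT y|lborel. indicator (ball x R) y * (1 / norm (x - y))) \<le> 4 * pi * R" (is ?B)
proof -
  have eq: "ennreal (indicator (ball x R) y * (1 / norm (x - y))) = ennreal (1 / norm (x - y)) * indicator (ball x R) y" for y
    by (simp split: split_indicator)
  have b: "(\<integral>\<^sup>+y. ennreal (indicator (ball x R) y * (1 / norm (x - y))) \<partial>lborel) \<le> ennreal (4 * pi * R)"
    unfolding eq by (rule nn_integral_inverse_norm_ball[OF assms])
  have m: "(\<lambda>y. indicator (ball x R) y * (1 / norm (x - y))) \<in> borel_measurable lborel"
    by (intro borel_measurable_times borel_measurable_divide borel_measurable_indicator) auto
  show ?I
  proof (rule integrableI_nonneg[OF m])
    show "(\<integral>\<^sup>+y. ennreal (indicator (ball x R) y * (1 / norm (x - y))) \<partial>lborel) < \<infinity>"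
      using b by (rule le_less_trans) simp
  qed auto
  show ?B
    by (subst integral_eq_nn_integral[OF m]) (use b assms in \<open>auto intro!: enn2real_leI\<close>)
qed

section \<open>Potentials and bilinear forms of bounded densities\<close>

definition bounded_supported :: "(real^2) set \<Rightarrow> (real^2 \<Rightarrow> real) \<Rightarrow> bool" where
  "bounded_supported S f \<longleftrightarrow> f \<in> borel_measurable borel \<and> bounded (range f) \<and> (\<forall>x. x \<notin> S \<longrightarrow> f x = 0)"

lemma bounded_supportedI:
  assumes "f \<in> borel_measurable borel" "\<And>x. \<bar>f x\<bar> \<le> A" "\<And>x. x \<notin> S \<Longrightarrow> f x = 0"
  shows "bounded_supported S f"
  using assms by (auto simp: bounded_supported_def bounded_iff)

lemma bounded_supportedE:
  assumes "bounded_supported S f"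
  obtains A where "A > 0" "\<And>x. \<bar>f x\<bar> \<le> A"
  using assms by (auto simp: bounded_supported_def bounded_pos)

lemma bounded_supported_measurable[measurable_dest]:
  "bounded_supported S f \<Longrightarrow> f \<in> borel_measurable borel"
  by (simp add: bounded_supported_def)

lemma bounded_supported_lincomb:
  assumes "bounded_supported S f" "bounded_supported S g"
  shows "bounded_supported S (\<lambda>x. a * f x + b * g x)"
proof -
  note [measurable] = assms
  obtain A B where A: "A > 0" "\<And>x. \<bar>f x\<bar> \<le> A" and B: "B > 0" "\<And>x. \<bar>g x\<bar> \<le> B"
    using assms by (metis bounded_supportedE)
  show ?thesis
  proof (rule bounded_supportedI)
    fix x
    have "\<bar>a * f x + b * g x\<bar> \<le> \<bar>a\<bar> * \<bar>f x\<bar> + \<bar>b\<bar> * \<bar>g x\<bar>"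
      using abs_triangle_ineq[of "a * f x" "b * g x"] by (simp add: abs_mult)
    also have "\<dots> \<le> \<bar>a\<bar> * A + \<bar>b\<bar> * B" by (intro add_mono mult_left_mono A B) auto
    finally show "\<bar>a * f x + b * g x\<bar> \<le> \<bar>a\<bar> * A + \<bar>b\<bar> * B" .
    show "a * f x + b * g x = 0" if "x \<notin> S" using that assms by (simp add: bounded_supported_def)
  qed measurable
qed

lemma bounded_supported_diff:
  "bounded_supported S f \<Longrightarrow> bounded_supported S g \<Longrightarrow> bounded_supported S (\<lambda>x. f x - g x)"
  using bounded_supported_lincomb[of S f g 1 "-1"] by simp

lemma bounded_supported_mono: "bounded_supported S f \<Longrightarrow> S \<subseteq> T \<Longrightarrow> bounded_supported T f"
  by (auto simp: bounded_supported_def)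

lemma bounded_supported_integrable:
  assumes f: "bounded_supported S f" and S: "bounded S"
  shows "integrable lborel f"
proof -
  obtain A where A: "A > 0" "\<And>x. \<bar>f x\<bar> \<le> A" using f by (metis bounded_supportedE)
  obtain r where r: "S \<subseteq> ball 0 r" using S bounded_subset_ballD by blast
  have fin: "emeasure lborel (ball (0::real^2) r) < \<infinity>"
    using emeasure_bounded_finite[of "ball (0::real^2) r"] by simp
  have [measurable]: "f \<in> borel_measurable borel" using f by (simp add: bounded_supported_def)
  show ?thesis
  proof (rule Bochner_Integration.integrable_bound)
    show "integrable lborel (\<lambda>x. A * indicator (ball (0::real^2) r) x)"
      using fin by (intro integrable_mult_right integrable_real_indicator) auto
    show "AE x in lborel. norm (f x) \<le> norm (A * indicator (ball 0 r) x)"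
      using A f r by (intro AE_I2) (auto simp: bounded_supported_def split: split_indicator)
  qed simp
qed

definition potential :: "(real^2 \<Rightarrow> real^2 \<Rightarrow> real) \<Rightarrow> (real^2 \<Rightarrow> real) \<Rightarrow> real^2 \<Rightarrow> real" where
  "potential K f x = (LINT y|lborel. K x y * f y)"

definition interaction :: "(real^2 \<Rightarrow> real^2 \<Rightarrow> real) \<Rightarrow> (real^2 \<Rightarrow> real) \<Rightarrow> (real^2 \<Rightarrow> real) \<Rightarrow> real" where
  "interaction K f g = (LINT x|lborel. f x * potential K g x)"

text \<open>A common frame for \<open>log_kernel\<close>, \<open>h\<close> and \<open>g\<close>. The
  bound by a reciprocal distance is much weaker than a logarithmic one, but it is integrable in the
  plane. Measurability is asked only after cutting off to \<open>S\<close>, since \<open>h\<close>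
  is not controlled outside \<open>D\<close>; densities vanish at every point outside
  \<open>S\<close>, so the cutoff disappears in products.\<close>

locale weakly_singular_kernel =
  fixes S :: "(real^2) set" and K :: "real^2 \<Rightarrow> real^2 \<Rightarrow> real" and C d :: real
  assumes S_borel[measurable]: "S \<in> sets borel"
    and C_nonneg: "C \<ge> 0" and S_diam: "\<And>x y. x \<in> S \<Longrightarrow> y \<in> S \<Longrightarrow> dist x y < d"
    and K_measurable[measurable]: "(\<lambda>(x, y). indicator S x * indicator S y * K x y) \<in> borel_measurable borel"
    and K_bound: "\<And>x y. x \<in> S \<Longrightarrow> y \<in> S \<Longrightarrow> x \<noteq> y \<Longrightarrow> \<bar>K x y\<bar> \<le> C / norm (x - y)"
begin

lemma bounded_S: "bounded S"
proof (cases "S = {}")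
  case False
  then obtain x where "x \<in> S" by blast
  then have "S \<subseteq> ball x d" using S_diam by auto
  then show ?thesis using bounded_ball bounded_subset by blast
qed simp

lemma d_nonneg: "x \<in> S \<Longrightarrow> d \<ge> 0"
  using S_diam[of x x] by simp

lemma K_measurable_pair: "(\<lambda>(x, y). indicator S x * indicator S y * K x y) \<in> borel_measurable (lborel \<Otimes>\<^sub>M lborel)"
  using K_measurable by (simp add: lborel_prod)

lemma K_integrand_measurable:
  assumes x: "x \<in> S" and f: "bounded_supported S f"
  shows "(\<lambda>y. K x y * f y) \<in> borel_measurable lborel"
proof -
  have [measurable]: "f \<in> borel_measurable borel" using f by (simp add: bounded_supported_def)
  have "(\<lambda>y. (\<lambda>(x, y). indicator S x * indicator S y * K x y) (x, y) * f y) \<in> borel_measurable lborel"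
    by measurable
  also have "(\<lambda>y. (\<lambda>(x, y). indicator S x * indicator S y * K x y) (x, y) * f y) = (\<lambda>y. K x y * f y)"
    using x f by (auto simp: bounded_supported_def fun_eq_iff split: split_indicator)
  finally show ?thesis .
qed

lemma K_integrand_bound:
  assumes x: "x \<in> S" and f: "bounded_supported S f" and A: "A \<ge> 0" "\<And>x. \<bar>f x\<bar> \<le> A" and y: "y \<noteq> x"
  shows "\<bar>K x y * f y\<bar> \<le> A * C * (indicator (ball x d) y * (1 / norm (x - y)))"
proof (cases "y \<in> S")
  case True
  then have "y \<in> ball x d" using S_diam x by auto
  have "\<bar>K x y\<bar> * \<bar>f y\<bar> \<le> (C / norm (x - y)) * A"
    using K_bound[of x y] x True y A C_nonneg by (intro mult_mono) auto
  then show ?thesis using \<open>y \<in> ball x d\<close> by (simp add: abs_mult mult.commute)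
qed (use f A C_nonneg in \<open>auto simp: bounded_supported_def split: split_indicator\<close>)

lemma K_integrand_integrable:
  assumes x: "x \<in> S" and f: "bounded_supported S f"
  shows "integrable lborel (\<lambda>y. K x y * f y)"
proof -
  obtain A where A: "A > 0" "\<And>x. \<bar>f x\<bar> \<le> A" using f by (metis bounded_supportedE)
  show ?thesis
  proof (rule Bochner_Integration.integrable_bound[OF _ K_integrand_measurable[OF assms]])
    show "integrable lborel (\<lambda>y. A * C * (indicator (ball x d) y * (1 / norm (x - y))))"
      using d_nonneg[OF x] by (intro integrable_mult_right inverse_norm_ball)
    show "AE y in lborel. norm (K x y * f y) \<le> norm (A * C * (indicator (ball x d) y * (1 / norm (x - y))))"
      using AE_lborel_singleton[of x]
    proof eventually_elim
      case (elim y)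
      show ?case unfolding real_norm_def
        by (rule order_trans[OF K_integrand_bound[OF x f _ A(2) elim] abs_ge_self]) (use A in simp)
    qed
  qed
qed

lemma norm_potential_bound:
  assumes x: "x \<in> S" and f: "bounded_supported S f" and A: "A \<ge> 0" "\<And>x. \<bar>f x\<bar> \<le> A"
  shows "(LINT y|lborel. \<bar>K x y * f y\<bar>) \<le> A * C * (4 * pi * d)"
proof -
  have "(LINT y|lborel. \<bar>K x y * f y\<bar>) \<le> (LINT y|lborel. A * C * (indicator (ball x d) y * (1 / norm (x - y))))"
  proof (rule integral_mono_AE)
    show "integrable lborel (\<lambda>y. \<bar>K x y * f y\<bar>)" using K_integrand_integrable[OF x f] by simp
    show "integrable lborel (\<lambda>y. A * C * (indicator (ball x d) y * (1 / norm (x - y))))"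
      using d_nonneg[OF x] by (intro integrable_mult_right inverse_norm_ball)
    show "AE y in lborel. \<bar>K x y * f y\<bar> \<le> A * C * (indicator (ball x d) y * (1 / norm (x - y)))"
      using AE_lborel_singleton[of x] by eventually_elim (rule K_integrand_bound[OF x f A])
  qed
  also have "\<dots> \<le> A * C * (4 * pi * d)"
    unfolding integral_mult_right_zero
    using d_nonneg[OF x] A C_nonneg by (intro mult_left_mono inverse_norm_ball) auto
  finally show ?thesis .
qed

lemma product_measurable:
  assumes f: "bounded_supported S f" and g: "bounded_supported S g"
  shows "(\<lambda>(x, y). f x * K x y * g y) \<in> borel_measurable (lborel \<Otimes>\<^sub>M lborel)"
proof -
  note [measurable] = K_measurable_pair
  have [measurable]: "f \<in> borel_measurable lborel" "g \<in> borel_measurable lborel"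
    using f g by (simp_all add: bounded_supported_def)
  have "(\<lambda>p. f (fst p) * (\<lambda>(x, y). indicator S x * indicator S y * K x y) p * g (snd p)) \<in> borel_measurable (lborel \<Otimes>\<^sub>M lborel)"
    by measurable
  also have "(\<lambda>p. f (fst p) * (\<lambda>(x, y). indicator S x * indicator S y * K x y) p * g (snd p)) = (\<lambda>(x, y). f x * K x y * g y)"
    using f g by (auto simp: bounded_supported_def fun_eq_iff split: split_indicator)
  finally show ?thesis .
qed

text \<open>Tonelli with the uniform bound for the inner integral; this justifies exchanging the
  integrals in \<open>interaction_commute\<close>.\<close>

lemma product_integrable:
  assumes f: "bounded_supported S f" and g: "bounded_supported S g"
  shows "integrable (lborel \<Otimes>\<^sub>M lborel) (\<lambda>(x, y). f x * K x y * g y)"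
proof -
  note m[measurable] = product_measurable[OF assms]
  obtain A where A: "A > 0" "\<And>x. \<bar>f x\<bar> \<le> A" using f by (metis bounded_supportedE)
  obtain B where B: "B > 0" "\<And>x. \<bar>g x\<bar> \<le> B" using g by (metis bounded_supportedE)
  have int: "integrable lborel (\<lambda>y. f x * K x y * g y)" for x
  proof (cases "x \<in> S")
    case True
    then show ?thesis using K_integrand_integrable[OF True g] by (simp add: mult.assoc)
  qed (use f in \<open>simp add: bounded_supported_def\<close>)
  show ?thesis
  proof (rule lborel_pair.Fubini_integrable[OF m])
    show "AE x in lborel. integrable lborel (\<lambda>y. case (x, y) of (x, y) \<Rightarrow> f x * K x y * g y)"
      using int by simp
    have [measurable]: "(\<lambda>x. LINT y|lborel. norm (case (x, y) of (x, y) \<Rightarrow> f x * K x y * g y)) \<in> borel_measurable lborel"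
      by measurable
    obtain r where r: "S \<subseteq> ball 0 r" using bounded_S bounded_subset_ballD by blast
    have fin: "emeasure lborel (ball (0::real^2) r) < \<infinity>"
      using emeasure_bounded_finite[of "ball (0::real^2) r"] by simp
    show "integrable lborel (\<lambda>x. LINT y|lborel. norm (case (x, y) of (x, y) \<Rightarrow> f x * K x y * g y))"
    proof (rule Bochner_Integration.integrable_bound)
      show "integrable lborel (\<lambda>x. A * (B * C * (4 * pi * d)) * indicator (ball (0::real^2) r) x)"
        using fin by (intro integrable_mult_right integrable_real_indicator) auto
      show "AE x in lborel. norm (LINT y|lborel. norm (case (x, y) of (x, y) \<Rightarrow> f x * K x y * g y))
         \<le> norm (A * (B * C * (4 * pi * d)) * indicator (ball 0 r) x)"
      proof (intro AE_I2)
        fix x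
        show "norm (LINT y|lborel. norm (case (x, y) of (x, y) \<Rightarrow> f x * K x y * g y))
         \<le> norm (A * (B * C * (4 * pi * d)) * indicator (ball 0 r) x)"
        proof (cases "x \<in> S")
          case True
          have "(LINT y|lborel. \<bar>f x * K x y * g y\<bar>) = \<bar>f x\<bar> * (LINT y|lborel. \<bar>K x y * g y\<bar>)"
            by (simp add: abs_mult mult.assoc)
          also have "\<dots> \<le> A * (B * C * (4 * pi * d))"
            using A B norm_potential_bound[OF True g _ B(2)] by (intro mult_mono) auto
          finally show ?thesis using True r
            by (auto simp: subset_iff intro!: order_trans[OF _ abs_ge_self])
        qed (use f in \<open>auto simp: bounded_supported_def\<close>)
      qed
    qed simp
  qed
qed

lemma interaction_eq_double_integral:
  "interaction K f g = (LINT x|lborel. LINT y|lborel. f x * K x y * g y)"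
  by (simp add: interaction_def potential_def mult.assoc)

lemma interaction_integrable:
  assumes f: "bounded_supported S f" and g: "bounded_supported S g"
  shows "integrable lborel (\<lambda>x. f x * potential K g x)"
  using lborel_pair.integrable_fst'[OF product_integrable[OF assms]]
  by (simp add: potential_def mult.assoc)

lemma interaction_commute:
  assumes f: "bounded_supported S f" and g: "bounded_supported S g"
    and sym: "\<And>x y. x \<in> S \<Longrightarrow> y \<in> S \<Longrightarrow> K x y = K y x"
  shows "interaction K f g = interaction K g f"
proof -
  have "interaction K f g = (LINT x|lborel. LINT y|lborel. f x * K x y * g y)"
    by (rule interaction_eq_double_integral)
  also have "\<dots> = (LINT y|lborel. LINT x|lborel. f x * K x y * g y)"
    by (rule lborel_pair.Fubini_integral[symmetric]) (rule product_integrable[OF f g])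
  also have "\<dots> = (LINT y|lborel. LINT x|lborel. g y * K y x * f x)"
  proof (intro Bochner_Integration.integral_cong refl)
    show "f x * K x y * g y = g y * K y x * f x" for x y
      using f g sym[of x y] by (cases "x \<in> S"; cases "y \<in> S") (auto simp: bounded_supported_def)
  qed
  finally show ?thesis by (simp add: interaction_eq_double_integral)
qed

lemma potential_lincomb:
  assumes x: "x \<in> S" and f: "bounded_supported S f" and g: "bounded_supported S g"
  shows "potential K (\<lambda>x. a * f x + b * g x) x = a * potential K f x + b * potential K g x"
proof -
  have "potential K (\<lambda>x. a * f x + b * g x) x = (LINT y|lborel. a * (K x y * f y) + b * (K x y * g y))"
    unfolding potential_def by (intro Bochner_Integration.integral_cong) (auto simp: algebra_simps)
  then show ?thesis
    using K_integrand_integrable[OF x f] K_integrand_integrable[OF x g] by (simp add: potential_def)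
qed

lemma interaction_lincomb_left:
  assumes f: "bounded_supported S f" and g: "bounded_supported S g" and u: "bounded_supported S u"
  shows "interaction K (\<lambda>x. a * f x + b * g x) u = a * interaction K f u + b * interaction K g u"
proof -
  have "interaction K (\<lambda>x. a * f x + b * g x) u
      = (LINT x|lborel. a * (f x * potential K u x) + b * (g x * potential K u x))"
    unfolding interaction_def by (intro Bochner_Integration.integral_cong) (auto simp: algebra_simps)
  then show ?thesis
    using interaction_integrable[OF f u] interaction_integrable[OF g u] by (simp add: interaction_def)
qed

lemma interaction_lincomb_right:
  assumes f: "bounded_supported S f" and g: "bounded_supported S g" and u: "bounded_supported S u"
  shows "interaction K u (\<lambda>x. a * f x + b * g x) = a * interaction K u f + b * interaction K u g"
proof -
  have "interaction K u (\<lambda>x. a * f x + b * g x)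
      = (LINT x|lborel. a * (u x * potential K f x) + b * (u x * potential K g x))"
    unfolding interaction_def
  proof (intro Bochner_Integration.integral_cong refl)
    fix x
    show "u x * potential K (\<lambda>x. a * f x + b * g x) x = a * (u x * potential K f x) + b * (u x * potential K g x)"
      using potential_lincomb[OF _ f g, of x] u by (cases "x \<in> S") (auto simp: bounded_supported_def algebra_simps)
  qed
  then show ?thesis
    using interaction_integrable[OF u f] interaction_integrable[OF u g] by (simp add: interaction_def)
qed

end

section \<open>Lipschitz bounds and partial derivatives of logarithmic potentials\<close>

lemma abs_log_kernel_le:
  assumes "x \<noteq> y" "dist x y < d"
  shows "\<bar>log_kernel x y\<bar> \<le> (d\<^sup>2 + 1) / norm (x - y)"
proof -
  let ?t = "norm (x - y)"
  have t: "?t > 0" "?t < d" using assms by (auto simp: dist_norm)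
  \<comment> \<open>The sum equals \<open>(?t\<^sup>2 + 1) / ?t\<close>, which is the origin of the
    constant \<open>d\<^sup>2 + 1\<close>.\<close>
  have "\<bar>ln ?t\<bar> \<le> ?t + 1 / ?t"
  proof -
    have "1 / ?t > 0" using t by simp
    moreover have "- ln ?t \<le> 1 / ?t - 1" using ln_le_minus_one[of "1 / ?t"] t by (simp add: ln_div)
    ultimately show ?thesis using ln_le_minus_one[of ?t] t unfolding abs_le_iff by linarith
  qed
  also have "\<dots> = (?t\<^sup>2 + 1) / ?t" using t by (simp add: field_simps power2_eq_square)
  also have "\<dots> \<le> (d\<^sup>2 + 1) / ?t" using t by (intro divide_right_mono add_right_mono power_mono) auto
  finally have "\<bar>ln ?t\<bar> \<le> (d\<^sup>2 + 1) / ?t" .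
  moreover have "\<bar>log_kernel x y\<bar> = (1 / (2 * pi)) * \<bar>ln ?t\<bar>" by (simp add: log_kernel_eq abs_mult)
  moreover have "(1 / (2 * pi)) * \<bar>ln ?t\<bar> \<le> 1 * \<bar>ln ?t\<bar>" using pi_gt3 by (intro mult_right_mono) auto
  ultimately show ?thesis by linarith
qed

lemma weakly_singular_log_kernel:
  assumes "S \<in> sets borel" "\<And>x y. x \<in> S \<Longrightarrow> y \<in> S \<Longrightarrow> dist x y < d"
  shows "weakly_singular_kernel S log_kernel (d\<^sup>2 + 1) d"
proof
  note [measurable] = assms(1)
  show "(\<lambda>(x, y). indicator S x * indicator S y * log_kernel x y) \<in> borel_measurable borel"
    unfolding borel_prod[symmetric] case_prod_unfold log_kernel_eq by measurable
qed (use assms abs_log_kernel_le in auto)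

text \<open>The squared norm is \<open>(norm z)\<^sup>2 * (1 + s)\<close>, and
  \<open>ln (1 + s)\<close> is expanded to first order. The condition with the factor 5 ensures
  \<open>\<bar>s\<bar> \<le> 1 / 2\<close>.\<close>

lemma ln_norm_taylor:
  fixes z :: "real^2"
  assumes "5 * \<bar>t\<bar> \<le> norm z" "z \<noteq> 0"
  shows "\<bar>ln (norm (z + t *\<^sub>R axis i 1)) - ln (norm z) - t * (z $ i / (norm z)\<^sup>2)\<bar> \<le> 6 * t\<^sup>2 / (norm z)\<^sup>2"
proof -
  define u where "u = \<bar>t\<bar> / norm z"
  define s where "s = 2 * t * (z $ i / (norm z)\<^sup>2) + t\<^sup>2 / (norm z)\<^sup>2"
  have z: "norm z > 0" using assms by simp
  have u: "0 \<le> u" "u \<le> 1 / 5" using assms by (auto simp: u_def field_simps)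
  have u2: "u\<^sup>2 = t\<^sup>2 / (norm z)\<^sup>2" by (simp add: u_def power_divide)
  have eq: "(norm (z + t *\<^sub>R axis i 1))\<^sup>2 = (norm z)\<^sup>2 * (1 + s)"
  proof -
    have "(norm (z + t *\<^sub>R axis i 1))\<^sup>2 = (norm z)\<^sup>2 + 2 * t * z $ i + t\<^sup>2"
      unfolding power2_norm_eq_inner by (simp add: algebra_simps inner_axis_axis inner_axis inner_axis' power2_eq_square)
    also have "\<dots> = (norm z)\<^sup>2 * (1 + s)" using z by (simp add: s_def field_simps)
    finally show ?thesis .
  qed
  have "\<bar>2 * t * (z $ i / (norm z)\<^sup>2)\<bar> \<le> 2 * \<bar>t\<bar> * (norm z / (norm z)\<^sup>2)"
    using component_le_norm_cart[of z i] z by (auto simp: abs_mult intro!: mult_left_mono divide_right_mono)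
  also have "\<dots> = 2 * u" using z by (simp add: u_def power2_eq_square)
  finally have b1: "\<bar>2 * t * (z $ i / (norm z)\<^sup>2)\<bar> \<le> 2 * u" .
  have uu: "u\<^sup>2 \<le> u / 5" using mult_left_mono[of u "1/5" u] u by (simp add: power2_eq_square)
  have b: "\<bar>s\<bar> \<le> 11 / 5 * u" unfolding s_def u2[symmetric] using b1 uu abs_triangle_ineq[of "2 * t * (z $ i / (norm z)\<^sup>2)" "u\<^sup>2"]
    by (simp add: abs_of_nonneg)
  then have "\<bar>s\<bar> \<le> 1 / 2" using u by linarith
  then have 1: "\<bar>ln (1 + s) - s\<bar> \<le> 2 * s\<^sup>2" by (rule abs_ln_one_plus_x_minus_x_bound)
  have "s\<^sup>2 \<le> (11 / 5 * u)\<^sup>2" using b by (metis abs_ge_zero power2_abs power_mono)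
  then have 2: "s\<^sup>2 \<le> 121 / 25 * u\<^sup>2" by (simp add: power_mult_distrib power_divide)
  have s1: "1 + s > 0" using \<open>\<bar>s\<bar> \<le> 1 / 2\<close> by linarith
  have "2 * ln (norm (z + t *\<^sub>R axis i 1)) = ln ((norm (z + t *\<^sub>R axis i 1))\<^sup>2)"
  proof -
    have "norm (z + t *\<^sub>R axis i 1) \<noteq> 0" using eq s1 z by (metis mult_eq_0_iff less_irrefl zero_eq_power2)
    then show ?thesis by (simp add: ln_realpow)
  qed
  also have "\<dots> = 2 * ln (norm z) + ln (1 + s)" unfolding eq using z s1 by (simp add: ln_mult ln_realpow)
  finally have 3: "2 * ln (norm (z + t *\<^sub>R axis i 1)) = 2 * ln (norm z) + ln (1 + s)" .
  have "s = 2 * (t * (z $ i / (norm z)\<^sup>2)) + u\<^sup>2" by (simp add: s_def u2)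
  \<comment> \<open>Twice the remainder is at most \<open>2 * s\<^sup>2 + u\<^sup>2\<close>, hence
    at most \<open>(242 / 25 + 1) * u\<^sup>2\<close>, which is below
    \<open>12 * u\<^sup>2\<close>.\<close>
  with 1 2 3 have "\<bar>ln (norm (z + t *\<^sub>R axis i 1)) - ln (norm z) - t * (z $ i / (norm z)\<^sup>2)\<bar> \<le> 6 * u\<^sup>2"
    using zero_le_power2[of u] unfolding abs_le_iff by linarith
  then show ?thesis by (simp add: u2)
qed

definition log_kernel_partial :: "2 \<Rightarrow> real^2 \<Rightarrow> real^2 \<Rightarrow> real" where
  "log_kernel_partial i x y = - ((x - y) $ i) / (2 * pi * (norm (x - y))\<^sup>2)"

lemma abs_log_kernel_partial_le: "\<bar>log_kernel_partial i x y\<bar> \<le> 1 / norm (x - y)"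
proof (cases "x = y")
  case False
  then have n: "norm (x - y) > 0" by simp
  have "\<bar>log_kernel_partial i x y\<bar> = 1 / (2 * pi) * (\<bar>(x - y) $ i\<bar> / (norm (x - y))\<^sup>2)"
    by (simp add: log_kernel_partial_def abs_mult abs_minus_commute)
  also have "\<dots> \<le> 1 * (norm (x - y) / (norm (x - y))\<^sup>2)"
    using pi_gt3 component_le_norm_cart[of "x - y" i] by (intro mult_mono divide_right_mono) auto
  finally show ?thesis using n by (simp add: power2_eq_square)
qed (simp add: log_kernel_partial_def)

text \<open>Splitting at distance \<open>sqrt \<bar>t\<bar>\<close> makes both contributions to the difference quotient of a
  logarithmic potential \<open>O(sqrt \<bar>t\<bar>)\<close>.\<close>

lemma log_kernel_quotient_far:
  assumes t: "t \<noteq> 0" "\<bar>t\<bar> \<le> 1 / 25" and far: "sqrt \<bar>t\<bar> \<le> norm (x - y)"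
  shows "\<bar>(log_kernel (x + t *\<^sub>R axis i 1) y - log_kernel x y) / t - log_kernel_partial i x y\<bar> \<le> sqrt \<bar>t\<bar> / norm (x - y)"
proof -
  let ?z = "x - y" and ?r = "sqrt \<bar>t\<bar>"
  have r: "?r > 0" "\<bar>t\<bar> = ?r * ?r" using t by auto
  \<comment> \<open>The restriction to \<open>\<bar>t\<bar> \<le> 1 / 25\<close> gives
    \<open>5 * \<bar>t\<bar> \<le> sqrt \<bar>t\<bar>\<close>, so every point at distance at least
    \<open>sqrt \<bar>t\<bar>\<close> is within reach of the Taylor estimate.\<close>
  have "?r \<le> sqrt (1 / 25)" using t by (intro real_sqrt_le_mono)
  also have "sqrt (1 / 25 :: real) = 1 / 5" by (rule real_sqrt_unique) (auto simp: power2_eq_square)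
  finally have "?r * ?r \<le> ?r * (1 / 5)" using r by (intro mult_left_mono) auto
  then have "5 * \<bar>t\<bar> \<le> norm ?z" using far r(2) by linarith
  moreover have z: "norm ?z > 0" using far r by linarith
  ultimately have T: "\<bar>ln (norm (?z + t *\<^sub>R axis i 1)) - ln (norm ?z) - t * (?z $ i / (norm ?z)\<^sup>2)\<bar> \<le> 6 * t\<^sup>2 / (norm ?z)\<^sup>2"
    by (intro ln_norm_taylor) auto
  have "(log_kernel (x + t *\<^sub>R axis i 1) y - log_kernel x y) / t - log_kernel_partial i x y
     = - (1 / (2 * pi * t)) * (ln (norm (?z + t *\<^sub>R axis i 1)) - ln (norm ?z) - t * (?z $ i / (norm ?z)\<^sup>2))"
    using t z by (simp add: log_kernel_eq log_kernel_partial_def field_simps)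
  then have "\<bar>(log_kernel (x + t *\<^sub>R axis i 1) y - log_kernel x y) / t - log_kernel_partial i x y\<bar>
     = (1 / (2 * pi * \<bar>t\<bar>)) * \<bar>ln (norm (?z + t *\<^sub>R axis i 1)) - ln (norm ?z) - t * (?z $ i / (norm ?z)\<^sup>2)\<bar>"
    by (simp add: abs_mult)
  also have "\<dots> \<le> (1 / (6 * \<bar>t\<bar>)) * (6 * t\<^sup>2 / (norm ?z)\<^sup>2)"
    using pi_gt3 t by (intro mult_mono T frac_le) auto
  also have "\<dots> = \<bar>t\<bar> / (norm ?z)\<^sup>2"
  proof -
    have "1 / (6 * a) * (6 * (a * a) / n) = a / n" if "a \<noteq> 0" for a n :: real using that by simp
    from this[of "\<bar>t\<bar>" "(norm ?z)\<^sup>2"] show ?thesis using t by (simp add: power2_eq_square)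
  qed
  also have "\<dots> = (?r / norm ?z) * (?r / norm ?z)" using r by (simp add: power2_eq_square)
  also have "\<dots> \<le> (?r / norm ?z) * 1" using far z r by (intro mult_left_mono) auto
  finally show ?thesis by simp
qed

text \<open>A crude bound close to the pole, with singularities at both \<open>x\<close> and the
  shifted point. Over discs of radius \<open>O(sqrt \<bar>t\<bar>)\<close> it integrates to
  \<open>O(sqrt \<bar>t\<bar>)\<close>.\<close>

lemma log_kernel_quotient_near:
  assumes t: "t \<noteq> 0" and y: "y \<noteq> x" "y \<noteq> x + t *\<^sub>R axis i 1"
  shows "\<bar>(log_kernel (x + t *\<^sub>R axis i 1) y - log_kernel x y) / t - log_kernel_partial i x y\<bar>
      \<le> 1 / norm (x + t *\<^sub>R axis i 1 - y) + 2 / norm (x - y)"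
proof -
  have "\<bar>log_kernel (x + t *\<^sub>R axis i 1) y - log_kernel x y\<bar> \<le> \<bar>t\<bar> * (1 / norm (x + t *\<^sub>R axis i 1 - y) + 1 / norm (x - y))"
    using abs_log_kernel_diff_le[of "x + t *\<^sub>R axis i 1" y x] y by auto
  then have "\<bar>(log_kernel (x + t *\<^sub>R axis i 1) y - log_kernel x y) / t\<bar> \<le> 1 / norm (x + t *\<^sub>R axis i 1 - y) + 1 / norm (x - y)"
    using t by (simp add: field_simps)
  then show ?thesis using abs_log_kernel_partial_le[of i x y] by linarith
qed

context
  fixes S :: "(real^2) set" and d A :: real and f :: "real^2 \<Rightarrow> real"
  assumes S: "S \<in> sets borel" "\<And>x y. x \<in> S \<Longrightarrow> y \<in> S \<Longrightarrow> dist x y < d"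
    and f: "bounded_supported S f" and A: "A \<ge> 0" "\<And>x. \<bar>f x\<bar> \<le> A"
begin

interpretation weakly_singular_kernel S log_kernel "d\<^sup>2 + 1" d
  by (rule weakly_singular_log_kernel[OF S])

text \<open>Each of the two reciprocals in the Lipschitz bound of the kernel contributes
  \<open>4 * pi * d\<close>.\<close>

lemma log_potential_lipschitz:
  assumes x: "x \<in> S" "x' \<in> S"
  shows "\<bar>potential log_kernel f x - potential log_kernel f x'\<bar> \<le> 8 * pi * d * A * norm (x - x')"
proof -
  have d: "d \<ge> 0" using d_nonneg[OF x(1)] .
  let ?I = "\<lambda>x y. indicator (ball x d) y * (1 / norm (x - y))"
  have int: "integrable lborel (\<lambda>y. log_kernel x y * f y)" "integrable lborel (\<lambda>y. log_kernel x' y * f y)"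
    using K_integrand_integrable f x by auto
  have "potential log_kernel f x - potential log_kernel f x' = (LINT y|lborel. log_kernel x y * f y - log_kernel x' y * f y)"
    using int by (simp add: potential_def)
  also have "\<bar>\<dots>\<bar> \<le> (LINT y|lborel. \<bar>log_kernel x y * f y - log_kernel x' y * f y\<bar>)"
    by (rule integral_abs_bound)
  also have "\<dots> \<le> (LINT y|lborel. norm (x - x') * A * (?I x y + ?I x' y))"
  proof (rule integral_mono_AE)
    show "integrable lborel (\<lambda>y. \<bar>log_kernel x y * f y - log_kernel x' y * f y\<bar>)" using int by simp
    show "integrable lborel (\<lambda>y. norm (x - x') * A * (?I x y + ?I x' y))"
      using d by (intro integrable_mult_right Bochner_Integration.integrable_add inverse_norm_ball)
    show "AE y in lborel. \<bar>log_kernel x y * f y - log_kernel x' y * f y\<bar> \<le> norm (x - x') * A * (?I x y + ?I x' y)"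
      using AE_lborel_singleton[of x] AE_lborel_singleton[of x']
    proof eventually_elim
      case (elim y)
      show ?case
      proof (cases "y \<in> S")
        case True
        have I: "?I x y + ?I x' y = 1 / norm (x - y) + 1 / norm (x' - y)" using S(2) x True by simp
        have "\<bar>log_kernel x y * f y - log_kernel x' y * f y\<bar> = \<bar>log_kernel x y - log_kernel x' y\<bar> * \<bar>f y\<bar>"
          by (simp flip: left_diff_distrib abs_mult)
        also have "\<dots> \<le> (norm (x - x') * (1 / norm (x - y) + 1 / norm (x' - y))) * A"
          using elim A by (intro mult_mono abs_log_kernel_diff_le) auto
        finally show ?thesis unfolding I by (simp add: algebra_simps)
      qed (use f A in \<open>auto simp: bounded_supported_def\<close>)
    qed
  qed
  also have "\<dots> = norm (x - x') * A * ((LINT y|lborel. ?I x y) + (LINT y|lborel. ?I x' y))"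
    unfolding integral_mult_right_zero using d by (subst Bochner_Integration.integral_add) (auto intro!: inverse_norm_ball simp del: times_divide_eq_right)
  also have "\<dots> \<le> norm (x - x') * A * (4 * pi * d + 4 * pi * d)"
    using d A by (intro mult_left_mono add_mono inverse_norm_ball) auto
  finally show ?thesis by (simp add: algebra_simps)
qed

lemma log_kernel_partial_integrable:
  assumes x: "x \<in> S"
  shows "integrable lborel (\<lambda>y. log_kernel_partial i x y * f y)"
proof (rule Bochner_Integration.integrable_bound)
  note [measurable] = f
  show "integrable lborel (\<lambda>y. A * (indicator (ball x d) y * (1 / norm (x - y))))"
    using d_nonneg[OF x] by (intro integrable_mult_right inverse_norm_ball)
  have [measurable]: "(\<lambda>y::real^2. (x - y) $ i) \<in> borel_measurable borel"
    by (intro borel_measurable_continuous_onI continuous_intros)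
  show "(\<lambda>y. log_kernel_partial i x y * f y) \<in> borel_measurable lborel"
    unfolding log_kernel_partial_def by measurable
  have "norm (log_kernel_partial i x y * f y) \<le> norm (A * (indicator (ball x d) y * (1 / norm (x - y))))" for y
  proof (cases "y \<in> S")
    case True
    have "\<bar>log_kernel_partial i x y\<bar> * \<bar>f y\<bar> \<le> 1 / norm (x - y) * A"
      using A by (intro mult_mono abs_log_kernel_partial_le) auto
    then show ?thesis using S(2)[OF x True] A by (simp add: abs_mult mult.commute)
  qed (use f in \<open>simp add: bounded_supported_def\<close>)
  then show "AE y in lborel. norm (log_kernel_partial i x y * f y) \<le> norm (A * (indicator (ball x d) y * (1 / norm (x - y))))"
    by simp
qed

lemma log_potential_quotient_bound:
  assumes x: "x \<in> S" "x + t *\<^sub>R axis i 1 \<in> S" and t: "t \<noteq> 0" "\<bar>t\<bar> \<le> 1 / 25"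
  shows "\<bar>(potential log_kernel f (x + t *\<^sub>R axis i 1) - potential log_kernel f x) / t - potential (log_kernel_partial i) f x\<bar>
     \<le> A * (4 * pi * d + 16 * pi) * sqrt \<bar>t\<bar>"
proof -
  let ?x' = "x + t *\<^sub>R axis i 1" and ?r = "sqrt \<bar>t\<bar>"
  let ?q = "\<lambda>y. (log_kernel ?x' y - log_kernel x y) / t - log_kernel_partial i x y"
  have d: "d \<ge> 0" using d_nonneg[OF x(1)] .
  have r: "?r > 0" "\<bar>t\<bar> = ?r * ?r" using t by auto
  have "?r \<le> 1" using t by simp
  have tr: "\<bar>t\<bar> \<le> ?r" using r mult_left_mono[OF \<open>?r \<le> 1\<close>, of ?r] by simp
  let ?I = "\<lambda>x R y. indicator (ball x R) y * (1 / norm (x - y))"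
  have int: "integrable lborel (\<lambda>y. log_kernel x y * f y)" "integrable lborel (\<lambda>y. log_kernel ?x' y * f y)"
      "integrable lborel (\<lambda>y. log_kernel_partial i x y * f y)"
    using K_integrand_integrable f x log_kernel_partial_integrable by auto
  have eq: "?q y * f y = (log_kernel ?x' y * f y - log_kernel x y * f y) / t - log_kernel_partial i x y * f y" for y
    by (simp add: algebra_simps diff_divide_distrib)
  have intq: "integrable lborel (\<lambda>y. ?q y * f y)"
    unfolding eq using int by simp
  have "(potential log_kernel f ?x' - potential log_kernel f x) / t - potential (log_kernel_partial i) f x = (LINT y|lborel. ?q y * f y)"
    unfolding eq using int by (simp add: potential_def)
  also have "\<bar>\<dots>\<bar> \<le> (LINT y|lborel. \<bar>?q y * f y\<bar>)" by (rule integral_abs_bound)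
  also have "\<dots> \<le> (LINT y|lborel. A * (?r * ?I x d y + (?I ?x' (2 * ?r) y + 2 * ?I x ?r y)))"
  proof (rule integral_mono_AE)
    show "integrable lborel (\<lambda>y. \<bar>?q y * f y\<bar>)" using intq by simp
    show "integrable lborel (\<lambda>y. A * (?r * ?I x d y + (?I ?x' (2 * ?r) y + 2 * ?I x ?r y)))"
      using d r by (intro integrable_mult_right Bochner_Integration.integrable_add inverse_norm_ball) auto
    show "AE y in lborel. \<bar>?q y * f y\<bar> \<le> A * (?r * ?I x d y + (?I ?x' (2 * ?r) y + 2 * ?I x ?r y))"
      using AE_lborel_singleton[of x] AE_lborel_singleton[of ?x']
    proof eventually_elim
      case (elim y)
      show ?case
      proof (cases "y \<in> S")
        case True
        have yd: "y \<in> ball x d" using S(2)[OF x(1) True] by simp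
        have "\<bar>?q y\<bar> \<le> ?r * ?I x d y + (?I ?x' (2 * ?r) y + 2 * ?I x ?r y)"
        proof (cases "?r \<le> norm (x - y)")
          case far: True
          have "\<bar>?q y\<bar> \<le> ?r / norm (x - y)" by (rule log_kernel_quotient_far[OF t far])
          moreover have "0 \<le> ?I ?x' (2 * ?r) y + 2 * ?I x ?r y" by (intro add_nonneg_nonneg mult_nonneg_nonneg) auto
          moreover have "?r / norm (x - y) = ?r * ?I x d y" using yd by simp
          ultimately show ?thesis by linarith
        next
          case False
          \<comment> \<open>The shift has length
            \<open>\<bar>t\<bar> \<le> sqrt \<bar>t\<bar>\<close>, so a disc of twice the radius
            around the shifted point covers the near region.\<close>
          have "norm (?x' - y) \<le> norm (x - y) + norm (t *\<^sub>R (axis i 1 :: real^2))"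
            using norm_triangle_ineq[of "x - y" "t *\<^sub>R axis i 1"] by (simp add: algebra_simps)
          then have "y \<in> ball ?x' (2 * ?r)" "y \<in> ball x ?r" using False tr by (auto simp: dist_norm)
          moreover have "\<bar>?q y\<bar> \<le> 1 / norm (?x' - y) + 2 / norm (x - y)"
            using elim by (intro log_kernel_quotient_near t) auto
          moreover have "0 \<le> ?r * ?I x d y" by (intro mult_nonneg_nonneg) auto
          ultimately show ?thesis by (simp only: indicator_simps mult_1 times_divide_eq_right mult_1_right)
        qed
        then have "\<bar>?q y\<bar> * \<bar>f y\<bar> \<le> (?r * ?I x d y + (?I ?x' (2 * ?r) y + 2 * ?I x ?r y)) * A"
          using A by (intro mult_mono) auto
        then show ?thesis by (simp only: abs_mult mult.commute)
      qed (use f A in \<open>auto simp: bounded_supported_def\<close>)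
    qed
  qed
  also have "\<dots> = A * (?r * (LINT y|lborel. ?I x d y) + ((LINT y|lborel. ?I ?x' (2 * ?r) y) + 2 * (LINT y|lborel. ?I x ?r y)))"
  proof -
    have i: "integrable lborel (?I x d)" "integrable lborel (?I ?x' (2 * ?r))" "integrable lborel (?I x ?r)"
      using d r by (auto intro!: inverse_norm_ball simp del: times_divide_eq_right)
    show ?thesis
      unfolding integral_mult_right_zero
      by (simp only: Bochner_Integration.integral_add integrable_mult_right Bochner_Integration.integrable_add i integral_mult_right_zero)
  qed
  also have "\<dots> \<le> A * (?r * (4 * pi * d) + (4 * pi * (2 * ?r) + 2 * (4 * pi * ?r)))"
    using d r A by (intro mult_left_mono add_mono inverse_norm_ball) auto
  finally show ?thesis by (simp add: algebra_simps)
qed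

lemma log_potential_has_derivative:
  assumes "open S" and x: "x \<in> S"
  shows "((\<lambda>t. potential log_kernel f (x + t *\<^sub>R axis i 1)) has_real_derivative potential (log_kernel_partial i) f x) (at 0)"
proof -
  obtain e where e: "e > 0" "ball x e \<subseteq> S" using assms openE by blast
  have "((\<lambda>t. (potential log_kernel f (x + t *\<^sub>R axis i 1) - potential log_kernel f x) / t - potential (log_kernel_partial i) f x) \<longlongrightarrow> 0) (at 0)"
  proof (rule Lim_null_comparison)
    have "\<forall>\<^sub>F t in at (0::real). t \<noteq> 0 \<and> \<bar>t\<bar> < min e (1 / 25)"
      using e by (auto simp: eventually_at dist_norm intro!: exI[of _ "min e (1 / 25)"])
    then show "\<forall>\<^sub>F t in at 0. norm ((potential log_kernel f (x + t *\<^sub>R axis i 1) - potential log_kernel f x) / t - potential (log_kernel_partial i) f x)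
       \<le> A * (4 * pi * d + 16 * pi) * sqrt \<bar>t\<bar>"
    proof eventually_elim
      case (elim t)
      have "x + t *\<^sub>R axis i 1 \<in> S" by (rule subsetD[OF e(2)]) (use elim in \<open>simp add: dist_norm\<close>)
      then show ?case unfolding real_norm_def using elim x by (intro log_potential_quotient_bound) auto
    qed
    have "((\<lambda>t. A * (4 * pi * d + 16 * pi) * sqrt \<bar>t\<bar>) \<longlongrightarrow> A * (4 * pi * d + 16 * pi) * sqrt \<bar>0\<bar>) (at 0)"
      by (intro tendsto_intros)
    then show "((\<lambda>t. A * (4 * pi * d + 16 * pi) * sqrt \<bar>t\<bar>) \<longlongrightarrow> 0) (at 0)" by simp
  qed
  then show ?thesis
    unfolding DERIV_def using LIM_zero_cancel by fastforce
qed

end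

section \<open>The weak equation for a vortex patch\<close>

lemma integral_lborel_translate:
  fixes f :: "real^2 \<Rightarrow> real"
  assumes "f \<in> borel_measurable borel"
  shows "(LINT x|lborel. f (v + x)) = (LINT x|lborel. f x)"
proof -
  have "(LINT x|lborel. f x) = (LINT x|distr lborel borel ((+) v). f x)" by (simp add: lborel_distr_plus)
  also have "\<dots> = (LINT x|lborel. f (v + x))" by (rule integral_distr) (use assms in auto)
  finally show ?thesis by simp
qed

lemma image_plus_eq_vimage:
  fixes v :: "'a::group_add"
  shows "(+) v ` S = (+) (- v) -` S"
proof (intro set_eqI iffI)
  fix x assume "x \<in> (+) (- v) -` S"
  then show "x \<in> (+) v ` S" by (intro image_eqI[of _ _ "- v + x"]) (auto simp flip: add.assoc)
qed (auto simp flip: add.assoc)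

lemma emeasure_lborel_translate:
  fixes S :: "(real^2) set"
  assumes "S \<in> sets borel"
  shows "emeasure lborel ((+) v ` S) = emeasure lborel S"
proof -
  have "emeasure lborel S = emeasure (distr lborel borel ((+) (- v))) S" by (simp add: lborel_distr_plus)
  also have "\<dots> = emeasure lborel ((+) (- v) -` S \<inter> space lborel)" by (rule emeasure_distr) (use assms in auto)
  finally show ?thesis by (simp add: image_plus_eq_vimage)
qed

text \<open>Infinitely many disjoint translates of \<open>S\<close> fit into a bounded set.\<close>

lemma null_set_if_disjoint_translates:
  fixes S :: "(real^2) set"
  assumes S: "S \<in> sets borel" "bounded S" and e: "e > 0"
    and disj: "\<And>x s. x \<in> S \<Longrightarrow> s \<noteq> 0 \<Longrightarrow> \<bar>s\<bar> < e \<Longrightarrow> x + s *\<^sub>R v \<notin> S"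
  shows "emeasure lborel S = 0"
proof -
  obtain r where r: "r > 0" "S \<subseteq> ball 0 r" using S(2) bounded_subset_ballD by blast
  define R where "R = r + e * norm v"
  have fin: "emeasure lborel (ball (0::real^2) R) < \<infinity>"
    using emeasure_bounded_finite[of "ball (0::real^2) R"] by simp
  have bound: "of_nat n * emeasure lborel S \<le> emeasure lborel (ball (0::real^2) R)" for n :: nat
  proof -
    \<comment> \<open>The first \<open>n\<close> multiples of this step are distinct and lie in
      \<open>[0, e)\<close>, so any two translates differ by a nonzero shift shorter than
      \<open>e\<close>.\<close>
    define s where "s j = real j * (e / real (Suc n))" for j :: nat
    define T where "T j = (+) (s j *\<^sub>R v) ` S" for j :: nat
    have meas: "T j \<in> sets borel" for j
    proof -
      have "T j = (+) (- (s j *\<^sub>R v)) -` S \<inter> space borel"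
        unfolding T_def image_plus_eq_vimage by simp
      also have "\<dots> \<in> sets borel" by (rule measurable_sets[OF _ S(1)]) measurable
      finally show ?thesis .
    qed
    have s_bd: "0 \<le> s j" "s j < e" if "j < n" for j
    proof -
      have "real j * e < real (Suc n) * e" using that e by (intro mult_strict_right_mono) auto
      then show "0 \<le> s j" "s j < e" using e by (auto simp: s_def field_simps)
    qed
    have "disjoint_family_on T {..<n}"
      unfolding disjoint_family_on_def
    proof (intro ballI impI)
      fix i j assume ij: "i \<in> {..<n}" "j \<in> {..<n}" "i \<noteq> j"
      show "T i \<inter> T j = {}"
      proof (rule ccontr)
        assume "T i \<inter> T j \<noteq> {}"
        then obtain x y where xy: "x \<in> S" "y \<in> S" "s i *\<^sub>R v + x = s j *\<^sub>R v + y" by (auto simp: T_def)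
        have "y = x + (s i - s j) *\<^sub>R v" using xy(3) by (simp add: algebra_simps)
        moreover have "s i - s j \<noteq> 0" using ij(3) e by (simp add: s_def)
        moreover have "\<bar>s i - s j\<bar> < e" using s_bd[of i] s_bd[of j] ij by auto
        ultimately show False using disj[OF xy(1), of "s i - s j"] xy(2) by simp
      qed
    qed
    then have "(\<Sum>j<n. emeasure lborel (T j)) = emeasure lborel (\<Union>j<n. T j)"
      using meas by (intro sum_emeasure) auto
    also have "\<dots> \<le> emeasure lborel (ball (0::real^2) R)"
    proof (rule emeasure_mono[where M = lborel])
      show "(\<Union>j<n. T j) \<subseteq> ball 0 R"
      proof (clarsimp simp: T_def)
        fix j x assume jx: "j < n" "x \<in> S"
        have "norm (s j *\<^sub>R v + x) \<le> s j * norm v + norm x"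
          using norm_triangle_ineq[of "s j *\<^sub>R v" x] s_bd[OF jx(1)] by simp
        also have "\<dots> \<le> e * norm v + norm x" using s_bd[OF jx(1)] by (intro add_right_mono mult_right_mono) auto
        also have "\<dots> < R" using r jx by (auto simp: R_def)
        finally show "norm (s j *\<^sub>R v + x) < R" .
      qed
    qed simp
    finally show ?thesis using S(1) by (simp add: T_def emeasure_lborel_translate)
  qed
  show ?thesis
  proof (rule ccontr)
    assume "emeasure lborel S \<noteq> 0"
    then have "emeasure lborel S > 0" by (simp add: zero_less_iff_neq_zero)
    moreover have "emeasure lborel S \<noteq> \<infinity>" using bound[of 1] fin by (auto simp: top.not_eq_extremum)
    ultimately obtain c where c: "emeasure lborel S = ennreal c" "c > 0"
      by (cases "emeasure lborel S") auto
    obtain M where M: "emeasure lborel (ball (0::real^2) R) = ennreal M" "M \<ge> 0"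
      using fin by (cases "emeasure lborel (ball (0::real^2) R)") auto
    obtain n :: nat where n: "M / c < real n" using reals_Archimedean2 by blast
    have "ennreal (real n * c) \<le> ennreal M"
      using bound[of n] c M by (simp add: ennreal_mult ennreal_of_nat_eq_real_of_nat)
    then have "real n * c \<le> M" using M by simp
    then show False using n c by (simp add: field_simps)
  qed
qed

text \<open>At a level point with nonzero derivative, \<open>\<psi>\<close> leaves the level at a
  definite linear rate along the axis. The points where rate and range are both
  \<open>1 / real (Suc n)\<close> form a closed set disjoint from its own short translates, hence a
  null set, and countably many such sets exhaust the bad points. Only differentiability along one
  axis enters.\<close>

lemma partial_deriv_zero_on_level_set:
  fixes \<psi> :: "real^2 \<Rightarrow> real"
  assumes cont: "continuous_on (ball p \<delta>) \<psi>"
    and der: "\<And>x. x \<in> ball p \<delta> \<Longrightarrow> ((\<lambda>t. \<psi> (x + t *\<^sub>R axis i 1)) has_real_derivative \<psi>' x) (at 0)"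
  shows "AE x in lborel. x \<in> ball p \<delta> \<and> \<psi> x = \<mu> \<longrightarrow> \<psi>' x = 0"
proof -
  let ?e = "axis i 1 :: real^2"
  \<comment> \<open>The margin is twice the longest admissible shift
    \<open>1 / real (Suc n)\<close>, so shifted points remain strictly inside the disc.\<close>
  define K where "K n = cball p (\<delta> - 2 / real (Suc n))" for n
  define S where "S n = {x \<in> K n. \<psi> x = \<mu>} \<inter>
      (\<Inter>t\<in>{t. \<bar>t\<bar> \<le> 1 / real (Suc n)}. {x \<in> K n. \<bar>t\<bar> / real (Suc n) \<le> \<bar>\<psi> (x + t *\<^sub>R ?e) - \<mu>\<bar>})" for n
  have Kt: "x + t *\<^sub>R ?e \<in> ball p \<delta>" if "x \<in> K n" "\<bar>t\<bar> \<le> 1 / real (Suc n)" for x t n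
  proof -
    have "norm (x + t *\<^sub>R ?e - p) \<le> norm (x - p) + \<bar>t\<bar>"
      using norm_triangle_ineq[of "x - p" "t *\<^sub>R ?e"] by (simp add: algebra_simps)
    also have "\<dots> \<le> (\<delta> - 2 / real (Suc n)) + 1 / real (Suc n)"
      using that by (intro add_mono) (auto simp: K_def dist_norm norm_minus_commute)
    also have "\<dots> < \<delta>" by (simp add: field_simps)
    finally show ?thesis by (simp add: dist_norm norm_minus_commute)
  qed
  have KB: "K n \<subseteq> ball p \<delta>" for n using Kt[of _ n 0] by auto
  have closed_S: "closed (S n)" for n
  proof -
    have "continuous_on (K n) \<psi>" using cont KB by (rule continuous_on_subset)
    then have 1: "closed {x \<in> K n. \<psi> x = \<mu>}"
      by (intro continuous_closed_preimage_constant) (simp_all add: K_def)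
    have 2: "closed {x \<in> K n. \<bar>t\<bar> / real (Suc n) \<le> \<bar>\<psi> (x + t *\<^sub>R ?e) - \<mu>\<bar>}" if "\<bar>t\<bar> \<le> 1 / real (Suc n)" for t
    proof -
      have "continuous_on (K n) (\<lambda>x. \<bar>\<psi> (x + t *\<^sub>R ?e) - \<mu>\<bar>)"
        using Kt that by (intro continuous_intros continuous_on_compose2[OF cont]) auto
      then have "closed (K n \<inter> (\<lambda>x. \<bar>\<psi> (x + t *\<^sub>R ?e) - \<mu>\<bar>) -` {\<bar>t\<bar> / real (Suc n)..})"
        by (intro continuous_closed_preimage) (simp_all add: K_def)
      also have "K n \<inter> (\<lambda>x. \<bar>\<psi> (x + t *\<^sub>R ?e) - \<mu>\<bar>) -` {\<bar>t\<bar> / real (Suc n)..} =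
          {x \<in> K n. \<bar>t\<bar> / real (Suc n) \<le> \<bar>\<psi> (x + t *\<^sub>R ?e) - \<mu>\<bar>}" by auto
      finally show ?thesis .
    qed
    show ?thesis unfolding S_def by (intro closed_Int closed_INT ballI 1 2) simp
  qed
  have null: "S n \<in> null_sets lborel" for n
  proof -
    have "emeasure lborel (S n) = 0"
    proof (rule null_set_if_disjoint_translates[where v = ?e])
      show "S n \<in> sets borel" using closed_S by (rule borel_closed)
      show "bounded (S n)" by (rule bounded_subset[of "cball p (\<delta> - 2 / real (Suc n))"]) (auto simp: S_def K_def)
      fix x s assume xs: "x \<in> S n" "s \<noteq> 0" "\<bar>s\<bar> < 1 / real (Suc n)"
      then have "\<bar>s\<bar> / real (Suc n) \<le> \<bar>\<psi> (x + s *\<^sub>R ?e) - \<mu>\<bar>" by (auto simp: S_def)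
      moreover have "\<bar>s\<bar> / real (Suc n) > 0" using xs(2) by simp
      ultimately have "\<psi> (x + s *\<^sub>R ?e) \<noteq> \<mu>" by force
      then show "x + s *\<^sub>R ?e \<notin> S n" by (auto simp: S_def)
    qed simp
    then show ?thesis using borel_closed[OF closed_S] by (simp add: null_sets_def)
  qed
  have "(\<Union>n. S n) \<in> null_sets lborel" using null by (rule null_sets_UN)
  then show ?thesis
  proof (rule AE_I')
    show "{x \<in> space lborel. \<not> (x \<in> ball p \<delta> \<and> \<psi> x = \<mu> \<longrightarrow> \<psi>' x = 0)} \<subseteq> (\<Union>n. S n)"
    proof
      fix x assume "x \<in> {x \<in> space lborel. \<not> (x \<in> ball p \<delta> \<and> \<psi> x = \<mu> \<longrightarrow> \<psi>' x = 0)}"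
      then have x: "x \<in> ball p \<delta>" and mu: "\<mu> = \<psi> x" and nz: "\<psi>' x \<noteq> 0" by auto
      have "((\<lambda>t. (\<psi> (x + t *\<^sub>R ?e) - \<psi> x) / t) \<longlongrightarrow> \<psi>' x) (at 0)" using der[OF x] by (simp add: DERIV_def)
      then have "((\<lambda>t. \<bar>(\<psi> (x + t *\<^sub>R ?e) - \<psi> x) / t\<bar>) \<longlongrightarrow> \<bar>\<psi>' x\<bar>) (at 0)" by (rule tendsto_rabs)
      then have "\<forall>\<^sub>F t in at 0. \<bar>(\<psi> (x + t *\<^sub>R ?e) - \<psi> x) / t\<bar> > \<bar>\<psi>' x\<bar> / 2"
        by (rule order_tendstoD) (use nz in simp)
      then obtain \<eta> where \<eta>: "\<eta> > 0" "\<And>t. t \<noteq> 0 \<Longrightarrow> \<bar>t\<bar> < \<eta> \<Longrightarrow> \<bar>(\<psi> (x + t *\<^sub>R ?e) - \<psi> x) / t\<bar> > \<bar>\<psi>' x\<bar> / 2"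
        by (auto simp: eventually_at dist_norm)
      \<comment> \<open>The three bounds guarantee, in this order, that the difference quotient is
        controlled, that it exceeds \<open>1 / real (Suc n)\<close>, and that \<open>x\<close>
        belongs to \<open>K n\<close>.\<close>
      define m where "m = Min {\<eta>, \<bar>\<psi>' x\<bar> / 2, (\<delta> - dist p x) / 2}"
      have m: "m > 0" "m \<le> \<eta>" "m \<le> \<bar>\<psi>' x\<bar> / 2" "m \<le> (\<delta> - dist p x) / 2"
        unfolding m_def by (use \<eta>(1) nz x in simp) (rule Min_le; simp)+
      obtain n where n: "1 / real (Suc n) < m" using nat_approx_posE[OF m(1)] by auto
      have "x \<in> K n" using n m(4) by (simp add: K_def)
      moreover have "\<bar>t\<bar> / real (Suc n) \<le> \<bar>\<psi> (x + t *\<^sub>R ?e) - \<psi> x\<bar>" if "\<bar>t\<bar> \<le> 1 / real (Suc n)" for t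
      proof (cases "t = 0")
        case False
        have "1 / real (Suc n) \<le> \<bar>\<psi> (x + t *\<^sub>R ?e) - \<psi> x\<bar> / \<bar>t\<bar>"
          using \<eta>(2)[OF False] that n m unfolding abs_divide by linarith
        then have "\<bar>t\<bar> * (1 / real (Suc n)) \<le> \<bar>t\<bar> * (\<bar>\<psi> (x + t *\<^sub>R ?e) - \<psi> x\<bar> / \<bar>t\<bar>)"
          by (intro mult_left_mono) auto
        then show ?thesis using False by simp
      qed simp
      ultimately have "x \<in> S n" by (simp add: S_def mu)
      then show "x \<in> (\<Union>n. S n)" by blast
    qed
  qed
qed

text \<open>The discrete form of \<open>\<integral> \<partial>\<^sub>1\<xi> \<partial>\<^sub>2g = \<integral> \<partial>\<^sub>2\<xi> \<partial>\<^sub>1g\<close>, which needs no second derivatives.\<close>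

lemma integral_difference_product_swap:
  fixes \<xi> g :: "real^2 \<Rightarrow> real"
  assumes \<xi>: "continuous_on UNIV \<xi>" and g: "continuous_on UNIV g" "\<And>x. x \<notin> cball p r \<Longrightarrow> g x = 0"
  shows "(LINT x|lborel. (\<xi> (x + u) - \<xi> x) * (g (x + v) - g x)) = (LINT x|lborel. (\<xi> (x - v) - \<xi> x) * (g (x - u) - g x))"
proof -
  have cont_int: "integrable lborel f" if "continuous_on UNIV f" "\<And>x. x \<notin> cball q r \<Longrightarrow> f x = 0" for f :: "real^2 \<Rightarrow> real" and q
  proof -
    have "integrable lborel (\<lambda>x. indicator (cball q r) x *\<^sub>R f x)"
      by (intro borel_integrable_compact continuous_on_subset[OF that(1)]) auto
    then show ?thesis
      by (rule Bochner_Integration.integrable_cong[THEN iffD1, OF refl, rotated]) (use that(2) in \<open>auto split: split_indicator\<close>)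
  qed
  have \<xi>': "continuous_on UNIV (\<lambda>x. \<xi> (x + w))" for w by (intro continuous_on_compose2[OF \<xi>] continuous_intros) auto
  have g': "continuous_on UNIV (\<lambda>x. g (x + w))" for w by (intro continuous_on_compose2[OF g(1)] continuous_intros) auto
  have i: "integrable lborel (\<lambda>x. \<xi> (x + a) * g (x + b))" for a b
  proof (rule cont_int[of _ "p - b"])
    show "continuous_on UNIV (\<lambda>x. \<xi> (x + a) * g (x + b))" by (intro continuous_intros \<xi>' g')
    show "\<xi> (x + a) * g (x + b) = 0" if "x \<notin> cball (p - b) r" for x
      using g(2)[of "x + b"] that by (auto simp: dist_norm algebra_simps)
  qed
  \<comment> \<open>By translation invariance \<open>I a b\<close> depends only on
    \<open>a - b\<close>. Replacing the pair \<open>u\<close>, \<open>v\<close> by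
    \<open>- v\<close>, \<open>- u\<close> keeps the difference and exchanges the two mixed terms of
    the expanded product.\<close>
  define I where "I a b = (LINT x|lborel. \<xi> (x + a) * g (x + b))" for a b
  have shift: "I (a + w) (b + w) = I a b" for a b w
  proof -
    have "(\<lambda>x. \<xi> (x + a) * g (x + b)) \<in> borel_measurable borel"
      by (intro borel_measurable_continuous_onI continuous_intros \<xi>' g')
    from integral_lborel_translate[OF this, of w] show ?thesis by (simp add: I_def add_ac)
  qed
  have exp: "(LINT x|lborel. (\<xi> (x + a) - \<xi> x) * (g (x + b) - g x)) = I a b - I a 0 - I 0 b + I 0 0" for a b
  proof -
    have "(\<lambda>x. (\<xi> (x + a) - \<xi> x) * (g (x + b) - g x)) =
        (\<lambda>x. \<xi> (x + a) * g (x + b) - \<xi> (x + a) * g (x + 0) - \<xi> (x + 0) * g (x + b) + \<xi> (x + 0) * g (x + 0))"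
      by (simp add: algebra_simps)
    then show ?thesis unfolding I_def using i by (simp del: add_0_right)
  qed
  show ?thesis
    using exp[of u v] exp[of "- v" "- u"] shift[of "- v" "u + v" "- u"] shift[of "- v" v 0] shift[of 0 u "- u"]
    by simp
qed


lemma test_function_continuous: "test_function D \<xi> \<Longrightarrow> continuous_on UNIV \<xi>"
  by (simp add: test_function_def smooth_on_def flip: Ck_on.simps(1))

lemma test_function_has_derivative:
  assumes "test_function D \<xi>"
  shows "((\<lambda>t. \<xi> (x + t *\<^sub>R axis i 1)) has_real_derivative partial_deriv i \<xi> (x + t *\<^sub>R axis i 1)) (at t)"
proof -
  have "Ck_on (Suc 0) UNIV \<xi>" using assms by (simp add: test_function_def smooth_on_def del: Ck_on.simps)
  then show ?thesis by (intro Ck_on_Suc_has_derivative[of UNIV 0]) auto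
qed

lemma test_function_partial_continuous:
  assumes "test_function D \<xi>" shows "continuous_on UNIV (partial_deriv i \<xi>)"
proof -
  have "Ck_on (Suc 0) UNIV \<xi>" using assms by (simp add: test_function_def smooth_on_def del: Ck_on.simps)
  then show ?thesis by simp
qed

lemma test_function_lipschitz_on_ball:
  assumes \<xi>: "test_function D \<xi>"
  obtains L where "L \<ge> 0" "\<And>x t i. x \<in> cball p r \<Longrightarrow> \<bar>t\<bar> \<le> 1 \<Longrightarrow> \<bar>\<xi> (x + t *\<^sub>R axis i 1) - \<xi> x\<bar> \<le> L * \<bar>t\<bar>"
proof -
  have "\<exists>M. \<forall>x\<in>cball p (r + 1). \<bar>partial_deriv i \<xi> x\<bar> \<le> M" for i
  proof -
    have "compact (partial_deriv i \<xi> ` cball p (r + 1))"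
      by (intro compact_continuous_image continuous_on_subset[OF test_function_partial_continuous[OF \<xi>]]) auto
    then have "bounded (partial_deriv i \<xi> ` cball p (r + 1))" by (rule compact_imp_bounded)
    then show ?thesis by (auto simp: bounded_iff)
  qed
  then obtain M where M: "\<And>i x. x \<in> cball p (r + 1) \<Longrightarrow> \<bar>partial_deriv i \<xi> x\<bar> \<le> M i" by metis
  define L where "L = (\<Sum>i\<in>UNIV. \<bar>M i\<bar>)"
  have Mi_le: "M i \<le> L" for i
    using member_le_sum[of i UNIV "\<lambda>i. \<bar>M i\<bar>"] by (simp add: L_def)
  show thesis
  proof (rule that[of L])
    show "L \<ge> 0" by (simp add: L_def sum_nonneg)
    fix x t i assume x: "x \<in> cball p r" and t: "\<bar>t\<bar> \<le> (1::real)"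
    have "\<bar>\<xi> (x + t *\<^sub>R axis i 1) - \<xi> (x + 0 *\<^sub>R axis i 1)\<bar> \<le> L * \<bar>t - 0\<bar>"
    proof (rule field_differentiable_bound[of "cball 0 1" "\<lambda>t. \<xi> (x + t *\<^sub>R axis i 1)" "\<lambda>t. partial_deriv i \<xi> (x + t *\<^sub>R axis i 1)" L t 0, unfolded real_norm_def])
      show "((\<lambda>t. \<xi> (x + t *\<^sub>R axis i 1)) has_field_derivative partial_deriv i \<xi> (x + s *\<^sub>R axis i 1)) (at s within cball 0 1)" for s
        using test_function_has_derivative[OF \<xi>] by (rule has_field_derivative_at_within)
      fix s :: real assume "s \<in> cball 0 1"
      then have "dist x (x + s *\<^sub>R axis i 1) \<le> 1" by (simp add: dist_norm)
      then have "x + s *\<^sub>R axis i 1 \<in> cball p (r + 1)" using x dist_triangle[of p "x + s *\<^sub>R axis i 1" x] by simp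
      then show "\<bar>partial_deriv i \<xi> (x + s *\<^sub>R axis i 1)\<bar> \<le> L" using M[of "x + s *\<^sub>R axis i 1" i] Mi_le[of i] by linarith
    qed (use t in auto)
    then show "\<bar>\<xi> (x + t *\<^sub>R axis i 1) - \<xi> x\<bar> \<le> L * \<bar>t\<bar>" by simp
  qed
qed

lemma difference_quotient_LIMSEQ:
  assumes "(f has_real_derivative c) (at 0)" and "s \<noteq> 0"
  shows "(\<lambda>n. (f (s / real (Suc n)) - f 0) * real (Suc n)) \<longlonglongrightarrow> s * c"
proof -
  have "((\<lambda>t. (f t - f 0) / t) \<longlongrightarrow> c) (at 0)" using assms(1) by (simp add: DERIV_def)
  moreover have "filterlim (\<lambda>n. s / real (Suc n)) (at 0) sequentially"
    unfolding filterlim_at using assms(2)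
    by (auto intro!: tendsto_divide_0[OF tendsto_const] filterlim_at_top_imp_at_infinity
        filterlim_compose[OF filterlim_real_sequentially filterlim_Suc] always_eventually simp del: of_nat_Suc)
  ultimately have "(\<lambda>n. (f (s / real (Suc n)) - f 0) / (s / real (Suc n))) \<longlonglongrightarrow> c" by (rule filterlim_compose)
  then have "(\<lambda>n. s * ((f (s / real (Suc n)) - f 0) / (s / real (Suc n)))) \<longlonglongrightarrow> s * c" by (rule tendsto_mult_left)
  then show ?thesis using assms(2) by (simp del: of_nat_Suc)
qed


lemma AE_not_in_open_imp_empty:
  fixes U :: "(real^2) set"
  assumes "open U" "AE x in lborel. x \<notin> U"
  shows "U = {}"
proof (rule ccontr)
  assume "U \<noteq> {}"
  have "U \<in> null_sets lborel"
    using assms AE_iff_null_sets[of U lborel] borel_open[OF assms(1)] by simp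
  then have "negligible U" by (simp add: negligible_iff_null_sets null_sets_completionI)
  then show False using open_not_negligible[OF assms(1) \<open>U \<noteq> {}\<close>] by blast
qed

section \<open>Truncation of the stream function and the equation for one patch\<close>

context
  fixes D :: "(real^2) set" and f \<psi> \<xi> :: "real^2 \<Rightarrow> real" and d\<psi> :: "2 \<Rightarrow> real^2 \<Rightarrow> real"
    and p :: "real^2" and \<delta> r lam \<mu> L :: real
  assumes \<xi>: "test_function D \<xi>" and r: "r < \<delta>" and lam: "lam > 0" and L: "L \<ge> 0"
    and lip: "\<And>x y. x \<in> ball p \<delta> \<Longrightarrow> y \<in> ball p \<delta> \<Longrightarrow> \<bar>\<psi> x - \<psi> y\<bar> \<le> L * norm (x - y)"
    and der: "\<And>x i. x \<in> ball p \<delta> \<Longrightarrow> ((\<lambda>t. \<psi> (x + t *\<^sub>R axis i 1)) has_real_derivative d\<psi> i x) (at 0)"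
    and f_out: "\<And>x. x \<notin> ball p \<delta> \<Longrightarrow> f x = 0"
    and f_upper: "AE x in lborel. x \<in> ball p \<delta> \<longrightarrow> \<psi> x > \<mu> \<longrightarrow> f x = lam"
    and f_lower: "AE x in lborel. x \<in> ball p \<delta> \<longrightarrow> \<psi> x < \<mu> \<longrightarrow> f x = 0"
    and f_supp: "AE x in lborel. x \<notin> cball p r \<longrightarrow> f x = 0"
begin

text \<open>Up to the factor \<open>lam\<close> this is a primitive of the vorticity as a function
  of \<open>\<psi>\<close>: almost everywhere \<open>f\<close> times the gradient of
  \<open>\<psi>\<close> equals \<open>lam\<close> times the gradient of
  \<open>truncation\<close>.\<close>

definition truncation :: "real^2 \<Rightarrow> real" where
  "truncation x = (if x \<in> ball p \<delta> then max 0 (\<psi> x - \<mu>) else 0)"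

definition truncation_partial :: "2 \<Rightarrow> real^2 \<Rightarrow> real" where
  "truncation_partial i x = (if x \<in> ball p \<delta> \<and> \<psi> x > \<mu> then d\<psi> i x else 0)"

lemma psi_continuous: "continuous_on (ball p \<delta>) \<psi>"
proof -
  have "L-lipschitz_on (ball p \<delta>) \<psi>" by (rule lipschitz_onI) (use lip L in \<open>auto simp: dist_norm\<close>)
  then show ?thesis by (rule lipschitz_on_continuous_on)
qed

text \<open>Where \<open>\<psi> > \<mu>\<close> the density equals \<open>lam > 0\<close> almost
  everywhere, but outside \<open>cball p r\<close> it vanishes almost everywhere. So the open set of
  exceptions is null, hence empty. This is the point at which the distance of the support from the
  circle enters.\<close>

lemma psi_le_outside:
  assumes "x \<in> ball p \<delta>" "x \<notin> cball p r" shows "\<psi> x \<le> \<mu>"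
proof -
  let ?U = "(ball p \<delta> \<inter> \<psi> -` {\<mu><..}) - cball p r"
  have "open ?U" by (intro open_Diff continuous_open_preimage psi_continuous) auto
  moreover have "AE x in lborel. x \<notin> ?U"
    using f_upper f_supp by eventually_elim (use lam in auto)
  ultimately have "?U = {}" by (rule AE_not_in_open_imp_empty)
  then show ?thesis using assms by force
qed

lemma truncation_zero: "x \<notin> cball p r \<Longrightarrow> truncation x = 0"
  using psi_le_outside by (auto simp: truncation_def)

lemma truncation_continuous: "continuous_on UNIV truncation"
proof -
  have 1: "continuous_on (ball p \<delta>) truncation"
    by (rule continuous_on_eq[of _ "\<lambda>x. max 0 (\<psi> x - \<mu>)"])
      (auto simp: truncation_def intro!: continuous_intros psi_continuous)
  have 2: "continuous_on (- cball p r) truncation"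
    by (rule continuous_on_eq[of _ "\<lambda>x. 0"]) (auto simp: truncation_zero)
  have "continuous_on (ball p \<delta> \<union> - cball p r) truncation"
    by (intro continuous_on_open_Un 1 2) auto
  moreover have "ball p \<delta> \<union> - cball p r = UNIV" using r by auto
  ultimately show ?thesis by simp
qed

text \<open>A step of at most half the margin \<open>\<delta> - r\<close> cannot lead from
  \<open>cball p r\<close> out of the larger disc: either both points lie where
  \<open>\<psi>\<close> is Lipschitz, or the truncation vanishes at both.\<close>

lemma truncation_lipschitz:
  assumes t: "\<bar>t\<bar> \<le> (\<delta> - r) / 2"
  shows "\<bar>truncation (x + t *\<^sub>R axis i 1) - truncation x\<bar> \<le> L * \<bar>t\<bar>"
proof -
  let ?y = "x + t *\<^sub>R axis i 1"
  have xy: "dist x ?y = \<bar>t\<bar>" by (simp add: dist_norm)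
  show ?thesis
  proof (cases "x \<in> cball p ((\<delta> + r) / 2) \<and> x \<in> ball p \<delta> \<and> ?y \<in> ball p \<delta>")
    case True
    then have "\<bar>\<psi> ?y - \<psi> x\<bar> \<le> L * \<bar>t\<bar>" using lip[of ?y x] by simp
    then show ?thesis using True by (auto simp: truncation_def)
  next
    case False
    have "dist p ?y \<le> dist p x + \<bar>t\<bar>" "dist p x \<le> dist p ?y + \<bar>t\<bar>"
      using dist_triangle[of p ?y x] dist_triangle[of p x ?y] xy by (auto simp: dist_commute)
    moreover have "dist p x > (\<delta> + r) / 2 \<or> dist p x \<ge> \<delta> \<or> dist p ?y \<ge> \<delta>" using False by auto
    ultimately have "dist p x \<ge> (\<delta> + r) / 2" "dist p ?y \<ge> (\<delta> + r) / 2 \<or> dist p ?y > r"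
      using t r by (auto simp: field_simps)
    then have "x \<notin> cball p r" "?y \<notin> cball p r" using r by auto
    then show ?thesis using L by (simp add: truncation_zero)
  qed
qed

text \<open>Off the level set the truncation is locally zero or \<open>\<psi> - \<mu>\<close>. On
  it, the increments are dominated by those of \<open>\<psi>\<close>, whose derivative is zero by
  assumption.\<close>

lemma truncation_has_derivative:
  assumes x: "x \<in> ball p \<delta> \<and> \<psi> x = \<mu> \<longrightarrow> d\<psi> i x = 0"
  shows "((\<lambda>t. truncation (x + t *\<^sub>R axis i 1)) has_real_derivative truncation_partial i x) (at 0)"
proof -
  have lim: "((\<lambda>t. x + t *\<^sub>R axis i 1) \<longlongrightarrow> x) (nhds 0)"
    by (rule tendsto_eq_intros refl filterlim_ident | simp)+
  have ev: "\<forall>\<^sub>F t in nhds 0. x + t *\<^sub>R axis i 1 \<in> U" if "open U" "x \<in> U" for U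
    using lim that by (rule topological_tendstoD)
  consider "x \<notin> ball p \<delta>" | "x \<in> ball p \<delta>" "\<psi> x > \<mu>" | "x \<in> ball p \<delta>" "\<psi> x < \<mu>" | "x \<in> ball p \<delta>" "\<psi> x = \<mu>"
    by fastforce
  then show ?thesis
  proof cases
    case 1
    have "\<forall>\<^sub>F t in nhds 0. x + t *\<^sub>R axis i 1 \<in> - cball p r" by (rule ev) (use 1 r in auto)
    then have "\<forall>\<^sub>F t in nhds 0. truncation (x + t *\<^sub>R axis i 1) = 0" by eventually_elim (simp add: truncation_zero)
    from DERIV_cong_ev[OF refl this refl] show ?thesis using 1 by (simp add: truncation_partial_def)
  next
    case 2
    have "\<forall>\<^sub>F t in nhds 0. x + t *\<^sub>R axis i 1 \<in> ball p \<delta> \<inter> \<psi> -` {\<mu><..}"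
      by (intro ev continuous_open_preimage psi_continuous) (use 2 in auto)
    then have ev2: "\<forall>\<^sub>F t in nhds 0. truncation (x + t *\<^sub>R axis i 1) = \<psi> (x + t *\<^sub>R axis i 1) - \<mu>"
      by eventually_elim (auto simp: truncation_def)
    have "((\<lambda>t. \<psi> (x + t *\<^sub>R axis i 1) - \<mu>) has_real_derivative d\<psi> i x - 0) (at 0)"
      by (intro DERIV_diff der DERIV_const 2)
    then show ?thesis using DERIV_cong_ev[OF refl ev2 refl] 2 by (simp add: truncation_partial_def)
  next
    case 3
    have "\<forall>\<^sub>F t in nhds 0. x + t *\<^sub>R axis i 1 \<in> ball p \<delta> \<inter> \<psi> -` {..<\<mu>}"
      by (intro ev continuous_open_preimage psi_continuous) (use 3 in auto)
    then have "\<forall>\<^sub>F t in nhds 0. truncation (x + t *\<^sub>R axis i 1) = 0"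
      by eventually_elim (auto simp: truncation_def)
    from DERIV_cong_ev[OF refl this refl] show ?thesis using 3 by (simp add: truncation_partial_def)
  next
    case 4
    then have "d\<psi> i x = 0" using x by simp
    then have lim0: "((\<lambda>t. (\<psi> (x + t *\<^sub>R axis i 1) - \<mu>) / t) \<longlongrightarrow> 0) (at 0)"
      using der[OF 4(1), of i] 4(2) by (simp add: DERIV_def)
    have "((\<lambda>t. (truncation (x + t *\<^sub>R axis i 1) - truncation x) / t) \<longlongrightarrow> 0) (at 0)"
    proof (rule Lim_null_comparison[OF always_eventually tendsto_norm_zero[OF lim0]], intro allI)
      fix t
      have "\<bar>truncation (x + t *\<^sub>R axis i 1) - truncation x\<bar> \<le> \<bar>\<psi> (x + t *\<^sub>R axis i 1) - \<mu>\<bar>"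
        using 4 by (auto simp: truncation_def)
      then show "norm ((truncation (x + t *\<^sub>R axis i 1) - truncation x) / t) \<le> norm ((\<psi> (x + t *\<^sub>R axis i 1) - \<mu>) / t)"
        by (simp add: divide_right_mono)
    qed
    then show ?thesis using 4 by (simp add: DERIV_def truncation_partial_def)
  qed
qed

lemma AE_truncation_has_derivative:
  "AE x in lborel. ((\<lambda>t. truncation (x + t *\<^sub>R axis i 1)) has_real_derivative truncation_partial i x) (at 0)"
proof -
  have "AE x in lborel. x \<in> ball p \<delta> \<and> \<psi> x = \<mu> \<longrightarrow> d\<psi> i x = 0"
    by (rule partial_deriv_zero_on_level_set[OF psi_continuous der])
  then show ?thesis by eventually_elim (rule truncation_has_derivative)
qed

text \<open>\<open>d\<psi>\<close> is given only as a pointwise derivative, so measurability is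
  obtained from a limit of difference quotients, each continuous on an open set that leaves room for
  the shift.\<close>

lemma truncation_partial_measurable: "truncation_partial i \<in> borel_measurable borel"
proof -
  let ?q = "\<lambda>n x. (\<psi> (x + (1 / real (Suc n)) *\<^sub>R axis i 1) - \<psi> x) * real (Suc n)"
  let ?B = "\<lambda>n. ball p (\<delta> - 1 / real (Suc n))"
  let ?P = "\<lambda>n. ?B n \<inter> \<psi> -` {\<mu><..}"
  have sub: "x \<in> ball p \<delta>" "x + (1 / real (Suc n)) *\<^sub>R axis i 1 \<in> ball p \<delta>" if "x \<in> ?B n" for x n
  proof -
    have "1 / real (Suc n) > 0" by simp
    then show "x \<in> ball p \<delta>" using that unfolding mem_ball by linarith
    have "dist p (x + (1 / real (Suc n)) *\<^sub>R axis i 1) \<le> dist p x + 1 / real (Suc n)"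
      using dist_triangle[of p "x + (1 / real (Suc n)) *\<^sub>R axis i 1" x] by (simp add: dist_norm)
    then show "x + (1 / real (Suc n)) *\<^sub>R axis i 1 \<in> ball p \<delta>" using that by simp
  qed
  have cont: "continuous_on (?P n) (?q n)" and opn: "open (?P n)" for n
    using sub by (auto intro!: continuous_intros continuous_on_compose2[OF psi_continuous]
        continuous_on_subset[OF psi_continuous] continuous_open_preimage)
  have m: "(\<lambda>x. indicator (?P n) x *\<^sub>R ?q n x) \<in> borel_measurable borel" for n
    by (intro borel_measurable_continuous_on_indicator cont borel_open opn)
  have "(\<lambda>n. indicator (?P n) x *\<^sub>R ?q n x) \<longlonglongrightarrow> truncation_partial i x" for x
  proof (cases "x \<in> ball p \<delta> \<and> \<psi> x > \<mu>")
    case True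
    have "(\<lambda>n. ?q n x) \<longlonglongrightarrow> 1 * d\<psi> i x"
      using difference_quotient_LIMSEQ[OF der, of x 1 i] True by simp
    moreover have "\<forall>\<^sub>F n in sequentially. ?q n x = indicator (?P n) x *\<^sub>R ?q n x"
    proof -
      have "\<delta> - dist p x > 0" using True by simp
      then obtain N where N: "1 / real (Suc N) < \<delta> - dist p x" by (rule nat_approx_posE)
      have "x \<in> ?P n" if "n \<ge> N" for n
      proof -
        have "1 / real (Suc n) \<le> 1 / real (Suc N)" using that by (simp add: frac_le)
        then show ?thesis using N True by auto
      qed
      then show ?thesis unfolding eventually_sequentially by (auto intro!: exI[of _ N])
    qed
    ultimately have "(\<lambda>n. indicator (?P n) x *\<^sub>R ?q n x) \<longlonglongrightarrow> 1 * d\<psi> i x"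
      by (rule Lim_transform_eventually)
    moreover have "truncation_partial i x = 1 * d\<psi> i x" using True by (simp add: truncation_partial_def)
    ultimately show ?thesis by (simp only:)
  next
    case False
    then have "x \<notin> ?P n" for n using sub by auto
    then show ?thesis using False by (auto simp: truncation_partial_def)
  qed
  then show ?thesis by (rule borel_measurable_LIMSEQ_real[OF _ m])
qed

text \<open>The discrete swap identity passes to the limit by dominated convergence, since both
  factors have bounded difference quotients and the truncation has compact support. The result is
  phrased through an integrable representative \<open>F\<close> because neither \<open>f\<close> nor
  \<open>d\<psi>\<close> is assumed measurable; an almost everywhere identity also lets the
  contributions of two vortices be added.\<close>

lemma weak_patch_equation:
  "\<exists>F. integrable lborel F \<and> (LINT x|lborel. F x) = 0 \<and>
     (AE x in lborel. f x * (partial_deriv 1 \<xi> x * d\<psi> 2 x - partial_deriv 2 \<xi> x * d\<psi> 1 x) = F x)"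
proof -
  have [measurable]: "partial_deriv i \<xi> \<in> borel_measurable borel" "truncation_partial i \<in> borel_measurable borel" for i
    using borel_measurable_continuous_onI[OF test_function_partial_continuous[OF \<xi>]] truncation_partial_measurable by auto
  obtain M where M: "M \<ge> 0" "\<And>x t i. x \<in> cball p (r + 1) \<Longrightarrow> \<bar>t\<bar> \<le> 1 \<Longrightarrow> \<bar>\<xi> (x + t *\<^sub>R axis i 1) - \<xi> x\<bar> \<le> M * \<bar>t\<bar>"
    using test_function_lipschitz_on_ball[OF \<xi>] by metis
  have "min 1 ((\<delta> - r) / 2) > 0" using r by simp
  then obtain N where N: "1 / real (Suc N) < min 1 ((\<delta> - r) / 2)" by (rule nat_approx_posE)
  \<comment> \<open>The offset \<open>N\<close> makes every step at most 1, for the bound on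
    \<open>\<xi>\<close>, and at most half the margin, for the bound on the truncation.\<close>
  define s where "s n = 1 / real (Suc (n + N))" for n
  have s: "s n > 0" "s n \<le> 1" "s n \<le> (\<delta> - r) / 2" for n
  proof -
    have "s n \<le> 1 / real (Suc N)" by (simp add: s_def frac_le)
    then have "s n < min 1 ((\<delta> - r) / 2)" using N by linarith
    then show "s n \<le> 1" "s n \<le> (\<delta> - r) / 2" by linarith+
  qed (simp add: s_def)
  \<comment> \<open>The swap identity reverses the direction of the shifts, hence the sign
    \<open>\<sigma>\<close>. Both denominators are \<open>s n\<close> without the sign, so
    \<open>\<sigma>\<close> enters the limit twice and cancels.\<close>
  define Q where "Q \<sigma> i j n x = ((\<xi> (x + (\<sigma> * s n) *\<^sub>R axis i 1) - \<xi> x) / s n) * ((truncation (x + (\<sigma> * s n) *\<^sub>R axis j 1) - truncation x) / s n)"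
    for \<sigma> i j n x
  have \<xi>c: "continuous_on UNIV (\<lambda>x. \<xi> (x + w))" for w
    by (intro continuous_on_compose2[OF test_function_continuous[OF \<xi>]] continuous_intros) auto
  have gc: "continuous_on UNIV (\<lambda>x. truncation (x + w))" for w
    by (intro continuous_on_compose2[OF truncation_continuous] continuous_intros) auto
  have main: "integrable lborel (\<lambda>x. partial_deriv i \<xi> x * truncation_partial j x) \<and>
      (\<lambda>n. LINT x|lborel. Q \<sigma> i j n x) \<longlonglongrightarrow> (LINT x|lborel. partial_deriv i \<xi> x * truncation_partial j x)"
    if \<sigma>: "\<sigma> = 1 \<or> \<sigma> = -1" for \<sigma> i j
  proof -
    let ?w = "\<lambda>x. M * L * indicator (cball p (r + 1)) x"
    have fin: "emeasure lborel (cball p (r + 1)) < \<infinity>" using emeasure_bounded_finite[of "cball p (r + 1)"] by simp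
    have w: "integrable lborel ?w"
      using fin by (intro integrable_mult_right integrable_real_indicator) auto
    have meas: "Q \<sigma> i j n \<in> borel_measurable lborel" for n
      unfolding Q_def using \<xi>c[of 0] gc[of 0] s(1)[of n]
      by (simp, intro borel_measurable_continuous_onI continuous_intros \<xi>c gc) auto
    have bound: "norm (Q \<sigma> i j n x) \<le> ?w x" for n x
    proof -
      have ab: "\<bar>\<sigma> * s n\<bar> = s n" using \<sigma> s(1)[of n] by auto
      have g: "\<bar>(truncation (x + (\<sigma> * s n) *\<^sub>R axis j 1) - truncation x) / s n\<bar> \<le> L"
        using truncation_lipschitz[of "\<sigma> * s n" x j] ab s[of n] by (simp add: field_simps)
      show ?thesis
      proof (cases "x \<in> cball p (r + 1)")
        case True
        have "\<bar>(\<xi> (x + (\<sigma> * s n) *\<^sub>R axis i 1) - \<xi> x) / s n\<bar> \<le> M"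
          using M(2)[OF True, of "\<sigma> * s n" i] ab s[of n] by (simp add: field_simps)
        then have "norm (Q \<sigma> i j n x) \<le> M * L"
          unfolding Q_def real_norm_def abs_mult using g M(1) by (intro mult_mono) auto
        then show ?thesis using True by simp
      next
        case False
        have "dist x (x + (\<sigma> * s n) *\<^sub>R axis j 1) \<le> 1" using ab s[of n] by (simp add: dist_norm)
        then have "x \<notin> cball p r" "x + (\<sigma> * s n) *\<^sub>R axis j 1 \<notin> cball p r"
          using False dist_triangle[of p x "x + (\<sigma> * s n) *\<^sub>R axis j 1"] by (auto simp: dist_commute)
        then show ?thesis using False by (simp add: Q_def truncation_zero)
      qed
    qed
    have lim: "AE x in lborel. (\<lambda>n. Q \<sigma> i j n x) \<longlonglongrightarrow> partial_deriv i \<xi> x * truncation_partial j x"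
      using AE_truncation_has_derivative[of j]
    proof eventually_elim
      case (elim x)
      have dq: "(\<lambda>n. (u (\<sigma> * s n) - u 0) / s n) \<longlonglongrightarrow> \<sigma> * c" if "(u has_real_derivative c) (at 0)" for u c
      proof -
        have "\<sigma> \<noteq> 0" using \<sigma> by auto
        from LIMSEQ_ignore_initial_segment[OF difference_quotient_LIMSEQ[OF that this], of N]
        show ?thesis by (simp add: s_def)
      qed
      have "((\<lambda>t. \<xi> (x + t *\<^sub>R axis i 1)) has_real_derivative partial_deriv i \<xi> x) (at 0)"
        using test_function_has_derivative[OF \<xi>, of x i 0] by simp
      from tendsto_mult[OF dq[OF this] dq[OF elim]]
      have "(\<lambda>n. Q \<sigma> i j n x) \<longlonglongrightarrow> (\<sigma> * partial_deriv i \<xi> x) * (\<sigma> * truncation_partial j x)"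
        by (simp add: Q_def)
      moreover have "(\<sigma> * partial_deriv i \<xi> x) * (\<sigma> * truncation_partial j x) = partial_deriv i \<xi> x * truncation_partial j x"
        using \<sigma> by auto
      ultimately show ?case by simp
    qed
    have m2: "(\<lambda>x. partial_deriv i \<xi> x * truncation_partial j x) \<in> borel_measurable lborel" by measurable
    show ?thesis
      using integrable_dominated_convergence[OF m2 meas w lim] integral_dominated_convergence[OF m2 meas w lim] bound
      by auto
  qed
  have "(LINT x|lborel. Q 1 1 2 n x) = (LINT x|lborel. Q (-1) 2 1 n x)" for n
  proof -
    have "(LINT x|lborel. Q 1 1 2 n x) = (LINT x|lborel. (\<xi> (x + s n *\<^sub>R axis 1 1) - \<xi> x) * (truncation (x + s n *\<^sub>R axis 2 1) - truncation x)) / (s n * s n)"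
      by (simp add: Q_def)
    also have "\<dots> = (LINT x|lborel. (\<xi> (x - s n *\<^sub>R axis 2 1) - \<xi> x) * (truncation (x - s n *\<^sub>R axis 1 1) - truncation x)) / (s n * s n)"
      using integral_difference_product_swap[OF test_function_continuous[OF \<xi>] truncation_continuous truncation_zero] by simp
    also have "\<dots> = (LINT x|lborel. Q (-1) 2 1 n x)" by (simp add: Q_def)
    finally show ?thesis .
  qed
  then have eq: "(LINT x|lborel. partial_deriv 1 \<xi> x * truncation_partial 2 x) = (LINT x|lborel. partial_deriv 2 \<xi> x * truncation_partial 1 x)"
    using main[of 1 1 2] main[of "-1" 2 1] LIMSEQ_unique by auto
  have AE_zero: "AE x in lborel. x \<in> ball p \<delta> \<and> \<psi> x = \<mu> \<longrightarrow> d\<psi> i x = 0" for i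
    by (rule partial_deriv_zero_on_level_set[OF psi_continuous der])
  have AE: "AE x in lborel. f x * (partial_deriv 1 \<xi> x * d\<psi> 2 x - partial_deriv 2 \<xi> x * d\<psi> 1 x) =
      lam * (partial_deriv 1 \<xi> x * truncation_partial 2 x - partial_deriv 2 \<xi> x * truncation_partial 1 x)"
    using f_upper f_lower AE_zero[of 1] AE_zero[of 2]
  proof eventually_elim
    case (elim x)
    consider "x \<notin> ball p \<delta>" | "x \<in> ball p \<delta>" "\<psi> x > \<mu>" | "x \<in> ball p \<delta>" "\<psi> x < \<mu>" | "x \<in> ball p \<delta>" "\<psi> x = \<mu>"
      by fastforce
    then show ?case by cases (use elim f_out in \<open>auto simp: truncation_partial_def\<close>)
  qed
  show ?thesis
  proof (intro exI conjI)
    show "integrable lborel (\<lambda>x. lam * (partial_deriv 1 \<xi> x * truncation_partial 2 x - partial_deriv 2 \<xi> x * truncation_partial 1 x))"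
      using main[of 1 1 2] main[of 1 2 1] by simp
    show "(LINT x|lborel. lam * (partial_deriv 1 \<xi> x * truncation_partial 2 x - partial_deriv 2 \<xi> x * truncation_partial 1 x)) = 0"
      using main[of 1 1 2] main[of 1 2 1] eq by simp
  qed (rule AE)
qed

end

section \<open>Potentials on two discs and the first variation\<close>

locale vortex_domain = green_function +
  fixes p1 p2 :: "real^2" and \<delta> :: real
  assumes \<delta>: "\<delta> > 0" and balls_in_D: "cball p1 \<delta> \<subseteq> D" "cball p2 \<delta> \<subseteq> D"
    and disjoint_balls: "cball p1 \<delta> \<inter> cball p2 \<delta> = {}"
begin

definition S :: "(real^2) set" where "S = ball p1 \<delta> \<union> ball p2 \<delta>"

definition cS :: "(real^2) set" where "cS = cball p1 \<delta> \<union> cball p2 \<delta>"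

text \<open>The Green function with a definite value on the diagonal, where \<open>G\<close> is left
  unspecified.\<close>

definition g :: "real^2 \<Rightarrow> real^2 \<Rightarrow> real" where "g x y = log_kernel x y - h x y"

text \<open>A bound for all distances in \<open>cS\<close>; the summand 1 makes it strict, as the
  kernel frame requires.\<close>

definition diam :: real where "diam = 2 * \<delta> + dist p1 p2 + 1"

lemma S_subset: "S \<subseteq> cS" "cS \<subseteq> D" "S \<subseteq> D" and compact_cS: "compact cS" and open_S: "open S"
  using balls_in_D by (auto simp: S_def cS_def)

lemma S_sets: "S \<in> sets borel" using open_S by simp

lemma dist_cS: assumes "x \<in> cS" "y \<in> cS" shows "dist x y < diam"
proof -
  obtain p q where pq: "p \<in> {p1, p2}" "q \<in> {p1, p2}" "dist p x \<le> \<delta>" "dist q y \<le> \<delta>"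
    using assms by (auto simp: cS_def)
  have "dist x y \<le> dist p x + dist p q + dist q y"
    using dist_triangle[of x y p] dist_triangle[of p y q] by (simp add: dist_commute)
  moreover have "dist p q \<le> dist p1 p2" using pq by (auto simp: dist_commute)
  ultimately show ?thesis using pq by (simp add: diam_def)
qed

lemma dist_S: "x \<in> S \<Longrightarrow> y \<in> S \<Longrightarrow> dist x y < diam"
  using dist_cS S_subset by blast

lemma diam_pos: "diam > 0" using \<delta> by (simp add: diam_def add_pos_nonneg)

lemma h_bounded: obtains M where "M > 0" "\<And>x y. x \<in> cS \<Longrightarrow> y \<in> cS \<Longrightarrow> \<bar>h x y\<bar> \<le> M"
proof -
  have "compact ((\<lambda>(x, y). h x y) ` (cS \<times> cS))"
    using S_subset by (intro compact_continuous_image compact_Times compact_cS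
        continuous_on_subset[OF continuous_on_h_joint]) auto
  then have "bounded ((\<lambda>(x, y). h x y) ` (cS \<times> cS))" by (rule compact_imp_bounded)
  then obtain M where M: "M > 0" "\<forall>v\<in>(\<lambda>(x, y). h x y) ` (cS \<times> cS). norm v \<le> M" by (auto simp: bounded_pos)
  have "\<bar>h x y\<bar> \<le> M" if "x \<in> cS" "y \<in> cS" for x y
  proof -
    have "h x y \<in> (\<lambda>(x, y). h x y) ` (cS \<times> cS)" using that by (intro image_eqI[of _ _ "(x, y)"]) auto
    then show ?thesis using M(2) by auto
  qed
  then show thesis using M(1) that by blast
qed

text \<open>Uniform on both discs at once, because the compact set \<open>cS\<close> has positive
  distance from the frontier and the comparison of boundary values involves no path between the two
  points.\<close>

lemma h_lipschitz: obtains L where "L > 0"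
  "\<And>x x' y. x \<in> cS \<Longrightarrow> x' \<in> cS \<Longrightarrow> y \<in> D \<Longrightarrow> \<bar>h x y - h x' y\<bar> \<le> L * norm (x - x')"
proof -
  have "cS \<inter> frontier D = {}" using S_subset not_in_frontier by blast
  then obtain \<rho> where \<rho>: "\<rho> > 0" "\<And>x z. x \<in> cS \<Longrightarrow> z \<in> frontier D \<Longrightarrow> \<rho> \<le> dist x z"
    using separate_compact_closed[OF compact_cS frontier_closed \<open>cS \<inter> frontier D = {}\<close>] by metis
  show thesis
  proof (rule that[of "2 / \<rho>"])
    show "\<bar>h x y - h x' y\<bar> \<le> 2 / \<rho> * norm (x - x')" if "x \<in> cS" "x' \<in> cS" "y \<in> D" for x x' y
      using h_diff_le[of x x' \<rho> y] that \<rho> S_subset by (auto simp: dist_norm mult.commute)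
  qed (use \<rho> in simp)
qed

lemma h_measurable: "(\<lambda>(x, y). indicator S x * indicator S y * h x y) \<in> borel_measurable borel"
proof -
  have "(\<lambda>p. indicator (S \<times> S) p *\<^sub>R (\<lambda>(x, y). h x y) p) \<in> borel_measurable borel"
    using S_subset open_S by (intro borel_measurable_continuous_on_indicator continuous_on_subset[OF continuous_on_h_joint] borel_open open_Times) auto
  also have "(\<lambda>p. indicator (S \<times> S) p *\<^sub>R (\<lambda>(x, y). h x y) p) = (\<lambda>(x, y). indicator S x * indicator S y * h x y)"
    by (auto simp: fun_eq_iff split: split_indicator)
  finally show ?thesis .
qed

lemma weakly_singular_log: "weakly_singular_kernel S log_kernel (diam\<^sup>2 + 1) diam"
  by (rule weakly_singular_log_kernel[OF S_sets dist_S])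

lemma weakly_singular_h: obtains C where "weakly_singular_kernel S h C diam"
proof -
  obtain M where M: "M > 0" "\<And>x y. x \<in> cS \<Longrightarrow> y \<in> cS \<Longrightarrow> \<bar>h x y\<bar> \<le> M" using h_bounded by metis
  have "weakly_singular_kernel S h (M * diam) diam"
  proof
    fix x y assume xy: "x \<in> S" "y \<in> S" "x \<noteq> y"
    have "norm (x - y) \<le> diam" using dist_S[OF xy(1,2)] by (simp add: dist_norm)
    then have "M * 1 \<le> M * (diam / norm (x - y))" using xy M by (intro mult_left_mono) auto
    then show "\<bar>h x y\<bar> \<le> M * diam / norm (x - y)" using M(2)[of x y] xy S_subset(1) by (simp add: subset_iff)
  qed (use S_sets dist_S h_measurable M diam_pos in auto)
  then show thesis by (rule that)
qed

lemma weakly_singular_g: obtains C where "weakly_singular_kernel S g C diam"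
proof -
  obtain C where "weakly_singular_kernel S h C diam" using weakly_singular_h .
  then interpret H: weakly_singular_kernel S h C diam .
  interpret L: weakly_singular_kernel S log_kernel "diam\<^sup>2 + 1" diam by (rule weakly_singular_log)
  have "weakly_singular_kernel S g (diam\<^sup>2 + 1 + C) diam"
  proof
    have "(\<lambda>p. (\<lambda>(x, y). indicator S x * indicator S y * log_kernel x y) p - (\<lambda>(x, y). indicator S x * indicator S y * h x y) p) \<in> borel_measurable borel"
      using L.K_measurable H.K_measurable by (rule borel_measurable_diff)
    then show "(\<lambda>(x, y). indicator S x * indicator S y * g x y) \<in> borel_measurable borel"
      by (simp add: g_def case_prod_unfold algebra_simps)
    show "\<bar>g x y\<bar> \<le> (diam\<^sup>2 + 1 + C) / norm (x - y)" if "x \<in> S" "y \<in> S" "x \<noteq> y" for x y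
      using L.K_bound[OF that] H.K_bound[OF that] by (simp add: g_def add_divide_distrib)
  qed (use L.C_nonneg H.C_nonneg S_sets dist_S in auto)
  then show thesis by (rule that)
qed

lemma g_commute: "x \<in> S \<Longrightarrow> y \<in> S \<Longrightarrow> g x y = g y x"
  using h_commute[of x y] S_subset by (auto simp: g_def log_kernel_commute)

lemma potential_g:
  assumes "x \<in> S" "bounded_supported S f"
  shows "potential g f x = potential log_kernel f x - potential h f x"
proof -
  obtain C where "weakly_singular_kernel S h C diam" using weakly_singular_h .
  then interpret H: weakly_singular_kernel S h C diam .
  interpret L: weakly_singular_kernel S log_kernel "diam\<^sup>2 + 1" diam by (rule weakly_singular_log)
  show ?thesis
    unfolding potential_def g_def left_diff_distrib
    using L.K_integrand_integrable H.K_integrand_integrable assms by (intro Bochner_Integration.integral_diff) auto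
qed

lemma interaction_g:
  assumes "bounded_supported S f" "bounded_supported S u"
  shows "interaction g f u = interaction log_kernel f u - interaction h f u"
proof -
  obtain C where "weakly_singular_kernel S h C diam" using weakly_singular_h .
  then interpret H: weakly_singular_kernel S h C diam .
  interpret L: weakly_singular_kernel S log_kernel "diam\<^sup>2 + 1" diam by (rule weakly_singular_log)
  have "f x * potential g u x = f x * potential log_kernel u x - f x * potential h u x" for x
    using potential_g[OF _ assms(2), of x] assms(1) by (cases "x \<in> S") (simp_all add: bounded_supported_def right_diff_distrib)
  then show ?thesis
    using L.interaction_integrable[OF assms] H.interaction_integrable[OF assms] by (simp add: interaction_def)
qed

lemma interaction_g_commute:
  assumes "bounded_supported S f" "bounded_supported S u"
  shows "interaction g f u = interaction g u f"
proof -
  obtain C where "weakly_singular_kernel S g C diam" using weakly_singular_g .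
  then interpret weakly_singular_kernel S g C diam .
  show ?thesis using assms g_commute by (rule interaction_commute)
qed

lemma bounded_S: "bounded S"
  using compact_imp_bounded[OF compact_cS] S_subset(1) by (rule bounded_subset)

lemma h_potential_lipschitz:
  assumes f: "bounded_supported S f"
  obtains L where "L \<ge> 0" "\<And>x x'. x \<in> S \<Longrightarrow> x' \<in> S \<Longrightarrow> \<bar>potential h f x - potential h f x'\<bar> \<le> L * norm (x - x')"
proof -
  obtain C where "weakly_singular_kernel S h C diam" using weakly_singular_h .
  then interpret H: weakly_singular_kernel S h C diam .
  obtain L where L: "L > 0" "\<And>x x' y. x \<in> cS \<Longrightarrow> x' \<in> cS \<Longrightarrow> y \<in> D \<Longrightarrow> \<bar>h x y - h x' y\<bar> \<le> L * norm (x - x')"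
    using h_lipschitz by metis
  show thesis
  proof (rule that[of "L * (LINT y|lborel. \<bar>f y\<bar>)"])
    fix x x' assume x: "x \<in> S" "x' \<in> S"
    have int: "integrable lborel (\<lambda>y. h x y * f y)" "integrable lborel (\<lambda>y. h x' y * f y)"
      using H.K_integrand_integrable f x by auto
    have "\<bar>potential h f x - potential h f x'\<bar> = \<bar>LINT y|lborel. h x y * f y - h x' y * f y\<bar>"
      using int by (simp add: potential_def)
    also have "\<dots> \<le> (LINT y|lborel. \<bar>h x y * f y - h x' y * f y\<bar>)" by (rule integral_abs_bound)
    also have "\<dots> \<le> (LINT y|lborel. L * norm (x - x') * \<bar>f y\<bar>)"
    proof (rule integral_mono)
      show "integrable lborel (\<lambda>y. \<bar>h x y * f y - h x' y * f y\<bar>)" using int by simp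
      show "integrable lborel (\<lambda>y. L * norm (x - x') * \<bar>f y\<bar>)"
        using bounded_supported_integrable[OF f bounded_S] by simp
      fix y
      show "\<bar>h x y * f y - h x' y * f y\<bar> \<le> L * norm (x - x') * \<bar>f y\<bar>"
      proof (cases "y \<in> S")
        case True
        have "\<bar>h x y - h x' y\<bar> * \<bar>f y\<bar> \<le> L * norm (x - x') * \<bar>f y\<bar>"
          using L(2)[of x x' y] x True S_subset by (intro mult_right_mono) auto
        then show ?thesis by (simp add: left_diff_distrib flip: abs_mult)
      qed (use f in \<open>simp add: bounded_supported_def\<close>)
    qed
    finally show "\<bar>potential h f x - potential h f x'\<bar> \<le> L * (LINT y|lborel. \<bar>f y\<bar>) * norm (x - x')"
      by (simp add: mult_ac)
  qed (use L in simp)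
qed

text \<open>Differentiation under the integral along arbitrary null sequences, dominated by a
  multiple of \<open>\<bar>f\<bar>\<close> through the Lipschitz bound. The pointwise derivative
  \<open>c\<close> carries no regularity in \<open>y\<close>; the product \<open>c y * f y\<close>
  is measurable as a limit of measurable quotients.\<close>

lemma h_potential_has_derivative:
  assumes f: "bounded_supported S f" and x: "x \<in> S"
  shows "\<exists>c. ((\<lambda>t. potential h f (x + t *\<^sub>R axis i 1)) has_real_derivative c) (at 0)"
proof -
  obtain C where "weakly_singular_kernel S h C diam" using weakly_singular_h .
  then interpret H: weakly_singular_kernel S h C diam .
  obtain L where L: "L > 0" "\<And>x x' y. x \<in> cS \<Longrightarrow> x' \<in> cS \<Longrightarrow> y \<in> D \<Longrightarrow> \<bar>h x y - h x' y\<bar> \<le> L * norm (x - x')"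
    using h_lipschitz by metis
  have "\<forall>y. \<exists>c. y \<in> S \<longrightarrow> ((\<lambda>t. h (x + t *\<^sub>R axis i 1) y) has_real_derivative c) (at 0)"
    using h_fst_differentiable[of x _ i] x S_subset by blast
  then obtain c where c: "\<And>y. y \<in> S \<Longrightarrow> ((\<lambda>t. h (x + t *\<^sub>R axis i 1) y) has_real_derivative c y) (at 0)" by metis
  obtain e where e: "e > 0" "ball x e \<subseteq> S" using open_S x openE by blast
  have "((\<lambda>t. (potential h f (x + t *\<^sub>R axis i 1) - potential h f x) / t) \<longlongrightarrow> (LINT y|lborel. c y * f y)) (at 0)"
    unfolding tendsto_at_iff_sequentially comp_def
  proof (intro allI impI)
    fix X :: "nat \<Rightarrow> real" assume X0: "\<forall>n. X n \<in> UNIV - {0}" and X: "X \<longlonglongrightarrow> 0"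
    have "\<forall>\<^sub>F n in sequentially. \<bar>X n\<bar> < e" using X e(1) by (simp add: tendsto_iff dist_norm)
    then obtain N where N: "\<And>n. n \<ge> N \<Longrightarrow> \<bar>X n\<bar> < e" by (auto simp: eventually_sequentially)
    define Y where "Y n = X (n + N)" for n
    have Y0: "Y n \<noteq> 0" for n using X0 by (simp add: Y_def)
    have Y: "Y \<longlonglongrightarrow> 0" unfolding Y_def using X by (rule LIMSEQ_ignore_initial_segment)
    have YS: "x + Y n *\<^sub>R axis i 1 \<in> S" for n
      by (rule subsetD[OF e(2)]) (use N in \<open>simp add: Y_def dist_norm\<close>)
    let ?Q = "\<lambda>n y. (h (x + Y n *\<^sub>R axis i 1) y * f y - h x y * f y) / Y n"
    have intQ: "integrable lborel (?Q n)" for n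
      using H.K_integrand_integrable[OF YS f] H.K_integrand_integrable[OF x f] by simp
    have lim: "(\<lambda>n. ?Q n y) \<longlonglongrightarrow> c y * f y" for y
    proof (cases "y \<in> S")
      case True
      have "((\<lambda>t. (h (x + t *\<^sub>R axis i 1) y - h x y) / t) \<longlongrightarrow> c y) (at 0)"
        using c[OF True] by (simp add: DERIV_def)
      moreover have "filterlim Y (at 0) sequentially"
        unfolding filterlim_at using Y Y0 by simp
      ultimately have "(\<lambda>n. (h (x + Y n *\<^sub>R axis i 1) y - h x y) / Y n) \<longlonglongrightarrow> c y" by (rule filterlim_compose)
      then have "(\<lambda>n. (h (x + Y n *\<^sub>R axis i 1) y - h x y) / Y n * f y) \<longlonglongrightarrow> c y * f y" by (rule tendsto_mult_right)
      then show ?thesis by (simp add: left_diff_distrib)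
    qed (use f in \<open>simp add: bounded_supported_def\<close>)
    have "(\<lambda>n. LINT y|lborel. ?Q n y) \<longlonglongrightarrow> (LINT y|lborel. c y * f y)"
    proof (rule integral_dominated_convergence)
      have mQ: "?Q n \<in> borel_measurable lborel" for n using intQ by (rule borel_measurable_integrable)
      then show "?Q n \<in> borel_measurable lborel" for n .
      show "(\<lambda>y. c y * f y) \<in> borel_measurable lborel" by (rule borel_measurable_LIMSEQ_real[OF lim mQ])
      show "AE y in lborel. (\<lambda>n. ?Q n y) \<longlonglongrightarrow> c y * f y" using lim by simp
      show "integrable lborel (\<lambda>y. L * \<bar>f y\<bar>)" using bounded_supported_integrable[OF f bounded_S] by simp
      have "norm (?Q n y) \<le> L * \<bar>f y\<bar>" for n y
      proof (cases "y \<in> S")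
        case True
        have "\<bar>h (x + Y n *\<^sub>R axis i 1) y - h x y\<bar> \<le> L * norm ((x + Y n *\<^sub>R axis i 1) - x)"
          using YS x True S_subset by (intro L(2)) auto
        then have "\<bar>(h (x + Y n *\<^sub>R axis i 1) y - h x y) / Y n\<bar> \<le> L" using Y0[of n] by (simp add: field_simps)
        then have "\<bar>(h (x + Y n *\<^sub>R axis i 1) y - h x y) / Y n\<bar> * \<bar>f y\<bar> \<le> L * \<bar>f y\<bar>" by (rule mult_right_mono) simp
        moreover have "?Q n y = (h (x + Y n *\<^sub>R axis i 1) y - h x y) / Y n * f y" by (simp add: left_diff_distrib)
        ultimately show ?thesis by (simp only: real_norm_def abs_mult)
      qed (use f L in \<open>simp add: bounded_supported_def\<close>)
      then show "AE y in lborel. norm (?Q n y) \<le> L * \<bar>f y\<bar>" for n by simp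
    qed
    moreover have "(LINT y|lborel. ?Q n y) = (potential h f (x + Y n *\<^sub>R axis i 1) - potential h f x) / Y n" for n
      using H.K_integrand_integrable[OF YS f] H.K_integrand_integrable[OF x f] by (simp add: potential_def)
    ultimately have "(\<lambda>n. (potential h f (x + Y n *\<^sub>R axis i 1) - potential h f x) / Y n) \<longlonglongrightarrow> (LINT y|lborel. c y * f y)"
      by (simp only:)
    then show "(\<lambda>n. (potential h f (x + X n *\<^sub>R axis i 1) - potential h f x) / X n) \<longlonglongrightarrow> (LINT y|lborel. c y * f y)"
      unfolding Y_def by (rule LIMSEQ_offset)
  qed
  then show ?thesis by (auto simp: DERIV_def)
qed

lemma g_potential_lipschitz:
  assumes f: "bounded_supported S f"
  obtains L where "L \<ge> 0" "\<And>x x'. x \<in> S \<Longrightarrow> x' \<in> S \<Longrightarrow> \<bar>potential g f x - potential g f x'\<bar> \<le> L * norm (x - x')"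
proof -
  obtain A where A: "A > 0" "\<And>x. \<bar>f x\<bar> \<le> A" using f by (metis bounded_supportedE)
  obtain L where L: "L \<ge> 0" "\<And>x x'. x \<in> S \<Longrightarrow> x' \<in> S \<Longrightarrow> \<bar>potential h f x - potential h f x'\<bar> \<le> L * norm (x - x')"
    using h_potential_lipschitz[OF f] by metis
  show thesis
  proof (rule that[of "8 * pi * diam * A + L"])
    fix x x' assume x: "x \<in> S" "x' \<in> S"
    have "\<bar>potential log_kernel f x - potential log_kernel f x'\<bar> \<le> 8 * pi * diam * A * norm (x - x')"
      using log_potential_lipschitz[OF S_sets dist_S f _ A(2) x] A(1) by simp
    then show "\<bar>potential g f x - potential g f x'\<bar> \<le> (8 * pi * diam * A + L) * norm (x - x')"
      using L(2)[OF x] by (simp add: potential_g x f algebra_simps)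
  qed (use L A diam_pos in simp)
qed

lemma g_potential_has_derivative:
  assumes f: "bounded_supported S f" and x: "x \<in> S"
  shows "\<exists>c. ((\<lambda>t. potential g f (x + t *\<^sub>R axis i 1)) has_real_derivative c) (at 0)"
proof -
  obtain A where A: "A > 0" "\<And>x. \<bar>f x\<bar> \<le> A" using f by (metis bounded_supportedE)
  obtain e where e: "e > 0" "ball x e \<subseteq> S" using open_S x openE by blast
  obtain c where c: "((\<lambda>t. potential h f (x + t *\<^sub>R axis i 1)) has_real_derivative c) (at 0)"
    using h_potential_has_derivative[OF f x] by blast
  have l: "((\<lambda>t. potential log_kernel f (x + t *\<^sub>R axis i 1)) has_real_derivative potential (log_kernel_partial i) f x) (at 0)"
    using log_potential_has_derivative[OF S_sets dist_S f _ A(2) open_S x] A(1) by simp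
  have "\<forall>\<^sub>F t in nhds 0. \<bar>t\<bar> < e" using e by (auto simp: eventually_nhds_metric dist_norm)
  then have ev: "\<forall>\<^sub>F t in nhds 0. potential g f (x + t *\<^sub>R axis i 1) = potential log_kernel f (x + t *\<^sub>R axis i 1) - potential h f (x + t *\<^sub>R axis i 1)"
  proof eventually_elim
    case (elim t)
    have "x + t *\<^sub>R axis i 1 \<in> S" by (rule subsetD[OF e(2)]) (use elim in \<open>simp add: dist_norm\<close>)
    then show ?case using f by (rule potential_g)
  qed
  show ?thesis using DERIV_cong_ev[OF refl ev refl] DERIV_diff[OF l c] by blast
qed

end

section \<open>Sign-free vorticity profiles and the bathtub principle\<close>

definition profile :: "real \<Rightarrow> real \<Rightarrow> (real^2) set \<Rightarrow> (real^2 \<Rightarrow> real) \<Rightarrow> bool" where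
  "profile m lam B f \<longleftrightarrow> f \<in> borel_measurable borel \<and> (\<forall>x. 0 \<le> f x \<and> f x \<le> lam) \<and>
     (\<forall>x. x \<notin> B \<longrightarrow> f x = 0) \<and> (LINT x|lborel. f x) = m"

lemma profile_bounded_supported: "profile m lam B f \<Longrightarrow> bounded_supported B f"
  by (rule bounded_supportedI[of _ lam]) (auto simp: profile_def)

lemma profile_integrable:
  assumes "profile m lam B f" "bounded B" shows "integrable lborel f"
  using bounded_supported_integrable[OF profile_bounded_supported[OF assms(1)] assms(2)] .

lemma profile_convex:
  assumes f: "profile m lam B f" and f': "profile m lam B f'" and B: "bounded B" and t: "0 \<le> t" "t \<le> 1"
  shows "profile m lam B (\<lambda>x. f x + t * (f' x - f x))"
  unfolding profile_def
proof (intro conjI allI impI)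
  have [measurable]: "f \<in> borel_measurable borel" "f' \<in> borel_measurable borel" using f f' by (simp_all add: profile_def)
  show "(\<lambda>x. f x + t * (f' x - f x)) \<in> borel_measurable borel" by measurable
  fix x
  have eq: "f x + t * (f' x - f x) = (1 - t) * f x + t * f' x" by (simp add: algebra_simps)
  have b: "0 \<le> f x" "f x \<le> lam" "0 \<le> f' x" "f' x \<le> lam" using f f' by (auto simp: profile_def)
  show "0 \<le> f x + t * (f' x - f x)" unfolding eq using b t by simp
  show "f x + t * (f' x - f x) \<le> lam" unfolding eq using b t by (intro convex_bound_le) auto
  show "f x + t * (f' x - f x) = 0" if "x \<notin> B" using f f' that by (simp add: profile_def)
next
  show "(LINT x|lborel. f x + t * (f' x - f x)) = m"
    using profile_integrable[OF f B] profile_integrable[OF f' B] f f' by (simp add: profile_def)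
qed

text \<open>An optimal density fills the superlevel sets of \<open>\<phi>\<close> from the top. With
  a level satisfying \<open>V \<mu> \<le> m / lam \<le> U\<close>, the density \<open>F\<close> that
  is full above the level and constant on the level set has mass \<open>m\<close>. Then
  \<open>(\<phi> - \<mu>) * (F - f)\<close> is nonnegative pointwise while optimality makes its
  integral nonpositive, so \<open>f = F\<close> off the level set.\<close>

lemma bathtub_level:
  fixes \<phi> :: "real^2 \<Rightarrow> real"
  assumes cont: "continuous_on (ball p \<delta>) \<phi>" and bnd: "\<And>x. x \<in> ball p \<delta> \<Longrightarrow> \<bar>\<phi> x\<bar> \<le> A"
    and f: "profile m lam (ball p \<delta>) f" and lam: "lam > 0" and \<delta>: "\<delta> > 0" and m: "0 < m" "m < lam * (pi * \<delta>\<^sup>2)"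
    and opt: "\<And>f'. profile m lam (ball p \<delta>) f' \<Longrightarrow> (LINT x|lborel. f' x * \<phi> x) \<le> (LINT x|lborel. f x * \<phi> x)"
  obtains \<mu> where "measure lborel {x \<in> ball p \<delta>. \<phi> x > \<mu>} \<le> m / lam"
    "AE x in lborel. x \<in> ball p \<delta> \<longrightarrow> \<phi> x > \<mu> \<longrightarrow> f x = lam"
    "AE x in lborel. x \<in> ball p \<delta> \<longrightarrow> \<phi> x < \<mu> \<longrightarrow> f x = 0"
proof -
  let ?B = "ball p \<delta>"
  define c where "c = m / lam"
  have area: "measure lborel ?B = pi * \<delta>\<^sup>2"
    using content_ball[of \<delta> p] \<delta> by (simp add: unit_ball_vol_2)
  have c: "0 < c" "c < measure lborel ?B" using m lam by (auto simp: c_def area field_simps)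
  have finB: "emeasure lborel ?B < \<infinity>" using emeasure_bounded_finite[of ?B] by simp
  have meas: "?B \<inter> \<phi> -` X \<in> sets borel" if "X \<in> sets borel" for X
  proof -
    have "\<phi> \<in> borel_measurable (restrict_space borel ?B)" using cont by (rule borel_measurable_continuous_on_restrict)
    then have "\<phi> -` X \<inter> space (restrict_space borel ?B) \<in> sets (restrict_space borel ?B)" using that by (rule measurable_sets)
    then show ?thesis by (auto simp: space_restrict_space sets_restrict_space_iff Int_commute)
  qed
  have fin: "emeasure lborel (?B \<inter> X) \<noteq> \<infinity>" for X
    using emeasure_mono[of "?B \<inter> X" ?B lborel] finB by (auto simp: top_unique)
  define V where "V s = measure lborel (?B \<inter> \<phi> -` {s<..})" for s
  have V_mono: "V t \<le> V s" if "s \<le> t" for s t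
    unfolding V_def using that fin[of "\<phi> -` {s<..}"] meas by (intro measure_mono_fmeasurable) (auto simp: fmeasurable_def top.not_eq_extremum)
  define X where "X = {s. V s \<le> c}"
  have "A \<in> X"
  proof -
    have "?B \<inter> \<phi> -` {A<..} = {}" using bnd by (force simp: abs_le_iff)
    then show ?thesis using c by (simp add: X_def V_def)
  qed
  have lower: "s \<ge> - A - 1" if "s \<in> X" for s
  proof (rule ccontr)
    assume "\<not> s \<ge> - A - 1"
    then have "?B \<inter> \<phi> -` {s<..} = ?B" using bnd by (force simp: abs_le_iff)
    then show False using that c by (simp add: X_def V_def)
  qed
  \<comment> \<open>\<open>V\<close> is nonincreasing, and \<open>X\<close> is bounded below because
    the whole disc has area larger than \<open>c\<close>. Continuity of the measure from below
    yields \<open>V \<mu> \<le> c\<close>, continuity from above yields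
    \<open>c \<le> U\<close>.\<close>
  define \<mu> where "\<mu> = Inf X"
  have bb: "bdd_below X" using lower by (auto simp: bdd_below_def)
  have above: "V s \<le> c" if "s > \<mu>" for s
  proof -
    have "X \<noteq> {}" using \<open>A \<in> X\<close> by auto
    then have "\<exists>s'\<in>X. s' < s" using that[unfolded \<mu>_def] by (rule cInf_lessD)
    then obtain s' where "s' \<in> X" "s' < s" by auto
    then show ?thesis using V_mono[of s' s] by (simp add: X_def)
  qed
  have below: "V s > c" if "s < \<mu>" for s
    using that cInf_lower[OF _ bb, of s] by (force simp: \<mu>_def X_def)
  have V\<mu>: "V \<mu> \<le> c"
  proof -
    let ?T = "\<lambda>n. ?B \<inter> \<phi> -` {\<mu> + 1 / real (Suc n)<..}"
    have U: "(\<Union>n. ?T n) = ?B \<inter> \<phi> -` {\<mu><..}"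
    proof (intro set_eqI iffI)
      fix x assume x: "x \<in> ?B \<inter> \<phi> -` {\<mu><..}"
      then have "\<phi> x - \<mu> > 0" by simp
      then obtain n where "1 / real (Suc n) < \<phi> x - \<mu>" by (rule nat_approx_posE)
      then show "x \<in> (\<Union>n. ?T n)" using x by (auto intro!: exI[of _ n])
    next
      fix x assume "x \<in> (\<Union>n. ?T n)"
      then obtain n where "x \<in> ?B" "\<mu> + 1 / real (Suc n) < \<phi> x" by auto
      moreover have "1 / real (Suc n) > 0" by simp
      ultimately have "x \<in> ?B" "\<mu> < \<phi> x" by linarith+
      then show "x \<in> ?B \<inter> \<phi> -` {\<mu><..}" by simp
    qed
    have "(\<lambda>n. measure lborel (?T n)) \<longlonglongrightarrow> measure lborel (\<Union>n. ?T n)"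
    proof (rule Lim_measure_incseq)
      show "incseq ?T"
      proof (rule incseq_SucI)
        fix n
        have "1 / real (Suc (Suc n)) \<le> 1 / real (Suc n)" by (simp add: frac_le)
        then show "?T n \<subseteq> ?T (Suc n)" by (auto simp del: of_nat_Suc)
      qed
    qed (use meas fin U in auto)
    moreover have "measure lborel (?T n) \<le> c" for n using above[of "\<mu> + 1 / real (Suc n)"] by (simp add: V_def)
    ultimately show ?thesis unfolding V_def U by (intro LIMSEQ_le_const2) auto
  qed
  define U where "U = measure lborel (?B \<inter> \<phi> -` {\<mu>..})"
  have U\<mu>: "c \<le> U"
  proof -
    let ?T = "\<lambda>n. ?B \<inter> \<phi> -` {\<mu> - 1 / real (Suc n)<..}"
    have I: "(\<Inter>n. ?T n) = ?B \<inter> \<phi> -` {\<mu>..}"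
    proof (intro set_eqI iffI)
      fix x assume x: "x \<in> (\<Inter>n. ?T n)"
      show "x \<in> ?B \<inter> \<phi> -` {\<mu>..}"
      proof (rule ccontr)
        assume "x \<notin> ?B \<inter> \<phi> -` {\<mu>..}"
        then have "\<mu> - \<phi> x > 0" using x by auto
        then obtain n where "1 / real (Suc n) < \<mu> - \<phi> x" by (rule nat_approx_posE)
        moreover have "\<mu> - 1 / real (Suc n) < \<phi> x" using x by auto
        ultimately show False by simp
      qed
    next
      fix x assume x: "x \<in> ?B \<inter> \<phi> -` {\<mu>..}"
      have "\<mu> - 1 / real (Suc n) < \<phi> x" for n
      proof -
        have "1 / real (Suc n) > 0" by simp
        moreover have "\<mu> \<le> \<phi> x" using x by simp
        ultimately show ?thesis by linarith
      qed
      then show "x \<in> (\<Inter>n. ?T n)" using x by auto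
    qed
    have "(\<lambda>n. measure lborel (?T n)) \<longlonglongrightarrow> measure lborel (\<Inter>n. ?T n)"
    proof (rule Lim_measure_decseq)
      show "decseq ?T"
      proof (rule decseq_SucI)
        fix n
        have "1 / real (Suc (Suc n)) \<le> 1 / real (Suc n)" by (simp add: frac_le)
        then show "?T (Suc n) \<subseteq> ?T n" by (auto simp del: of_nat_Suc)
      qed
    qed (use meas fin in auto)
    moreover have "c \<le> measure lborel (?T n)" for n using below[of "\<mu> - 1 / real (Suc n)"] by (simp add: V_def)
    ultimately show ?thesis unfolding U_def I by (intro LIMSEQ_le_const) auto
  qed
  define E where "E = measure lborel (?B \<inter> \<phi> -` {\<mu>})"
  have UVE: "U = V \<mu> + E"
  proof -
    have "?B \<inter> \<phi> -` {\<mu>..} = (?B \<inter> \<phi> -` {\<mu><..}) \<union> (?B \<inter> \<phi> -` {\<mu>})" by auto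
    then show ?thesis unfolding U_def V_def E_def using fin meas
      by (simp, intro measure_Union) (auto simp: top.not_eq_extremum)
  qed
  \<comment> \<open>The fraction of the level set needed to reach mass \<open>m\<close>. If the
    level set is null, then \<open>V \<mu> = c\<close> already and the default 0 is right.\<close>
  define \<theta> where "\<theta> = (if E = 0 then 0 else (c - V \<mu>) / E)"
  have E0: "E \<ge> 0" by (simp add: E_def)
  have \<theta>: "0 \<le> \<theta>" "\<theta> \<le> 1" "V \<mu> + \<theta> * E = c"
    using V\<mu> U\<mu> UVE E0 by (auto simp: \<theta>_def field_simps)
  define F where "F x = lam * (indicator (?B \<inter> \<phi> -` {\<mu><..}) x + \<theta> * indicator (?B \<inter> \<phi> -` {\<mu>}) x)" for x
  have m1: "?B \<inter> \<phi> -` {\<mu><..} \<in> sets borel" and m2: "?B \<inter> \<phi> -` {\<mu>} \<in> sets borel" using meas by auto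
  have F: "profile m lam ?B F"
    unfolding profile_def
  proof (intro conjI allI impI)
    show "F \<in> borel_measurable borel" unfolding F_def using m1 m2 by measurable
    show "0 \<le> F x" for x using lam \<theta> by (simp add: F_def)
    show "F x \<le> lam" for x
    proof -
      have "indicator (?B \<inter> \<phi> -` {\<mu><..}) x + \<theta> * indicator (?B \<inter> \<phi> -` {\<mu>}) x \<le> 1"
        using \<theta> by (auto split: split_indicator)
      then show ?thesis unfolding F_def using lam by (simp add: mult_left_le)
    qed
    show "F x = 0" if "x \<notin> ?B" for x using that by (simp add: F_def)
    have "(LINT x|lborel. F x) = lam * (V \<mu> + \<theta> * E)"
      unfolding F_def integral_mult_right_zero V_def E_def
      using m1 m2 fin by (subst Bochner_Integration.integral_add) (auto simp: top.not_eq_extremum intro!: integrable_mult_right integrable_real_indicator)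
    then show "(LINT x|lborel. F x) = m" using \<theta>(3) lam by (simp add: c_def)
  qed
  have mphi: "(\<lambda>x. indicator ?B x *\<^sub>R \<phi> x) \<in> borel_measurable borel"
    using cont by (intro borel_measurable_continuous_on_indicator) auto
  have int\<phi>: "integrable lborel (\<lambda>x. u x * \<phi> x)" if u: "profile m lam ?B u" for u
  proof -
    have "bounded_supported ?B (\<lambda>x. u x * (indicator ?B x *\<^sub>R \<phi> x))"
    proof (rule bounded_supportedI)
      show "(\<lambda>x. u x * (indicator ?B x *\<^sub>R \<phi> x)) \<in> borel_measurable borel"
        using u mphi by (intro borel_measurable_times) (auto simp: profile_def)
      show "\<bar>u x * (indicator ?B x *\<^sub>R \<phi> x)\<bar> \<le> lam * \<bar>A\<bar>" for x
      proof (cases "x \<in> ?B")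
        case True
        have "\<bar>u x\<bar> * \<bar>\<phi> x\<bar> \<le> lam * \<bar>A\<bar>"
          using u bnd[OF True] by (intro mult_mono) (auto simp: profile_def)
        then show ?thesis using True by (simp add: abs_mult)
      qed (use lam in simp)
    qed simp
    then have "integrable lborel (\<lambda>x. u x * (indicator ?B x *\<^sub>R \<phi> x))" by (rule bounded_supported_integrable) simp
    also have "(\<lambda>x. u x * (indicator ?B x *\<^sub>R \<phi> x)) = (\<lambda>x. u x * \<phi> x)"
      using u by (auto simp: profile_def fun_eq_iff split: split_indicator)
    finally show ?thesis .
  qed
  let ?d = "\<lambda>x. (\<phi> x - \<mu>) * (F x - f x)"
  have eqd: "?d x = F x * \<phi> x - f x * \<phi> x - \<mu> * (F x - f x)" for x by (simp add: algebra_simps)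
  have intF: "integrable lborel F" "integrable lborel f" using profile_integrable F f by auto
  have intd: "integrable lborel ?d" unfolding eqd using int\<phi>[OF F] int\<phi>[OF f] intF by simp
  have nonneg: "?d x \<ge> 0" for x
  proof -
    have b: "0 \<le> f x" "f x \<le> lam" "x \<notin> ?B \<Longrightarrow> f x = 0" using f by (auto simp: profile_def)
    consider "x \<notin> ?B" | "x \<in> ?B" "\<phi> x > \<mu>" | "x \<in> ?B" "\<phi> x < \<mu>" | "x \<in> ?B" "\<phi> x = \<mu>" by fastforce
    then show ?thesis
    proof cases
      case 1 then show ?thesis using b by (simp add: F_def)
    next
      case 2 then show ?thesis using b by (simp add: F_def)
    next
      case 3
      then have "F x = 0" by (simp add: F_def)
      then show ?thesis using 3 b(1) mult_nonpos_nonneg[of "\<phi> x - \<mu>" "f x"] by simp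
    qed simp
  qed
  \<comment> \<open>\<open>F\<close> and \<open>f\<close> have the same mass, so the term with
    \<open>\<mu>\<close> integrates to zero.\<close>
  have d_eq: "(LINT x|lborel. ?d x) = (LINT x|lborel. F x * \<phi> x) - (LINT x|lborel. f x * \<phi> x)"
    unfolding eqd using int\<phi>[OF F] int\<phi>[OF f] intF F f by (simp add: profile_def)
  have "0 \<le> (LINT x|lborel. ?d x)" using nonneg by (rule Bochner_Integration.integral_nonneg)
  then have "(LINT x|lborel. ?d x) = 0" using opt[OF F] d_eq by linarith
  then have "AE x in lborel. ?d x = 0" using integral_nonneg_eq_0_iff_AE[OF intd] nonneg by simp
  then have AE: "AE x in lborel. \<phi> x \<noteq> \<mu> \<longrightarrow> f x = F x" by eventually_elim auto
  show thesis
  proof (rule that[of \<mu>])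
    have "{x \<in> ?B. \<phi> x > \<mu>} = ?B \<inter> \<phi> -` {\<mu><..}" by auto
    then show "measure lborel {x \<in> ?B. \<phi> x > \<mu>} \<le> m / lam" using V\<mu> by (simp add: V_def c_def)
    show "AE x in lborel. x \<in> ?B \<longrightarrow> \<phi> x > \<mu> \<longrightarrow> f x = lam" using AE by eventually_elim (auto simp: F_def)
    show "AE x in lborel. x \<in> ?B \<longrightarrow> \<phi> x < \<mu> \<longrightarrow> f x = 0" using AE by eventually_elim (auto simp: F_def)
  qed
qed

section \<open>First variation of the energy and the optimality conditions\<close>

context vortex_domain
begin

lemma ball_subset_S: "ball p1 \<delta> \<subseteq> S" "ball p2 \<delta> \<subseteq> S" by (auto simp: S_def)

lemma profile_supported_S:
  "profile m lam (ball p1 \<delta>) a \<Longrightarrow> bounded_supported S a" "profile m lam (ball p2 \<delta>) b \<Longrightarrow> bounded_supported S b"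
  using profile_bounded_supported bounded_supported_mono ball_subset_S by blast+

lemma interaction_g_lincomb:
  assumes f: "bounded_supported S f" and u: "bounded_supported S u"
  shows "interaction g (\<lambda>x. f x + t * u x) (\<lambda>x. f x + t * u x)
    = interaction g f f + 2 * t * interaction g u f + t\<^sup>2 * interaction g u u"
proof -
  obtain C where "weakly_singular_kernel S g C diam" using weakly_singular_g .
  then interpret weakly_singular_kernel S g C diam .
  have fu: "bounded_supported S (\<lambda>x. f x + t * u x)" using bounded_supported_lincomb[OF f u, of 1 t] by simp
  have "interaction g (\<lambda>x. f x + t * u x) (\<lambda>x. f x + t * u x)
     = interaction g f (\<lambda>x. f x + t * u x) + t * interaction g u (\<lambda>x. f x + t * u x)"
    using interaction_lincomb_left[OF f u fu, of 1 t] by simp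
  also have "interaction g f (\<lambda>x. f x + t * u x) = interaction g f f + t * interaction g f u"
    using interaction_lincomb_right[OF f u f, of 1 t] by simp
  also have "interaction g u (\<lambda>x. f x + t * u x) = interaction g u f + t * interaction g u u"
    using interaction_lincomb_right[OF f u u, of 1 t] by simp
  finally show ?thesis using interaction_g_commute[OF f u] by (simp add: algebra_simps power2_eq_square)
qed

text \<open>By symmetry of \<open>g\<close> the energy increment is
  \<open>t * (2 * ?I + t * ?J)\<close>; divide by \<open>t\<close> and let \<open>t\<close> tend to
  0 from the right.\<close>

lemma first_variation:
  assumes f: "bounded_supported S f" and u: "bounded_supported S u"
    and max: "\<And>t. 0 < t \<Longrightarrow> t \<le> 1 \<Longrightarrow>
      interaction g (\<lambda>x. f x + t * u x) (\<lambda>x. f x + t * u x) \<le> interaction g f f"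
  shows "(LINT x|lborel. u x * potential g f x) \<le> 0"
proof -
  let ?I = "interaction g u f" and ?J = "interaction g u u"
  have "2 * ?I + t * ?J \<le> 0" if "0 < t" "t \<le> 1" for t
  proof -
    have "t * (2 * ?I + t * ?J) \<le> 0"
      using max[OF that] by (simp add: interaction_g_lincomb[OF f u] algebra_simps power2_eq_square)
    then show ?thesis using that by (simp add: mult_le_0_iff)
  qed
  then have ev: "\<forall>\<^sub>F t in at_right 0. 2 * ?I + t * ?J \<le> 0"
    by (auto simp: eventually_at_right_field intro!: exI[of _ 1])
  have "((\<lambda>t. 2 * ?I + t * ?J) \<longlongrightarrow> 2 * ?I + 0 * ?J) (at_right 0)" by (intro tendsto_intros)
  then have "2 * ?I + 0 * ?J \<le> 0" using ev by (rule tendsto_upperbound) simp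
  then show ?thesis by (simp add: interaction_def)
qed

definition admissible :: "real \<Rightarrow> real \<Rightarrow> real \<Rightarrow> (real^2 \<Rightarrow> real) \<Rightarrow> (real^2 \<Rightarrow> real) \<Rightarrow> bool" where
  "admissible m1 m2 lam a b \<longleftrightarrow> profile m1 lam (ball p1 \<delta>) a \<and> profile m2 lam (ball p2 \<delta>) b"

text \<open>Twice the kinetic energy of the vorticity \<open>a - b\<close>.\<close>

definition pair_energy :: "(real^2 \<Rightarrow> real) \<Rightarrow> (real^2 \<Rightarrow> real) \<Rightarrow> real" where
  "pair_energy a b = interaction g (\<lambda>x. a x - b x) (\<lambda>x. a x - b x)"

definition pair_maximizer :: "real \<Rightarrow> real \<Rightarrow> real \<Rightarrow> (real^2 \<Rightarrow> real) \<Rightarrow> (real^2 \<Rightarrow> real) \<Rightarrow> bool" where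
  "pair_maximizer m1 m2 lam a b \<longleftrightarrow> admissible m1 m2 lam a b \<and>
     (\<forall>a' b'. admissible m1 m2 lam a' b' \<longrightarrow> pair_energy a' b' \<le> pair_energy a b)"

lemma g_potential_continuous:
  assumes f: "bounded_supported S f" shows "continuous_on S (potential g f)"
proof -
  obtain L where "L \<ge> 0" "\<And>x x'. x \<in> S \<Longrightarrow> x' \<in> S \<Longrightarrow> \<bar>potential g f x - potential g f x'\<bar> \<le> L * norm (x - x')"
    using g_potential_lipschitz[OF f] by metis
  then have "L-lipschitz_on S (potential g f)" by (intro lipschitz_onI) (auto simp: dist_norm)
  then show ?thesis by (rule lipschitz_on_continuous_on)
qed

lemma g_potential_bounded:
  assumes f: "bounded_supported S f" obtains A where "\<And>x. x \<in> S \<Longrightarrow> \<bar>potential g f x\<bar> \<le> A"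
proof -
  obtain C where "weakly_singular_kernel S g C diam" using weakly_singular_g .
  then interpret weakly_singular_kernel S g C diam .
  obtain A where A: "A > 0" "\<And>x. \<bar>f x\<bar> \<le> A" using f by (metis bounded_supportedE)
  have "\<bar>potential g f x\<bar> \<le> A * C * (4 * pi * diam)" if "x \<in> S" for x
  proof -
    have "\<bar>potential g f x\<bar> \<le> (LINT y|lborel. \<bar>g x y * f y\<bar>)" unfolding potential_def by (rule integral_abs_bound)
    also have "\<dots> \<le> A * C * (4 * pi * diam)" using norm_potential_bound[OF that f _ A(2)] A(1) by simp
    finally show ?thesis .
  qed
  then show thesis by (rule that)
qed

lemma potential_minus: "potential K (\<lambda>x. - f x) x = - potential K f x"
  by (simp add: potential_def)

text \<open>Moving one component towards a competitor while freezing the other shows that it solves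
  a linear problem weighted by the potential of the maximizer, to which the bathtub principle
  applies. The area bounds are recorded because they later force a level from below.\<close>

lemma maximizer_levels:
  assumes max: "pair_maximizer m1 m2 lam a b" and lam: "lam > 0"
    and m: "0 < m1" "m1 < lam * (pi * \<delta>\<^sup>2)" "0 < m2" "m2 < lam * (pi * \<delta>\<^sup>2)"
  obtains \<mu>1 \<mu>2 where
    "measure lborel {x \<in> ball p1 \<delta>. potential g (\<lambda>x. a x - b x) x > \<mu>1} \<le> m1 / lam"
    "AE x in lborel. x \<in> ball p1 \<delta> \<longrightarrow> potential g (\<lambda>x. a x - b x) x > \<mu>1 \<longrightarrow> a x = lam"
    "AE x in lborel. x \<in> ball p1 \<delta> \<longrightarrow> potential g (\<lambda>x. a x - b x) x < \<mu>1 \<longrightarrow> a x = 0"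
    "measure lborel {x \<in> ball p2 \<delta>. potential g (\<lambda>x. b x - a x) x > \<mu>2} \<le> m2 / lam"
    "AE x in lborel. x \<in> ball p2 \<delta> \<longrightarrow> potential g (\<lambda>x. b x - a x) x > \<mu>2 \<longrightarrow> b x = lam"
    "AE x in lborel. x \<in> ball p2 \<delta> \<longrightarrow> potential g (\<lambda>x. b x - a x) x < \<mu>2 \<longrightarrow> b x = 0"
proof -
  have a: "profile m1 lam (ball p1 \<delta>) a" and b: "profile m2 lam (ball p2 \<delta>) b"
    and opt: "\<And>a' b'. admissible m1 m2 lam a' b' \<Longrightarrow> pair_energy a' b' \<le> pair_energy a b"
    using max by (auto simp: pair_maximizer_def admissible_def)
  note sa = profile_supported_S(1)[OF a] and sb = profile_supported_S(2)[OF b]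
  have sab: "bounded_supported S (\<lambda>x. a x - b x)" and sba: "bounded_supported S (\<lambda>x. b x - a x)"
    using bounded_supported_diff sa sb by auto
  have int: "integrable lborel (\<lambda>x. u x * potential g (\<lambda>x. a x - b x) x)" if "bounded_supported S u" for u
  proof -
    obtain C where "weakly_singular_kernel S g C diam" using weakly_singular_g .
    then interpret weakly_singular_kernel S g C diam .
    show ?thesis using that sab by (rule interaction_integrable)
  qed
  obtain A where A: "\<And>x. x \<in> S \<Longrightarrow> \<bar>potential g (\<lambda>x. a x - b x) x\<bar> \<le> A" using g_potential_bounded[OF sab] by metis
  have neg: "potential g (\<lambda>x. b x - a x) x = - potential g (\<lambda>x. a x - b x) x" for x
    using potential_minus[of g "\<lambda>x. a x - b x" x] by simp
  have opt1: "(LINT x|lborel. a' x * potential g (\<lambda>x. a x - b x) x) \<le> (LINT x|lborel. a x * potential g (\<lambda>x. a x - b x) x)"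
    if a': "profile m1 lam (ball p1 \<delta>) a'" for a'
  proof -
    note sa' = profile_supported_S(1)[OF a']
    have "(LINT x|lborel. (a' x - a x) * potential g (\<lambda>x. a x - b x) x) \<le> 0"
    proof (rule first_variation[OF sab bounded_supported_diff[OF sa' sa]])
      fix t :: real assume t: "0 < t" "t \<le> 1"
      have "admissible m1 m2 lam (\<lambda>x. a x + t * (a' x - a x)) b"
        unfolding admissible_def using profile_convex[OF a a'] b t by simp
      from opt[OF this] show "interaction g (\<lambda>x. a x - b x + t * (a' x - a x)) (\<lambda>x. a x - b x + t * (a' x - a x)) \<le> interaction g (\<lambda>x. a x - b x) (\<lambda>x. a x - b x)"
        by (simp add: pair_energy_def algebra_simps)
    qed
    then show ?thesis using int[OF sa] int[OF sa'] by (simp add: left_diff_distrib)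
  qed
  have opt2: "(LINT x|lborel. b' x * potential g (\<lambda>x. b x - a x) x) \<le> (LINT x|lborel. b x * potential g (\<lambda>x. b x - a x) x)"
    if b': "profile m2 lam (ball p2 \<delta>) b'" for b'
  proof -
    note sb' = profile_supported_S(2)[OF b']
    \<comment> \<open>The second component enters the vorticity with a minus sign, so moving
      \<open>b\<close> towards \<open>b'\<close> is a variation in the direction
      \<open>b - b'\<close>.\<close>
    have "(LINT x|lborel. (b x - b' x) * potential g (\<lambda>x. a x - b x) x) \<le> 0"
    proof (rule first_variation[OF sab bounded_supported_diff[OF sb sb']])
      fix t :: real assume t: "0 < t" "t \<le> 1"
      have "admissible m1 m2 lam a (\<lambda>x. b x + t * (b' x - b x))"
        unfolding admissible_def using profile_convex[OF b b'] a t by simp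
      from opt[OF this] show "interaction g (\<lambda>x. a x - b x + t * (b x - b' x)) (\<lambda>x. a x - b x + t * (b x - b' x)) \<le> interaction g (\<lambda>x. a x - b x) (\<lambda>x. a x - b x)"
        by (simp add: pair_energy_def algebra_simps)
    qed
    then show ?thesis using int[OF sb] int[OF sb'] by (simp add: neg left_diff_distrib)
  qed
  obtain \<mu>1 where 1: "measure lborel {x \<in> ball p1 \<delta>. potential g (\<lambda>x. a x - b x) x > \<mu>1} \<le> m1 / lam"
    "AE x in lborel. x \<in> ball p1 \<delta> \<longrightarrow> potential g (\<lambda>x. a x - b x) x > \<mu>1 \<longrightarrow> a x = lam"
    "AE x in lborel. x \<in> ball p1 \<delta> \<longrightarrow> potential g (\<lambda>x. a x - b x) x < \<mu>1 \<longrightarrow> a x = 0"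
    using continuous_on_subset[OF g_potential_continuous[OF sab] ball_subset_S(1)] A[OF subsetD[OF ball_subset_S(1)]] a lam \<delta> m(1,2) opt1
    by (rule bathtub_level)
  obtain \<mu>2 where 2: "measure lborel {x \<in> ball p2 \<delta>. potential g (\<lambda>x. b x - a x) x > \<mu>2} \<le> m2 / lam"
    "AE x in lborel. x \<in> ball p2 \<delta> \<longrightarrow> potential g (\<lambda>x. b x - a x) x > \<mu>2 \<longrightarrow> b x = lam"
    "AE x in lborel. x \<in> ball p2 \<delta> \<longrightarrow> potential g (\<lambda>x. b x - a x) x < \<mu>2 \<longrightarrow> b x = 0"
  proof (rule bathtub_level[OF continuous_on_subset[OF g_potential_continuous[OF sba] ball_subset_S(2)] _ b lam \<delta> m(3,4) opt2])
    show "\<bar>potential g (\<lambda>x. b x - a x) x\<bar> \<le> A" if "x \<in> ball p2 \<delta>" for x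
      unfolding neg using A[OF subsetD[OF ball_subset_S(2) that]] by simp
  qed
  show thesis using 1 2 by (rule that)
qed

end

section \<open>Concentration of a single vortex\<close>

text \<open>\<open>C / m + 1\<close> bounds the scaled logarithmic potential at a good point,
  \<open>6 * m\<close> is lost in passing to its neighbourhood, and \<open>4 * pi * C\<close> pays
  for the bounded perturbation twice: in the bound for the level and at a point above the
  level.\<close>

definition concentration_constant :: "real \<Rightarrow> real \<Rightarrow> real" where
  "concentration_constant m C = 6 * m + C / m + 1 + 4 * pi * C"

text \<open>The exponential is the radius, in units of the core radius, outside which less than half
  of the mass lies. The factor 2 is the greatest possible distance, in that unit, between the
  centres of two such discs that meet.\<close>

definition concentration_radius :: "real \<Rightarrow> real \<Rightarrow> real" where
  "concentration_radius m C = 2 * exp (2 * (concentration_constant m C + 4 * m) / m + 1)"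

text \<open>The 5 is the factor by which a scaled distance, cut off below at 1, can grow when its
  base point moves by at most four core radii.\<close>

lemma ln_5_le: "ln (5::real) \<le> 2"
proof -
  have "(1 + 1 / 2 + (1/2)\<^sup>2 / 2 :: real) \<le> exp (1/2)" by (rule exp_lower_Taylor_quadratic) simp
  then have "(13/8 :: real) \<le> exp (1/2)" by (simp add: power2_eq_square)
  then have "(13/8 :: real) ^ 4 \<le> exp (1/2) ^ 4" by (intro power_mono) auto
  also have "exp (1/2 :: real) ^ 4 = exp 2" by (simp flip: exp_of_nat_mult)
  finally have "5 \<le> exp (2::real)" by (simp add: power4_eq_xxxx)
  then show ?thesis using ln_le_cancel_iff[of 5 "exp 2"] by simp
qed

section \<open>The potential of a single profile in units of the core radius\<close>

context
  fixes S :: "(real^2) set" and d \<delta> lam \<epsilon> m C \<mu> :: real and p :: "real^2" and f w :: "real^2 \<Rightarrow> real"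
  assumes S: "S \<in> sets borel" "\<And>x y. x \<in> S \<Longrightarrow> y \<in> S \<Longrightarrow> dist x y < d" "ball p \<delta> \<subseteq> S"
    and f: "profile m lam (ball p \<delta>) f" and m: "m > 0" and lam: "lam > 0"
    and \<epsilon>: "\<epsilon> > 0" "pi * \<epsilon>\<^sup>2 * lam = m" "2 * \<epsilon> \<le> \<delta>" and C: "C \<ge> 0"
begin

interpretation L: weakly_singular_kernel S log_kernel "d\<^sup>2 + 1" d
  by (rule weakly_singular_log_kernel[OF S(1,2)])

text \<open>Measuring distances in units of \<open>\<epsilon>\<close> removes the divergent term
  \<open>ln (1 / \<epsilon>)\<close>, so that all bounds become independent of
  \<open>lam\<close>.\<close>

definition scaled_log :: "real^2 \<Rightarrow> real^2 \<Rightarrow> real" where "scaled_log x y = ln (norm (x - y) / \<epsilon>)"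

lemma f_supported: "bounded_supported S f"
  using profile_bounded_supported[OF f] S(3) by (rule bounded_supported_mono)

lemma f_bounds: "0 \<le> f x" "f x \<le> lam" "x \<notin> ball p \<delta> \<Longrightarrow> f x = 0" "(LINT x|lborel. f x) = m" "f \<in> borel_measurable borel"
  using f by (auto simp: profile_def)

lemma f_integrable: "integrable lborel f"
  using profile_integrable[OF f] by simp

lemma scaled_log_eq: "y \<noteq> x \<Longrightarrow> scaled_log x y * f y = - 2 * pi * (log_kernel x y * f y) - ln \<epsilon> * f y"
  using \<epsilon> by (simp add: scaled_log_def log_kernel_eq ln_div algebra_simps)

lemma scaled_log_measurable: "(\<lambda>y. scaled_log x y) \<in> borel_measurable lborel"
  unfolding scaled_log_def by measurable

lemma scaled_log_integrable:
  assumes x: "x \<in> S"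
  shows "integrable lborel (\<lambda>y. scaled_log x y * f y)"
proof -
  note [measurable] = scaled_log_measurable f_bounds(5)
  have i: "integrable lborel (\<lambda>y. - 2 * pi * (log_kernel x y * f y) - ln \<epsilon> * f y)"
    using L.K_integrand_integrable[OF x f_supported] f_integrable by simp
  show ?thesis
  proof (rule integrable_cong_AE[THEN iffD1, OF _ _ _ i])
    show "AE y in lborel. - 2 * pi * (log_kernel x y * f y) - ln \<epsilon> * f y = scaled_log x y * f y"
      using AE_lborel_singleton[of x] by eventually_elim (simp add: scaled_log_eq)
  qed (use i in \<open>auto intro: borel_measurable_integrable\<close>)
qed

lemma scaled_log_integral:
  assumes x: "x \<in> S"
  shows "(LINT y|lborel. scaled_log x y * f y) = - 2 * pi * potential log_kernel f x - m * ln \<epsilon>"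
proof -
  note [measurable] = scaled_log_measurable f_bounds(5)
  have i: "integrable lborel (\<lambda>y. log_kernel x y * f y)"
    using L.K_integrand_integrable[OF x f_supported] .
  have "(LINT y|lborel. scaled_log x y * f y) = (LINT y|lborel. - 2 * pi * (log_kernel x y * f y) - ln \<epsilon> * f y)"
  proof (rule integral_cong_AE)
    show "AE y in lborel. scaled_log x y * f y = - 2 * pi * (log_kernel x y * f y) - ln \<epsilon> * f y"
      using AE_lborel_singleton[of x] by eventually_elim (simp add: scaled_log_eq)
    show "(\<lambda>y. - 2 * pi * (log_kernel x y * f y) - ln \<epsilon> * f y) \<in> borel_measurable lborel"
      using i f_integrable by (intro borel_measurable_integrable Bochner_Integration.integrable_diff integrable_mult_right)
  qed measurable
  also have "\<dots> = - 2 * pi * potential log_kernel f x - m * ln \<epsilon>"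
    using i f_integrable by (simp add: potential_def f_bounds(4))
  finally show ?thesis .
qed

text \<open>The negative part lives in \<open>ball x \<epsilon>\<close>, where
  \<open>- ln t \<le> 1 / t\<close> and the density is at most \<open>lam\<close>. The majorant
  integrates to at most \<open>4 * \<pi> * \<epsilon>\<^sup>2 * lam\<close>, that is
  \<open>4 * m\<close>.\<close>

lemma scaled_log_neg_bound:
  "- (\<epsilon> * lam * (indicator (ball x \<epsilon>) y * (1 / norm (x - y)))) \<le> min 0 (scaled_log x y) * f y"
proof (cases "y \<in> ball x \<epsilon> \<and> y \<noteq> x")
  case True
  define t where "t = norm (x - y) / \<epsilon>"
  have t: "t > 0" using True \<epsilon>(1) by (auto simp: t_def intro!: divide_pos_pos)
  have "- ln t \<le> 1 / t" using ln_le_minus_one[of "1 / t"] t by (simp add: ln_div)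
  then have "- (1 / t) \<le> min 0 (ln t)" using t by simp
  then have "- (1 / t) * lam \<le> min 0 (ln t) * lam" using lam by (intro mult_right_mono) auto
  also have "\<dots> \<le> min 0 (ln t) * f y" using f_bounds(2) by (intro mult_left_mono_neg) auto
  finally show ?thesis using True by (simp add: t_def scaled_log_def mult_ac)
next
  case False
  \<comment> \<open>At \<open>y = x\<close> this rests on the default value
    \<open>ln 0 = 0\<close>.\<close>
  then have "scaled_log x y \<ge> 0" using \<epsilon> by (cases "y = x") (auto simp: scaled_log_def dist_norm)
  then show ?thesis using \<epsilon> lam by simp
qed

text \<open>The positive part measures how much mass lies far from \<open>x\<close>. Since the
  negative part is bounded by \<open>4 * m\<close>, a bound for the full integral controls
  it.\<close>

lemma scaled_log_parts:
  assumes x: "x \<in> S"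
  shows min_part_integrable: "integrable lborel (\<lambda>y. min 0 (scaled_log x y) * f y)"
    and max_part_integrable: "integrable lborel (\<lambda>y. max 0 (scaled_log x y) * f y)"
    and max_part_bound: "(LINT y|lborel. max 0 (scaled_log x y) * f y) \<le> (LINT y|lborel. scaled_log x y * f y) + 4 * m"
proof -
  note [measurable] = scaled_log_measurable f_bounds(5)
  let ?n = "\<lambda>y. min 0 (scaled_log x y) * f y" and ?p = "\<lambda>y. max 0 (scaled_log x y) * f y"
  let ?I = "\<lambda>y. \<epsilon> * lam * (indicator (ball x \<epsilon>) y * (1 / norm (x - y)))"
  have iI: "integrable lborel ?I" using \<epsilon> by (intro integrable_mult_right inverse_norm_ball) auto
  have n0: "?n y \<le> 0" for y using f_bounds(1) by (simp add: mult_nonpos_nonneg)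
  show n: "integrable lborel ?n"
  proof (rule Bochner_Integration.integrable_bound[OF iI])
    have "norm (?n y) \<le> norm (?I y)" for y
    proof -
      have "0 \<le> ?I y" using \<epsilon> lam by simp
      then show ?thesis using n0[of y] scaled_log_neg_bound[of x y] unfolding real_norm_def by linarith
    qed
    then show "AE y in lborel. norm (?n y) \<le> norm (?I y)" by simp
  qed measurable
  have eq: "?p y = scaled_log x y * f y - ?n y" for y
    by (simp add: left_diff_distrib[symmetric] max_def min_def)
  show p: "integrable lborel ?p" unfolding eq using n scaled_log_integrable[OF x] by simp
  have "(LINT y|lborel. - ?I y) \<le> (LINT y|lborel. ?n y)"
    using iI n scaled_log_neg_bound by (intro integral_mono) auto
  moreover have "(LINT y|lborel. ?I y) \<le> \<epsilon> * lam * (4 * pi * \<epsilon>)"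
    unfolding integral_mult_right_zero using \<epsilon> lam by (intro mult_left_mono inverse_norm_ball) auto
  moreover have "\<epsilon> * lam * (4 * pi * \<epsilon>) = 4 * m" using \<epsilon>(2) by (simp add: power2_eq_square mult_ac)
  moreover have "(LINT y|lborel. - ?I y) = - (LINT y|lborel. ?I y)" by simp
  moreover have "(LINT y|lborel. ?p y) = (LINT y|lborel. scaled_log x y * f y) - (LINT y|lborel. ?n y)"
    unfolding eq using n scaled_log_integrable[OF x] by simp
  ultimately show "(LINT y|lborel. ?p y) \<le> (LINT y|lborel. scaled_log x y * f y) + 4 * m"
    by linarith
qed

lemma log_potential_upper:
  assumes x: "x \<in> S"
  shows "2 * pi * potential log_kernel f x \<le> m * ln (1 / \<epsilon>) + 4 * m"
proof -
  have "0 \<le> (LINT y|lborel. max 0 (scaled_log x y) * f y)"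
    using f_bounds(1) by (intro Bochner_Integration.integral_nonneg) auto
  then show ?thesis
    using max_part_bound[OF x] scaled_log_integral[OF x] \<epsilon> by (simp add: ln_div)
qed

text \<open>No profile beats the full disc by more than a bounded amount; the matching lower bound
  is \<open>disc_log_interaction_lower\<close>.\<close>

lemma log_interaction_upper:
  "2 * pi * interaction log_kernel f f \<le> m\<^sup>2 * ln (1 / \<epsilon>) + 4 * m\<^sup>2"
proof -
  have "2 * pi * interaction log_kernel f f = (LINT x|lborel. f x * (2 * pi * potential log_kernel f x))"
    unfolding interaction_def by (simp add: mult.left_commute flip: integral_mult_right_zero)
  also have "\<dots> \<le> (LINT x|lborel. f x * (m * ln (1 / \<epsilon>) + 4 * m))"
  proof (rule integral_mono)
    have "integrable lborel (\<lambda>x. 2 * pi * (f x * potential log_kernel f x))"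
      using L.interaction_integrable[OF f_supported f_supported] by simp
    then show "integrable lborel (\<lambda>x. f x * (2 * pi * potential log_kernel f x))" by (simp add: mult_ac)
    show "integrable lborel (\<lambda>x. f x * (m * ln (1 / \<epsilon>) + 4 * m))" using f_integrable by simp
    show "f x * (2 * pi * potential log_kernel f x) \<le> f x * (m * ln (1 / \<epsilon>) + 4 * m)" for x
    proof (cases "x \<in> ball p \<delta>")
      case True
      then show ?thesis using log_potential_upper[of x] f_bounds(1)[of x] S(3) by (intro mult_left_mono) auto
    qed (simp add: f_bounds(3))
  qed
  also have "\<dots> = m * (m * ln (1 / \<epsilon>) + 4 * m)"
    unfolding integral_mult_left_zero f_bounds(4) ..
  also have "\<dots> = m\<^sup>2 * ln (1 / \<epsilon>) + 4 * m\<^sup>2" by (simp add: power2_eq_square algebra_simps)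
  finally show ?thesis .
qed

text \<open>Some point carries a large potential, hence so does the disc of radius \<open>4\<epsilon>\<close> around it. Its area
  exceeds \<open>m / lam\<close>, which bounds the level \<open>\<mu>\<close> from below; this forces every point above the
  level to see more than half of the mass within distance \<open>O(\<epsilon>)\<close>.\<close>

lemma exists_point_with_large_potential:
  assumes E: "m\<^sup>2 * ln (1 / \<epsilon>) - C \<le> 2 * pi * interaction log_kernel f f"
  obtains x where "x \<in> ball p \<delta>" "(LINT y|lborel. scaled_log x y * f y) \<le> C / m + 1"
proof -
  have "\<exists>x. x \<in> ball p \<delta> \<and> (LINT y|lborel. scaled_log x y * f y) \<le> C / m + 1"
  proof (rule ccontr)
    \<comment> \<open>Integrating the failed inequality against \<open>f\<close> would leave the
      energy below the assumed lower bound by at least \<open>m\<close>; this slack comes from the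
      \<open>+ 1\<close>.\<close>
    assume neg: "\<not> ?thesis"
    let ?c = "- (C / m + 1) + m * ln (1 / \<epsilon>)"
    have "(LINT x|lborel. f x * (2 * pi * potential log_kernel f x)) \<le> (LINT x|lborel. f x * ?c)"
    proof (rule integral_mono)
      have "integrable lborel (\<lambda>x. 2 * pi * (f x * potential log_kernel f x))"
        using L.interaction_integrable[OF f_supported f_supported] by simp
      then show "integrable lborel (\<lambda>x. f x * (2 * pi * potential log_kernel f x))" by (simp add: mult_ac)
      show "integrable lborel (\<lambda>x. f x * ?c)" using f_integrable by simp
      fix x
      show "f x * (2 * pi * potential log_kernel f x) \<le> f x * ?c"
      proof (cases "x \<in> ball p \<delta>")
        case True
        then have "(LINT y|lborel. scaled_log x y * f y) > C / m + 1" using neg by auto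
        then have "2 * pi * potential log_kernel f x \<le> ?c"
          using scaled_log_integral[of x] True S(3) \<epsilon> by (auto simp: ln_div)
        then show ?thesis using f_bounds(1) by (rule mult_left_mono)
      qed (simp add: f_bounds(3))
    qed
    moreover have "(LINT x|lborel. f x * (2 * pi * potential log_kernel f x)) = 2 * pi * interaction log_kernel f f"
      unfolding interaction_def by (simp add: mult.left_commute flip: integral_mult_right_zero)
    moreover have "(LINT x|lborel. f x * ?c) = m * ?c" using f_bounds(4) by simp
    moreover have "m * ?c = - C - m + m\<^sup>2 * ln (1 / \<epsilon>)" using m by (simp add: field_simps power2_eq_square)
    ultimately show False using E m by linarith
  qed
  then show thesis using that by blast
qed

text \<open>A scaled distance \<open>t\<close> from \<open>x\<close> becomes at most
  \<open>t + 4 \<le> 5 * max 1 t\<close> from \<open>y\<close>, so the logarithm exceeds its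
  positive part at \<open>x\<close> by at most \<open>ln 5 \<le> 2\<close>. Integration costs
  \<open>2 * m\<close>, and the positive part itself another \<open>4 * m\<close>.\<close>

lemma potential_near_good_point:
  assumes x: "x \<in> S" "(LINT y|lborel. scaled_log x y * f y) \<le> c" and y: "y \<in> S" "dist x y \<le> 4 * \<epsilon>"
  shows "2 * pi * potential log_kernel f y \<ge> m * ln (1 / \<epsilon>) - (6 * m + c)"
proof -
  have pw: "scaled_log y z * f z \<le> 2 * f z + max 0 (scaled_log x z) * f z" if "z \<noteq> x" "z \<noteq> y" for z
  proof -
    define t where "t = norm (x - z) / \<epsilon>"
    have t: "t > 0" using that \<epsilon> by (simp add: t_def)
    have "norm (y - z) \<le> norm (x - z) + 4 * \<epsilon>"
      using y dist_triangle[of y z x] by (simp add: dist_norm norm_minus_commute)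
    then have "norm (y - z) / \<epsilon> \<le> (norm (x - z) + 4 * \<epsilon>) / \<epsilon>" using \<epsilon> by (intro divide_right_mono) auto
    also have "\<dots> = t + 4" using \<epsilon> by (simp add: t_def add_divide_distrib)
    also have "\<dots> \<le> 5 * max 1 t" by (simp add: max_def)
    finally have "ln (norm (y - z) / \<epsilon>) \<le> ln (5 * max 1 t)" using that \<epsilon> by (intro ln_mono) auto
    also have "\<dots> = ln 5 + ln (max 1 t)" by (simp add: ln_mult)
    also have "ln (max 1 t) = max 0 (ln t)" using t by (auto simp: max_def)
    finally have "scaled_log y z \<le> 2 + max 0 (scaled_log x z)" using ln_5_le by (simp add: scaled_log_def t_def)
    then have "scaled_log y z * f z \<le> (2 + max 0 (scaled_log x z)) * f z" using f_bounds(1) by (rule mult_right_mono)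
    then show ?thesis by (simp add: distrib_right)
  qed
  have "(LINT z|lborel. scaled_log y z * f z) \<le> (LINT z|lborel. 2 * f z + max 0 (scaled_log x z) * f z)"
  proof (rule integral_mono_AE)
    show "AE z in lborel. scaled_log y z * f z \<le> 2 * f z + max 0 (scaled_log x z) * f z"
      using AE_lborel_singleton[of x] AE_lborel_singleton[of y] by eventually_elim (rule pw)
  qed (use scaled_log_integrable y max_part_integrable x f_integrable in auto)
  also have "\<dots> = 2 * m + (LINT z|lborel. max 0 (scaled_log x z) * f z)"
    using max_part_integrable[OF x(1)] f_integrable f_bounds(4) by simp
  also have "\<dots> \<le> 2 * m + (c + 4 * m)" using max_part_bound[OF x(1)] x(2) by simp
  finally show ?thesis using scaled_log_integral[OF y(1)] \<epsilon> by (simp add: ln_div)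
qed

text \<open>Chebyshev's inequality for the positive part of the scaled logarithm, which is at least
  \<open>ln R\<close> outside the disc. The \<open>+ 1\<close> in the exponent makes the result
  strictly less than half.\<close>

lemma mass_outside:
  assumes x: "x \<in> S" "(LINT y|lborel. scaled_log x y * f y) \<le> c" and c: "c \<ge> 0"
    and R: "R = exp (2 * (c + 4 * m) / m + 1)"
  shows "(LINT y|lborel. indicator (- ball x (R * \<epsilon>)) y * f y) < m / 2"
proof -
  let ?l = "2 * (c + 4 * m) / m + 1"
  note [measurable] = f_bounds(5)
  have l: "?l > 0" using c m by (simp add: add_nonneg_pos)
  have Rpos: "R > 0" by (simp add: R)
  have i: "integrable lborel (\<lambda>y. indicator (- ball x (R * \<epsilon>)) y * f y)"
  proof (rule Bochner_Integration.integrable_bound[OF f_integrable])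
    have "- ball x (R * \<epsilon>) \<in> sets borel" by simp
    note [measurable] = this
    show "(\<lambda>y. indicator (- ball x (R * \<epsilon>)) y * f y) \<in> borel_measurable lborel" by measurable
    show "AE y in lborel. norm (indicator (- ball x (R * \<epsilon>)) y * f y) \<le> norm (f y)"
      by (intro AE_I2) (simp split: split_indicator)
  qed
  have "?l * (LINT y|lborel. indicator (- ball x (R * \<epsilon>)) y * f y) = (LINT y|lborel. ?l * (indicator (- ball x (R * \<epsilon>)) y * f y))"
    by simp
  also have "\<dots> \<le> (LINT y|lborel. max 0 (scaled_log x y) * f y)"
  proof (rule integral_mono)
    show "integrable lborel (\<lambda>y. ?l * (indicator (- ball x (R * \<epsilon>)) y * f y))" using i by simp
    fix y
    show "?l * (indicator (- ball x (R * \<epsilon>)) y * f y) \<le> max 0 (scaled_log x y) * f y"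
    proof (cases "y \<in> ball x (R * \<epsilon>)")
      case False
      then have "R \<le> norm (x - y) / \<epsilon>" using \<epsilon> by (simp add: dist_norm field_simps)
      then have "ln R \<le> scaled_log x y" unfolding scaled_log_def using Rpos by (intro ln_mono) auto
      then have "?l \<le> max 0 (scaled_log x y)" by (simp add: R)
      then have "?l * f y \<le> max 0 (scaled_log x y) * f y" using f_bounds(1) by (rule mult_right_mono)
      then show ?thesis using False by simp
    qed (use f_bounds(1) in simp)
  qed (use max_part_integrable x in auto)
  also have "\<dots> \<le> c + 4 * m" using max_part_bound[OF x(1)] x(2) by simp
  also have "\<dots> < ?l * (m / 2)" using m c by (simp add: field_simps)
  finally show ?thesis using l by (simp only: mult_less_cancel_left_pos)
qed

text \<open>The point \<open>x\<close> may lie next to the circle. Moving it by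
  \<open>2 * \<epsilon>\<close> towards the centre, or to the centre if that is close, makes room
  for a disc of area larger than \<open>m / lam\<close>.\<close>

lemma ball_in_intersection:
  assumes x: "x \<in> ball p \<delta>"
  obtains x' where "ball x' (2 * \<epsilon>) \<subseteq> ball p \<delta>" "ball x' (2 * \<epsilon>) \<subseteq> ball x (4 * \<epsilon>)"
proof (cases "dist p x \<le> 2 * \<epsilon>")
  case True
  show thesis
  proof (rule that[of p])
    show "ball p (2 * \<epsilon>) \<subseteq> ball p \<delta>" using \<epsilon>(3) by (rule subset_ball)
    show "ball p (2 * \<epsilon>) \<subseteq> ball x (4 * \<epsilon>)"
    proof
      fix y assume "y \<in> ball p (2 * \<epsilon>)"
      then show "y \<in> ball x (4 * \<epsilon>)" using dist_triangle[of x y p] True by (simp add: dist_commute)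
    qed
  qed
next
  case False
  define v where "v = (2 * \<epsilon> / dist p x) *\<^sub>R (p - x)"
  define x' where "x' = x + v"
  have px: "dist p x > 0" using False \<epsilon>(1) by linarith
  have nv: "norm v = 2 * \<epsilon>" using px \<epsilon>(1) by (simp add: v_def dist_norm)
  have "x' - p = (1 - 2 * \<epsilon> / dist p x) *\<^sub>R (x - p)"
    by (simp add: x'_def v_def algebra_simps)
  then have "norm (x' - p) = \<bar>1 - 2 * \<epsilon> / dist p x\<bar> * norm (x - p)" by simp
  then have "dist p x' = \<bar>1 - 2 * \<epsilon> / dist p x\<bar> * dist p x"
    by (simp only: dist_norm norm_minus_commute)
  also have "\<dots> = (1 - 2 * \<epsilon> / dist p x) * dist p x" using False px by (subst abs_of_nonneg) simp_all
  also have "\<dots> = dist p x - 2 * \<epsilon>" using px by (simp add: left_diff_distrib)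
  finally have px': "dist p x' = dist p x - 2 * \<epsilon>" .
  show thesis
  proof (rule that[of x'])
    show "ball x' (2 * \<epsilon>) \<subseteq> ball p \<delta>"
    proof
      fix y assume "y \<in> ball x' (2 * \<epsilon>)"
      then show "y \<in> ball p \<delta>" using dist_triangle[of p y x'] px' x by simp
    qed
    show "ball x' (2 * \<epsilon>) \<subseteq> ball x (4 * \<epsilon>)"
    proof
      fix y assume "y \<in> ball x' (2 * \<epsilon>)"
      moreover have "dist x x' = 2 * \<epsilon>" using nv by (simp add: x'_def dist_norm)
      ultimately show "y \<in> ball x (4 * \<epsilon>)" using dist_triangle[of x y x'] by simp
    qed
  qed
qed

text \<open>Here \<open>w\<close> is the bounded part of the stream function. Two points at or above
  the level each see more than half of the mass within \<open>R * \<epsilon>\<close>, so the two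
  discs meet. Hence all such points, and with them almost all of the support, lie within
  \<open>2 * (R * \<epsilon>)\<close> of any one of them.\<close>

lemma vortex_concentration:
  assumes w: "\<And>x. x \<in> ball p \<delta> \<Longrightarrow> \<bar>w x\<bar> \<le> C"
    and E: "m\<^sup>2 * ln (1 / \<epsilon>) - C \<le> 2 * pi * interaction log_kernel f f"
    and level: "measure lborel {x \<in> ball p \<delta>. potential log_kernel f x + w x > \<mu>} \<le> m / lam"
    and meas: "{x \<in> ball p \<delta>. potential log_kernel f x + w x > \<mu>} \<in> sets borel"
    and below: "AE x in lborel. x \<in> ball p \<delta> \<longrightarrow> potential log_kernel f x + w x < \<mu> \<longrightarrow> f x = 0"
  shows "\<exists>x1\<in>ball p \<delta>. AE x in lborel. x \<notin> cball x1 (concentration_radius m C * \<epsilon>) \<longrightarrow> f x = 0"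
proof -
  let ?C = "concentration_constant m C"
  define R where "R = exp (2 * (?C + 4 * m) / m + 1)"
  have C0: "?C \<ge> 0" using m C by (simp add: concentration_constant_def)
  obtain x0 where x0: "x0 \<in> ball p \<delta>" "(LINT y|lborel. scaled_log x0 y * f y) \<le> C / m + 1"
    using exists_point_with_large_potential[OF E] by metis
  obtain x' where x': "ball x' (2 * \<epsilon>) \<subseteq> ball p \<delta>" "ball x' (2 * \<epsilon>) \<subseteq> ball x0 (4 * \<epsilon>)"
    using ball_in_intersection[OF x0(1)] by metis
  \<comment> \<open>Otherwise a disc of area \<open>4 * (pi * \<epsilon>\<^sup>2)\<close> would lie
    above the level, where only area \<open>m / lam = pi * \<epsilon>\<^sup>2\<close> is
    available.\<close>
  have "\<exists>y\<in>ball x' (2 * \<epsilon>). potential log_kernel f y + w y \<le> \<mu>"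
  proof (rule ccontr)
    assume "\<not> ?thesis"
    then have sub: "ball x' (2 * \<epsilon>) \<subseteq> {x \<in> ball p \<delta>. potential log_kernel f x + w x > \<mu>}" using x' by force
    have fm: "{x \<in> ball p \<delta>. potential log_kernel f x + w x > \<mu>} \<in> fmeasurable lborel"
    proof -
      have "emeasure lborel {x \<in> ball p \<delta>. potential log_kernel f x + w x > \<mu>} < \<infinity>"
        by (rule emeasure_bounded_finite) (auto intro: bounded_subset[of "ball p \<delta>"])
      then show ?thesis using meas by (simp add: fmeasurable_def)
    qed
    have "measure lborel (ball x' (2 * \<epsilon>)) \<le> m / lam"
      by (rule order_trans[OF measure_mono_fmeasurable[OF sub _ fm] level]) simp
    moreover have "measure lborel (ball x' (2 * \<epsilon>)) = 4 * (pi * \<epsilon>\<^sup>2)"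
      using content_ball[of "2 * \<epsilon>" x'] \<epsilon> by (simp add: unit_ball_vol_2 power_mult_distrib)
    moreover have "m / lam = pi * \<epsilon>\<^sup>2" using \<epsilon>(2) lam by (simp add: field_simps)
    ultimately show False using \<epsilon>(1) by simp
  qed
  then obtain y where y: "y \<in> ball x' (2 * \<epsilon>)" "potential log_kernel f y + w y \<le> \<mu>" by blast
  have yS: "y \<in> ball p \<delta>" "dist x0 y \<le> 4 * \<epsilon>" using y x' by auto
  have "m * ln (1 / \<epsilon>) - (6 * m + (C / m + 1)) \<le> 2 * pi * potential log_kernel f y"
    using potential_near_good_point[OF _ x0(2) _ yS(2)] x0(1) yS(1) S(3) by blast
  moreover have "2 * pi * (- C) \<le> 2 * pi * w y" using w[OF yS(1)] by (intro mult_left_mono) auto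
  moreover have "2 * pi * (potential log_kernel f y + w y) \<le> 2 * pi * \<mu>" using y(2) by (intro mult_left_mono) auto
  ultimately have \<mu>: "m * ln (1 / \<epsilon>) - (6 * m + (C / m + 1)) - 2 * pi * C \<le> 2 * pi * \<mu>"
    unfolding distrib_left by linarith
  have half: "(LINT y|lborel. indicator (- ball x (R * \<epsilon>)) y * f y) < m / 2"
    if x: "x \<in> ball p \<delta>" "potential log_kernel f x + w x \<ge> \<mu>" for x
  proof -
    have "2 * pi * \<mu> \<le> 2 * pi * (potential log_kernel f x + w x)" using x(2) by (intro mult_left_mono) auto
    moreover have "2 * pi * w x \<le> 2 * pi * C" using w[OF x(1)] by (intro mult_left_mono) auto
    ultimately have "m * ln (1 / \<epsilon>) - ?C \<le> 2 * pi * potential log_kernel f x"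
      using \<mu> unfolding distrib_left concentration_constant_def by linarith
    then have "(LINT y|lborel. scaled_log x y * f y) \<le> ?C"
      using scaled_log_integral[of x] x(1) S(3) \<epsilon> by (auto simp: ln_div)
    then show ?thesis using x(1) S(3) C0 R_def by (intro mass_outside) auto
  qed
  have close: "dist x y \<le> 2 * (R * \<epsilon>)"
    if x: "x \<in> ball p \<delta>" "potential log_kernel f x + w x \<ge> \<mu>" and y: "y \<in> ball p \<delta>" "potential log_kernel f y + w y \<ge> \<mu>" for x y
  proof (rule ccontr)
    assume far: "\<not> dist x y \<le> 2 * (R * \<epsilon>)"
    let ?i = "\<lambda>x z. indicator (- ball x (R * \<epsilon>)) z * f z"
    have int: "integrable lborel (?i x)" for x
    proof (rule Bochner_Integration.integrable_bound[OF f_integrable])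
      have "- ball x (R * \<epsilon>) \<in> sets borel" by simp
      note [measurable] = this f_bounds(5)
      show "?i x \<in> borel_measurable lborel" by measurable
      show "AE z in lborel. norm (?i x z) \<le> norm (f z)" by (intro AE_I2) (simp split: split_indicator)
    qed
    have "m = (LINT z|lborel. f z)" using f_bounds(4) by simp
    also have "\<dots> \<le> (LINT z|lborel. ?i x z + ?i y z)"
    proof (rule integral_mono)
      fix z
      have "z \<notin> ball x (R * \<epsilon>) \<or> z \<notin> ball y (R * \<epsilon>)" using far dist_triangle[of x y z] by (auto simp: dist_commute)
      then show "f z \<le> ?i x z + ?i y z" using f_bounds(1)[of z] by (auto split: split_indicator)
    qed (use f_integrable int in auto)
    also have "\<dots> = (LINT z|lborel. ?i x z) + (LINT z|lborel. ?i y z)" using int by simp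
    also have "\<dots> < m" using half[OF x] half[OF y] by simp
    finally show False by simp
  qed
  have "\<exists>x1\<in>ball p \<delta>. potential log_kernel f x1 + w x1 \<ge> \<mu>"
  proof (rule ccontr)
    assume neg: "\<not> ?thesis"
    have "AE x in lborel. f x = 0"
      using below by eventually_elim (use neg f_bounds(3) in force)
    then have "(LINT x|lborel. f x) = 0" by (rule integral_eq_zero_AE)
    then show False using f_bounds(4) m by simp
  qed
  then obtain x1 where x1: "x1 \<in> ball p \<delta>" "potential log_kernel f x1 + w x1 \<ge> \<mu>" by blast
  have rad: "concentration_radius m C * \<epsilon> = 2 * (R * \<epsilon>)" by (simp add: concentration_radius_def R_def)
  have "AE x in lborel. x \<notin> cball x1 (concentration_radius m C * \<epsilon>) \<longrightarrow> f x = 0"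
    using below
  proof eventually_elim
    case (elim x)
    show ?case
    proof
      assume x: "x \<notin> cball x1 (concentration_radius m C * \<epsilon>)"
      show "f x = 0"
      proof (cases "x \<in> ball p \<delta>")
        case True
        have "\<not> potential log_kernel f x + w x \<ge> \<mu>" using close[OF x1 True] x rad by auto
        then show ?thesis using elim True by simp
      qed (rule f_bounds(3))
    qed
  qed
  then show ?thesis using x1(1) by blast
qed

end

section \<open>Location of the vortices\<close>

lemma profile_nonneg: "profile m lam B f \<Longrightarrow> 0 \<le> f x"
  and profile_integral: "profile m lam B f \<Longrightarrow> (LINT x|lborel. f x) = m"
  and profile_zero: "profile m lam B f \<Longrightarrow> x \<notin> B \<Longrightarrow> f x = 0"
  by (auto simp: profile_def)

section \<open>Bounds for interactions, comparison discs and translation invariance\<close>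

context weakly_singular_kernel
begin

lemma potential_bounds:
  assumes x: "x \<in> S" and u: "bounded_supported S u" "\<And>y. 0 \<le> u y" "AE y in lborel. u y \<noteq> 0 \<longrightarrow> y \<in> A"
    and K: "\<And>y. y \<in> A \<Longrightarrow> y \<in> S \<Longrightarrow> x \<noteq> y \<Longrightarrow> lo \<le> K x y \<and> K x y \<le> hi"
  shows "lo * (LINT y|lborel. u y) \<le> potential K u x" "potential K u x \<le> hi * (LINT y|lborel. u y)"
proof -
  have i: "integrable lborel u" by (rule bounded_supported_integrable[OF u(1) bounded_S])
  have AE: "AE y in lborel. lo * u y \<le> K x y * u y \<and> K x y * u y \<le> hi * u y"
    using u(3) AE_lborel_singleton[of x]
  proof eventually_elim
    case (elim y)
    show ?case
    proof (cases "u y = 0")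
      case False
      then have "y \<in> S" using u(1) by (auto simp: bounded_supported_def)
      then show ?thesis using K[of y] elim False u(2)[of y] by (auto intro!: mult_right_mono)
    qed simp
  qed
  have "(LINT y|lborel. lo * u y) \<le> (LINT y|lborel. K x y * u y)"
    using AE by (intro integral_mono_AE K_integrand_integrable x u(1) integrable_mult_right i) auto
  then show "lo * (LINT y|lborel. u y) \<le> potential K u x" by (simp add: potential_def)
  have "(LINT y|lborel. K x y * u y) \<le> (LINT y|lborel. hi * u y)"
    using AE by (intro integral_mono_AE K_integrand_integrable x u(1) integrable_mult_right i) auto
  then show "potential K u x \<le> hi * (LINT y|lborel. u y)" by (simp add: potential_def)
qed

lemma interaction_bounds:
  assumes f: "bounded_supported S f" "\<And>y. 0 \<le> f y" "AE y in lborel. f y \<noteq> 0 \<longrightarrow> y \<in> A'"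
    and u: "bounded_supported S u" "\<And>y. 0 \<le> u y" "AE y in lborel. u y \<noteq> 0 \<longrightarrow> y \<in> A"
    and K: "\<And>x y. x \<in> A' \<Longrightarrow> x \<in> S \<Longrightarrow> y \<in> A \<Longrightarrow> y \<in> S \<Longrightarrow> x \<noteq> y \<Longrightarrow> lo \<le> K x y \<and> K x y \<le> hi"
  shows "lo * ((LINT y|lborel. f y) * (LINT y|lborel. u y)) \<le> interaction K f u"
    "interaction K f u \<le> hi * ((LINT y|lborel. f y) * (LINT y|lborel. u y))"
proof -
  let ?U = "LINT y|lborel. u y"
  have i: "integrable lborel f" by (rule bounded_supported_integrable[OF f(1) bounded_S])
  have AE: "AE x in lborel. f x * (lo * ?U) \<le> f x * potential K u x \<and> f x * potential K u x \<le> f x * (hi * ?U)"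
    using f(3)
  proof eventually_elim
    case (elim x)
    show ?case
    proof (cases "f x = 0")
      case False
      then have x: "x \<in> S" "x \<in> A'" using f(1) elim by (auto simp: bounded_supported_def)
      have "lo * ?U \<le> potential K u x" "potential K u x \<le> hi * ?U"
        using potential_bounds[OF x(1) u, of lo hi] K[OF x(2,1)] by auto
      then show ?thesis using f(2)[of x] by (auto intro!: mult_left_mono)
    qed simp
  qed
  have "(LINT x|lborel. f x * (lo * ?U)) \<le> interaction K f u"
    unfolding interaction_def using AE by (intro integral_mono_AE interaction_integrable f(1) u(1) integrable_mult_left i) auto
  then show "lo * ((LINT y|lborel. f y) * ?U) \<le> interaction K f u"
    unfolding integral_mult_left_zero by (simp only: mult_ac)
  have "interaction K f u \<le> (LINT x|lborel. f x * (hi * ?U))"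
    unfolding interaction_def using AE by (intro integral_mono_AE interaction_integrable f(1) u(1) integrable_mult_left i) auto
  then show "interaction K f u \<le> hi * ((LINT y|lborel. f y) * ?U)"
    unfolding integral_mult_left_zero by (simp only: mult_ac)
qed

end

lemma disc_profile:
  assumes "\<epsilon> \<ge> 0" "pi * \<epsilon>\<^sup>2 * lam = m" "\<epsilon> \<le> \<delta>" "lam \<ge> 0"
  shows "profile m lam (ball p \<delta>) (\<lambda>x. lam * indicator (ball p \<epsilon>) x)"
proof -
  have fin: "emeasure lborel (ball p \<epsilon>) < \<infinity>" using emeasure_bounded_finite[of "ball p \<epsilon>"] by simp
  have "measure lborel (ball p \<epsilon>) = pi * \<epsilon>\<^sup>2"
    using content_ball[of \<epsilon> p] assms(1) by (simp add: unit_ball_vol_2)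
  then have "(LINT x|lborel. lam * indicator (ball p \<epsilon>) x) = m"
    using assms(2) by (simp add: mult.commute)
  moreover have "(\<lambda>x. lam * indicator (ball p \<epsilon>) x) \<in> borel_measurable borel"
    by (intro borel_measurable_times borel_measurable_indicator) auto
  ultimately show ?thesis
    using assms by (auto simp: profile_def split: split_indicator)
qed

lemma potential_log_kernel_translate:
  assumes [measurable]: "f \<in> borel_measurable borel"
  shows "potential log_kernel (\<lambda>y. f (v + y)) x = potential log_kernel f (v + x)"
proof -
  have m: "(\<lambda>y. log_kernel (v + x) y * f y) \<in> borel_measurable borel"
    unfolding log_kernel_eq by measurable
  have "log_kernel (v + x) (v + y) = log_kernel x y" for y
    using log_kernel_translate[of x v y] by (simp add: add.commute)
  then show ?thesis
    using integral_lborel_translate[OF m, of v] by (simp add: potential_def)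
qed

lemma interaction_log_kernel_translate:
  assumes [measurable]: "f \<in> borel_measurable borel"
  shows "interaction log_kernel (\<lambda>y. f (v + y)) (\<lambda>y. f (v + y)) = interaction log_kernel f f"
proof -
  have "(\<lambda>(x, y). log_kernel x y * f y) \<in> borel_measurable (borel \<Otimes>\<^sub>M lborel)"
    unfolding log_kernel_eq case_prod_unfold by measurable
  then have "potential log_kernel f \<in> borel_measurable borel"
    unfolding potential_def by (rule lborel.borel_measurable_lebesgue_integral)
  then have "(\<lambda>x. f x * potential log_kernel f x) \<in> borel_measurable borel" by measurable
  from integral_lborel_translate[OF this, of v] show ?thesis
    by (simp add: interaction_def potential_log_kernel_translate)
qed

lemma potential_cong_AE:
  assumes "AE y in lborel. f y = f' y" "f \<in> borel_measurable borel" "f' \<in> borel_measurable borel"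
    and "(\<lambda>y. K x y) \<in> borel_measurable borel"
  shows "potential K f x = potential K f' x"
  unfolding potential_def
proof (rule integral_cong_AE)
  show "AE y in lborel. K x y * f y = K x y * f' y" using assms(1) by eventually_elim simp
qed (use assms in auto)

section \<open>Comparison of energies and concentration of both vortices\<close>

context vortex_domain
begin

text \<open>The Kirchhoff-Routh function in terms of the positive masses
  \<open>m1 = \<kappa>1\<close> and \<open>m2 = - \<kappa>2\<close>, which turns the sign of the
  mixed term.\<close>

definition H :: "real \<Rightarrow> real \<Rightarrow> real^2 \<Rightarrow> real^2 \<Rightarrow> real" where
  "H m1 m2 x1 x2 = m1\<^sup>2 * h x1 x1 + m2\<^sup>2 * h x2 x2 + 2 * m1 * m2 * g x1 x2"

lemma continuous_g: "continuous_on (cball p1 \<delta> \<times> cball p2 \<delta>) (\<lambda>(x, y). g x y)"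
proof -
  have "continuous_on (cball p1 \<delta> \<times> cball p2 \<delta>) (\<lambda>q. log_kernel (fst q) (snd q) - (\<lambda>(x, y). h x y) q)"
    using balls_in_D disjoint_balls
    by (intro continuous_intros continuous_on_log_kernel' continuous_on_subset[OF continuous_on_h_joint]) auto
  then show ?thesis by (simp add: g_def case_prod_unfold)
qed

lemma g_bounded: obtains M where "M > 0" "\<And>x y. x \<in> cball p1 \<delta> \<Longrightarrow> y \<in> cball p2 \<delta> \<Longrightarrow> \<bar>g x y\<bar> \<le> M"
proof -
  have "compact ((\<lambda>(x, y). g x y) ` (cball p1 \<delta> \<times> cball p2 \<delta>))"
    by (intro compact_continuous_image compact_Times compact_cball continuous_g)
  then have "bounded ((\<lambda>(x, y). g x y) ` (cball p1 \<delta> \<times> cball p2 \<delta>))" by (rule compact_imp_bounded)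
  then obtain M where M: "M > 0" "\<forall>v\<in>(\<lambda>(x, y). g x y) ` (cball p1 \<delta> \<times> cball p2 \<delta>). norm v \<le> M" by (auto simp: bounded_pos)
  have "\<bar>g x y\<bar> \<le> M" if "x \<in> cball p1 \<delta>" "y \<in> cball p2 \<delta>" for x y
  proof -
    have "g x y \<in> (\<lambda>(x, y). g x y) ` (cball p1 \<delta> \<times> cball p2 \<delta>)" using that by (intro image_eqI[of _ _ "(x, y)"]) auto
    then show ?thesis using M(2) by auto
  qed
  then show thesis using M(1) that by blast
qed

text \<open>Only the self-interactions are split into logarithm and regular part. The mutual one
  keeps \<open>g\<close>, which is bounded because the closed discs are disjoint.\<close>

lemma pair_energy_expand:
  assumes a: "bounded_supported S a" and b: "bounded_supported S b"
  shows "pair_energy a b = interaction log_kernel a a + interaction log_kernel b b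
    - (interaction h a a + interaction h b b + 2 * interaction g a b)"
proof -
  have "pair_energy a b = interaction g a a - 2 * interaction g b a + interaction g b b"
    using interaction_g_lincomb[OF a b, of "-1"] by (simp add: pair_energy_def)
  then show ?thesis
    using interaction_g[OF a a] interaction_g[OF b b] interaction_g_commute[OF a b] by simp
qed

lemma interaction_h_bounds:
  assumes f: "bounded_supported S f" "\<And>y. 0 \<le> f y" "AE y in lborel. f y \<noteq> 0 \<longrightarrow> y \<in> A"
    and h: "\<And>x y. x \<in> A \<Longrightarrow> x \<in> S \<Longrightarrow> y \<in> A \<Longrightarrow> y \<in> S \<Longrightarrow> lo \<le> h x y \<and> h x y \<le> hi"
  shows "lo * (LINT y|lborel. f y)\<^sup>2 \<le> interaction h f f" "interaction h f f \<le> hi * (LINT y|lborel. f y)\<^sup>2"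
proof -
  obtain C where "weakly_singular_kernel S h C diam" using weakly_singular_h .
  then interpret weakly_singular_kernel S h C diam .
  show "lo * (LINT y|lborel. f y)\<^sup>2 \<le> interaction h f f" "interaction h f f \<le> hi * (LINT y|lborel. f y)\<^sup>2"
    using interaction_bounds[OF f f, of lo hi] h by (auto simp: power2_eq_square)
qed

lemma interaction_g_bounds:
  assumes f: "bounded_supported S f" "\<And>y. 0 \<le> f y" "AE y in lborel. f y \<noteq> 0 \<longrightarrow> y \<in> A'"
    and u: "bounded_supported S u" "\<And>y. 0 \<le> u y" "AE y in lborel. u y \<noteq> 0 \<longrightarrow> y \<in> A"
    and K: "\<And>x y. x \<in> A' \<Longrightarrow> x \<in> S \<Longrightarrow> y \<in> A \<Longrightarrow> y \<in> S \<Longrightarrow> lo \<le> g x y \<and> g x y \<le> hi"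
  shows "lo * ((LINT y|lborel. f y) * (LINT y|lborel. u y)) \<le> interaction g f u"
    "interaction g f u \<le> hi * ((LINT y|lborel. f y) * (LINT y|lborel. u y))"
proof -
  obtain C where "weakly_singular_kernel S g C diam" using weakly_singular_g .
  then interpret weakly_singular_kernel S g C diam .
  show "lo * ((LINT y|lborel. f y) * (LINT y|lborel. u y)) \<le> interaction g f u"
    "interaction g f u \<le> hi * ((LINT y|lborel. f y) * (LINT y|lborel. u y))"
    using interaction_bounds[OF f u, of lo hi] K by auto
qed

text \<open>Points of the disc are at most \<open>2 * \<epsilon>\<close> apart, so the kernel is
  bounded below on it; the loss \<open>m\<^sup>2 * ln 2\<close> is absorbed by
  \<open>m\<^sup>2\<close>.\<close>

lemma disc_log_interaction_lower:
  assumes sub: "ball p \<delta> \<subseteq> S" and \<epsilon>: "\<epsilon> > 0" "pi * \<epsilon>\<^sup>2 * lam = m" "\<epsilon> \<le> \<delta>" "lam > 0"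
  defines "f \<equiv> \<lambda>x. lam * indicator (ball p \<epsilon>) x"
  shows "m\<^sup>2 * ln (1 / \<epsilon>) - m\<^sup>2 \<le> 2 * pi * interaction log_kernel f f"
proof -
  interpret weakly_singular_kernel S log_kernel "diam\<^sup>2 + 1" diam by (rule weakly_singular_log)
  have prof: "profile m lam (ball p \<delta>) f" unfolding f_def using \<epsilon> by (intro disc_profile) auto
  have sf: "bounded_supported S f" using profile_bounded_supported[OF prof] sub by (rule bounded_supported_mono)
  let ?lo = "ln (1 / (2 * \<epsilon>)) / (2 * pi)"
  have lo: "?lo \<le> log_kernel x y" if "x \<in> ball p \<epsilon>" "y \<in> ball p \<epsilon>" "x \<noteq> y" for x y
  proof -
    have "norm (x - y) \<le> 2 * \<epsilon>" using that dist_triangle[of x y p] by (simp add: dist_norm norm_minus_commute)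
    then have "ln (1 / (2 * \<epsilon>)) \<le> ln (1 / norm (x - y))" using that \<epsilon> by (intro ln_mono divide_left_mono) auto
    then show ?thesis unfolding log_kernel_def by (simp add: divide_right_mono)
  qed
  have "?lo * (m * m) \<le> interaction log_kernel f f"
  proof -
    have "(LINT x|lborel. f x * (?lo * m)) \<le> (LINT x|lborel. f x * potential log_kernel f x)"
    proof (rule integral_mono)
      show "integrable lborel (\<lambda>x. f x * (?lo * m))" using profile_integrable[OF prof] by simp
      show "integrable lborel (\<lambda>x. f x * potential log_kernel f x)" by (rule interaction_integrable[OF sf sf])
      fix x
      show "f x * (?lo * m) \<le> f x * potential log_kernel f x"
      proof (cases "x \<in> ball p \<epsilon>")
        case True
        then have xS: "x \<in> S" using sub \<epsilon> by auto
        have "(LINT y|lborel. ?lo * f y) \<le> (LINT y|lborel. log_kernel x y * f y)"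
        proof (rule integral_mono_AE)
          show "integrable lborel (\<lambda>y. ?lo * f y)" using profile_integrable[OF prof] by simp
          show "integrable lborel (\<lambda>y. log_kernel x y * f y)" by (rule K_integrand_integrable[OF xS sf])
          show "AE y in lborel. ?lo * f y \<le> log_kernel x y * f y"
            using AE_lborel_singleton[of x]
          proof eventually_elim
            case (elim y)
            show ?case
            proof (cases "y \<in> ball p \<epsilon>")
              case y: True
              then show ?thesis using lo[OF True y] elim profile_nonneg[OF prof] by (intro mult_right_mono) auto
            qed (simp add: f_def)
          qed
        qed
        then have "?lo * m \<le> potential log_kernel f x"
          unfolding potential_def integral_mult_right_zero profile_integral[OF prof] .
        then show ?thesis using profile_nonneg[OF prof] by (intro mult_left_mono) auto
      qed (simp add: f_def)
    qed
    then show ?thesis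
      unfolding interaction_def integral_mult_left_zero profile_integral[OF prof] by (simp only: mult_ac)
  qed
  then have "2 * pi * (?lo * (m * m)) \<le> 2 * pi * interaction log_kernel f f" by (intro mult_left_mono) auto
  moreover have "2 * pi * (?lo * (m * m)) = m\<^sup>2 * ln (1 / \<epsilon>) - m\<^sup>2 * ln 2"
  proof -
    have "2 * pi * (v / (2 * pi) * (m * m)) = m\<^sup>2 * v" for v by (simp add: power2_eq_square)
    moreover have "ln (1 / (2 * \<epsilon>)) = ln (1 / \<epsilon>) - ln 2" using \<epsilon> by (simp add: ln_div ln_mult)
    ultimately show ?thesis by (simp only: right_diff_distrib)
  qed
  moreover have "m\<^sup>2 * ln 2 \<le> m\<^sup>2 * 1" using ln_2_less_1 by (intro mult_left_mono) auto
  ultimately show ?thesis by linarith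
qed

definition core_radius :: "real \<Rightarrow> real \<Rightarrow> real" where
  "core_radius m lam = sqrt (m / (pi * lam))"

lemma core_radius:
  assumes "m > 0" "lam > 0" shows "core_radius m lam > 0" "pi * (core_radius m lam)\<^sup>2 * lam = m"
  using assms by (auto simp: core_radius_def)

lemma core_radius_eventually_small:
  assumes "m > 0" "e > 0" shows "\<forall>\<^sub>F lam in at_top. core_radius m lam < e"
proof -
  have "((\<lambda>lam. sqrt (m / (pi * lam))) \<longlongrightarrow> sqrt 0) at_top"
    by (intro tendsto_real_sqrt tendsto_divide_0[OF tendsto_const] filterlim_at_top_imp_at_infinity
        filterlim_tendsto_pos_mult_at_top[OF tendsto_const] filterlim_ident) simp
  then show ?thesis unfolding core_radius_def using assms(2) by (intro order_tendstoD(2)[of _ "sqrt 0"]) auto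
qed

text \<open>The competitor consists of two full discs. As the regular terms are bounded, maximality
  bounds the sum of the two self-energies from below; subtracting the upper bound for one vortex
  gives a lower bound for the other. The constant \<open>R\<close> does not depend on
  \<open>lam\<close>.\<close>

lemma maximizer_concentrates:
  assumes m: "m1 > 0" "m2 > 0"
  obtains R where "R > 0"
    "\<And>lam a b. lam > 0 \<Longrightarrow> 2 * core_radius m1 lam < \<delta> \<Longrightarrow> 2 * core_radius m2 lam < \<delta> \<Longrightarrow> pair_maximizer m1 m2 lam a b \<Longrightarrow>
      \<exists>x1\<in>ball p1 \<delta>. \<exists>x2\<in>ball p2 \<delta>.
        (AE x in lborel. x \<notin> cball x1 (R * core_radius m1 lam) \<longrightarrow> a x = 0) \<and>
        (AE x in lborel. x \<notin> cball x2 (R * core_radius m2 lam) \<longrightarrow> b x = 0)"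
proof -
  obtain M where M: "M > 0" "\<And>x y. x \<in> cS \<Longrightarrow> y \<in> cS \<Longrightarrow> \<bar>h x y\<bar> \<le> M" using h_bounded by metis
  obtain M' where M': "M' > 0" "\<And>x y. x \<in> cball p1 \<delta> \<Longrightarrow> y \<in> cball p2 \<delta> \<Longrightarrow> \<bar>g x y\<bar> \<le> M'" using g_bounded by metis
  \<comment> \<open>The factor 5 is 1 from the disc bound plus 4 from the upper bound of the other
    vortex. The bracket collects the regular terms of both pairs of profiles, hence each bound is
    doubled. The last summand dominates \<open>w1\<close> and \<open>w2\<close>.\<close>
  define C where "C = 5 * m1\<^sup>2 + 5 * m2\<^sup>2 + 2 * pi * (2 * M * m1\<^sup>2 + 2 * M * m2\<^sup>2 + 4 * M' * (m1 * m2)) + (M + M') * (m1 + m2)"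
  have Cparts: "0 \<le> 2 * pi * (2 * M * m1\<^sup>2 + 2 * M * m2\<^sup>2 + 4 * M' * (m1 * m2))" "0 \<le> (M + M') * (m1 + m2)" "0 \<le> m1\<^sup>2" "0 \<le> m2\<^sup>2"
    using m M(1) M'(1) by auto
  then have C0: "C \<ge> 0" unfolding C_def by linarith
  define R where "R = max (concentration_radius m1 C) (concentration_radius m2 C)"
  have Rpos: "R > 0" by (simp add: R_def concentration_radius_def less_max_iff_disj)
  have hM: "- M \<le> h x y \<and> h x y \<le> M" if "x \<in> S" "y \<in> S" for x y
  proof -
    have "\<bar>h x y\<bar> \<le> M" using that S_subset(1) by (intro M(2)) auto
    then show ?thesis by linarith
  qed
  have gM: "- M' \<le> g x y \<and> g x y \<le> M'" if "x \<in> ball p1 \<delta>" "y \<in> ball p2 \<delta>" for x y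
  proof -
    have "\<bar>g x y\<bar> \<le> M'" using that by (intro M'(2)) auto
    then show ?thesis by linarith
  qed
  have main: "\<exists>x1\<in>ball p1 \<delta>. \<exists>x2\<in>ball p2 \<delta>.
        (AE x in lborel. x \<notin> cball x1 (R * core_radius m1 lam) \<longrightarrow> a x = 0) \<and>
        (AE x in lborel. x \<notin> cball x2 (R * core_radius m2 lam) \<longrightarrow> b x = 0)"
    if lam: "lam > 0" and small: "2 * core_radius m1 lam < \<delta>" "2 * core_radius m2 lam < \<delta>"
      and max: "pair_maximizer m1 m2 lam a b" for lam a b
  proof -
    let ?e1 = "core_radius m1 lam" and ?e2 = "core_radius m2 lam"
    note e1 = core_radius[OF m(1) lam] and e2 = core_radius[OF m(2) lam]
    have pa: "profile m1 lam (ball p1 \<delta>) a" and pb: "profile m2 lam (ball p2 \<delta>) b"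
      using max by (auto simp: pair_maximizer_def admissible_def)
    note sa = profile_supported_S(1)[OF pa] and sb = profile_supported_S(2)[OF pb]
    define d1 where "d1 = (\<lambda>x. lam * indicator (ball p1 ?e1) x :: real)"
    define d2 where "d2 = (\<lambda>x. lam * indicator (ball p2 ?e2) x :: real)"
    have pd1: "profile m1 lam (ball p1 \<delta>) d1" unfolding d1_def using e1 small lam by (intro disc_profile) auto
    have pd2: "profile m2 lam (ball p2 \<delta>) d2" unfolding d2_def using e2 small lam by (intro disc_profile) auto
    note sd1 = profile_supported_S(1)[OF pd1] and sd2 = profile_supported_S(2)[OF pd2]
    have le: "pair_energy d1 d2 \<le> pair_energy a b"
      using max pd1 pd2 by (simp add: pair_maximizer_def admissible_def)
    have hb: "- M * m\<^sup>2 \<le> interaction h f f \<and> interaction h f f \<le> M * m\<^sup>2"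
      if "bounded_supported S f" "profile m lam B f" for f m B
      using interaction_h_bounds[of f UNIV "-M" M, OF that(1) profile_nonneg[OF that(2)]] hM profile_integral[OF that(2)] by auto
    have gb: "- M' * (m1 * m2) \<le> interaction g f u \<and> interaction g f u \<le> M' * (m1 * m2)"
      if f: "profile m1 lam (ball p1 \<delta>) f" and u: "profile m2 lam (ball p2 \<delta>) u" for f u
    proof -
      have "AE y in lborel. f y \<noteq> 0 \<longrightarrow> y \<in> ball p1 \<delta>" "AE y in lborel. u y \<noteq> 0 \<longrightarrow> y \<in> ball p2 \<delta>"
        using profile_zero[OF f] profile_zero[OF u] by (auto intro!: AE_I2 simp del: mem_ball)
      then show ?thesis
        using interaction_g_bounds[of f "ball p1 \<delta>" u "ball p2 \<delta>" "-M'" M', OF profile_supported_S(1)[OF f] profile_nonneg[OF f] _ profile_supported_S(2)[OF u] profile_nonneg[OF u]]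
          gM profile_integral[OF f] profile_integral[OF u] by auto
    qed
    have log_lower: "interaction log_kernel d1 d1 + interaction log_kernel d2 d2 \<le>
        interaction log_kernel a a + interaction log_kernel b b + (2 * M * m1\<^sup>2 + 2 * M * m2\<^sup>2 + 4 * M' * (m1 * m2))"
      using le hb[OF sa pa] hb[OF sb pb] hb[OF sd1 pd1] hb[OF sd2 pd2] gb[OF pa pb] gb[OF pd1 pd2]
      unfolding pair_energy_expand[OF sa sb] pair_energy_expand[OF sd1 sd2] by linarith
    then have "2 * pi * (interaction log_kernel d1 d1 + interaction log_kernel d2 d2) \<le>
        2 * pi * (interaction log_kernel a a + interaction log_kernel b b + (2 * M * m1\<^sup>2 + 2 * M * m2\<^sup>2 + 4 * M' * (m1 * m2)))"
      by (intro mult_left_mono) auto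
    moreover have "m1\<^sup>2 * ln (1 / ?e1) - m1\<^sup>2 \<le> 2 * pi * interaction log_kernel d1 d1"
      unfolding d1_def using e1 small lam by (intro disc_log_interaction_lower ball_subset_S) auto
    moreover have "m2\<^sup>2 * ln (1 / ?e2) - m2\<^sup>2 \<le> 2 * pi * interaction log_kernel d2 d2"
      unfolding d2_def using e2 small lam by (intro disc_log_interaction_lower ball_subset_S) auto
    moreover have "2 * pi * interaction log_kernel a a \<le> m1\<^sup>2 * ln (1 / ?e1) + 4 * m1\<^sup>2"
      using log_interaction_upper[OF S_sets dist_S ball_subset_S(1) pa m(1) lam e1 _ C0] small by simp
    moreover have "2 * pi * interaction log_kernel b b \<le> m2\<^sup>2 * ln (1 / ?e2) + 4 * m2\<^sup>2"
      using log_interaction_upper[OF S_sets dist_S ball_subset_S(2) pb m(2) lam e2 _ C0] small by simp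
    ultimately have Ea: "m1\<^sup>2 * ln (1 / ?e1) - C \<le> 2 * pi * interaction log_kernel a a"
      and Eb: "m2\<^sup>2 * ln (1 / ?e2) - C \<le> 2 * pi * interaction log_kernel b b"
      using Cparts unfolding C_def distrib_left by linarith+
    have ar: "m < lam * (pi * \<delta>\<^sup>2)" if "pi * e\<^sup>2 * lam = m" "2 * e < \<delta>" "e > 0" for e m
    proof -
      have "e\<^sup>2 < \<delta>\<^sup>2" using that by (intro power_strict_mono) auto
      then have "lam * (pi * e\<^sup>2) < lam * (pi * \<delta>\<^sup>2)" using lam by simp
      moreover have "lam * (pi * e\<^sup>2) = m" using that(1) by (simp only: mult_ac)
      ultimately show ?thesis by simp
    qed
    obtain \<mu>1 \<mu>2 where lev:
      "measure lborel {x \<in> ball p1 \<delta>. potential g (\<lambda>x. a x - b x) x > \<mu>1} \<le> m1 / lam"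
      "AE x in lborel. x \<in> ball p1 \<delta> \<longrightarrow> potential g (\<lambda>x. a x - b x) x > \<mu>1 \<longrightarrow> a x = lam"
      "AE x in lborel. x \<in> ball p1 \<delta> \<longrightarrow> potential g (\<lambda>x. a x - b x) x < \<mu>1 \<longrightarrow> a x = 0"
      "measure lborel {x \<in> ball p2 \<delta>. potential g (\<lambda>x. b x - a x) x > \<mu>2} \<le> m2 / lam"
      "AE x in lborel. x \<in> ball p2 \<delta> \<longrightarrow> potential g (\<lambda>x. b x - a x) x > \<mu>2 \<longrightarrow> b x = lam"
      "AE x in lborel. x \<in> ball p2 \<delta> \<longrightarrow> potential g (\<lambda>x. b x - a x) x < \<mu>2 \<longrightarrow> b x = 0"
      by (rule maximizer_levels[OF max lam m(1) ar[OF e1(2) small(1) e1(1)] m(2) ar[OF e2(2) small(2) e2(1)]])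
    obtain Cg where "weakly_singular_kernel S g Cg diam" using weakly_singular_g .
    then interpret G: weakly_singular_kernel S g Cg diam .
    obtain Ch where "weakly_singular_kernel S h Ch diam" using weakly_singular_h .
    then interpret H: weakly_singular_kernel S h Ch diam .
    \<comment> \<open>What remains of the stream function after removing the vortex's own
      logarithmic potential: its regular part and the field of the other vortex.\<close>
    define w1 where "w1 x = - potential h a x - potential g b x" for x
    define w2 where "w2 x = - potential h b x - potential g a x" for x
    have split1: "potential g (\<lambda>x. a x - b x) x = potential log_kernel a x + w1 x" if "x \<in> S" for x
      using G.potential_lincomb[OF that sa sb, of 1 "-1"] potential_g[OF that sa] by (simp add: w1_def)
    have split2: "potential g (\<lambda>x. b x - a x) x = potential log_kernel b x + w2 x" if "x \<in> S" for x
      using G.potential_lincomb[OF that sb sa, of 1 "-1"] potential_g[OF that sb] by (simp add: w2_def)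
    have w1: "\<bar>w1 x\<bar> \<le> C" if x: "x \<in> ball p1 \<delta>" for x
    proof -
      have xS: "x \<in> S" using x ball_subset_S by blast
      have "- M * m1 \<le> potential h a x \<and> potential h a x \<le> M * m1"
        using H.potential_bounds[OF xS sa profile_nonneg[OF pa], of UNIV "-M" M] hM[of x] xS profile_integral[OF pa] by auto
      moreover have "AE y in lborel. b y \<noteq> 0 \<longrightarrow> y \<in> ball p2 \<delta>" using profile_zero[OF pb] by (auto intro!: AE_I2 simp del: mem_ball)
      then have "- M' * m2 \<le> potential g b x \<and> potential g b x \<le> M' * m2"
        using G.potential_bounds[OF xS sb profile_nonneg[OF pb], of "ball p2 \<delta>" "-M'" M'] gM[OF x] profile_integral[OF pb] by auto
      ultimately have "\<bar>w1 x\<bar> \<le> M * m1 + M' * m2" unfolding w1_def abs_le_iff by linarith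
      also have "\<dots> \<le> (M + M') * (m1 + m2)" using m M(1) M'(1) by (simp add: algebra_simps)
      also have "\<dots> \<le> C" using Cparts unfolding C_def by linarith
      finally show ?thesis .
    qed
    have w2: "\<bar>w2 x\<bar> \<le> C" if x: "x \<in> ball p2 \<delta>" for x
    proof -
      have xS: "x \<in> S" using x ball_subset_S by blast
      have gx: "- M' \<le> g x y \<and> g x y \<le> M'" if "y \<in> ball p1 \<delta>" for y
        using gM[OF that x] g_commute[OF xS, of y] that ball_subset_S(1) by auto
      have "- M * m2 \<le> potential h b x \<and> potential h b x \<le> M * m2"
        using H.potential_bounds[OF xS sb profile_nonneg[OF pb], of UNIV "-M" M] hM[of x] xS profile_integral[OF pb] by auto
      moreover have "AE y in lborel. a y \<noteq> 0 \<longrightarrow> y \<in> ball p1 \<delta>" using profile_zero[OF pa] by (auto intro!: AE_I2 simp del: mem_ball)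
      then have "- M' * m1 \<le> potential g a x \<and> potential g a x \<le> M' * m1"
        using G.potential_bounds[OF xS sa profile_nonneg[OF pa], of "ball p1 \<delta>" "-M'" M'] gx profile_integral[OF pa] by auto
      ultimately have "\<bar>w2 x\<bar> \<le> M * m2 + M' * m1" unfolding w2_def abs_le_iff by linarith
      also have "\<dots> \<le> (M + M') * (m1 + m2)" using m M(1) M'(1) by (simp add: algebra_simps)
      also have "\<dots> \<le> C" using Cparts unfolding C_def by linarith
      finally show ?thesis .
    qed
    have cong1: "{x \<in> ball p1 \<delta>. potential g (\<lambda>x. a x - b x) x > \<mu>1} = {x \<in> ball p1 \<delta>. potential log_kernel a x + w1 x > \<mu>1}"
      using split1 ball_subset_S by auto
    have cong2: "{x \<in> ball p2 \<delta>. potential g (\<lambda>x. b x - a x) x > \<mu>2} = {x \<in> ball p2 \<delta>. potential log_kernel b x + w2 x > \<mu>2}"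
      using split2 ball_subset_S by auto
    have meas: "{x \<in> ball p \<delta>. potential g f x > \<mu>} \<in> sets borel" if "bounded_supported S f" "ball p \<delta> \<subseteq> S" for f p \<mu>
    proof -
      have "open (ball p \<delta> \<inter> potential g f -` {\<mu><..})"
        by (intro continuous_open_preimage continuous_on_subset[OF g_potential_continuous[OF that(1)] that(2)]) auto
      also have "ball p \<delta> \<inter> potential g f -` {\<mu><..} = {x \<in> ball p \<delta>. potential g f x > \<mu>}" by auto
      finally show ?thesis by (rule borel_open)
    qed
    have R1: "concentration_radius m1 C * ?e1 \<le> R * ?e1" "concentration_radius m2 C * ?e2 \<le> R * ?e2"
      unfolding R_def using e1 e2 by (auto intro!: mult_right_mono)
    have "\<exists>x1\<in>ball p1 \<delta>. AE x in lborel. x \<notin> cball x1 (concentration_radius m1 C * ?e1) \<longrightarrow> a x = 0"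
    proof (rule vortex_concentration[OF S_sets dist_S ball_subset_S(1) pa m(1) lam e1 _ C0 w1 Ea])
      show "2 * ?e1 \<le> \<delta>" using small by simp
      show "measure lborel {x \<in> ball p1 \<delta>. potential log_kernel a x + w1 x > \<mu>1} \<le> m1 / lam" using lev(1) unfolding cong1 .
      show "{x \<in> ball p1 \<delta>. potential log_kernel a x + w1 x > \<mu>1} \<in> sets borel"
        unfolding cong1[symmetric] by (rule meas[OF bounded_supported_diff[OF sa sb] ball_subset_S(1)])
      show "AE x in lborel. x \<in> ball p1 \<delta> \<longrightarrow> potential log_kernel a x + w1 x < \<mu>1 \<longrightarrow> a x = 0"
        using lev(3) by eventually_elim (use split1 ball_subset_S in auto)
    qed
    then obtain x1 where x1: "x1 \<in> ball p1 \<delta>" "AE x in lborel. x \<notin> cball x1 (concentration_radius m1 C * ?e1) \<longrightarrow> a x = 0" by blast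
    have "\<exists>x2\<in>ball p2 \<delta>. AE x in lborel. x \<notin> cball x2 (concentration_radius m2 C * ?e2) \<longrightarrow> b x = 0"
    proof (rule vortex_concentration[OF S_sets dist_S ball_subset_S(2) pb m(2) lam e2 _ C0 w2 Eb])
      show "2 * ?e2 \<le> \<delta>" using small by simp
      show "measure lborel {x \<in> ball p2 \<delta>. potential log_kernel b x + w2 x > \<mu>2} \<le> m2 / lam" using lev(4) unfolding cong2 .
      show "{x \<in> ball p2 \<delta>. potential log_kernel b x + w2 x > \<mu>2} \<in> sets borel"
        unfolding cong2[symmetric] by (rule meas[OF bounded_supported_diff[OF sb sa] ball_subset_S(2)])
      show "AE x in lborel. x \<in> ball p2 \<delta> \<longrightarrow> potential log_kernel b x + w2 x < \<mu>2 \<longrightarrow> b x = 0"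
        using lev(6) by eventually_elim (use split2 ball_subset_S in auto)
    qed
    then obtain x2 where x2: "x2 \<in> ball p2 \<delta>" "AE x in lborel. x \<notin> cball x2 (concentration_radius m2 C * ?e2) \<longrightarrow> b x = 0" by blast
    have "AE x in lborel. x \<notin> cball x1 (R * ?e1) \<longrightarrow> a x = 0"
      using x1(2) by eventually_elim (use R1(1) in auto)
    moreover have "AE x in lborel. x \<notin> cball x2 (R * ?e2) \<longrightarrow> b x = 0"
      using x2(2) by eventually_elim (use R1(2) in auto)
    ultimately show ?thesis using x1(1) x2(1) by blast
  qed
  show thesis using Rpos main by (rule that)
qed

end

section \<open>Recentring and localization near the minimum of the Kirchhoff-Routh function\<close>

lemma interaction_log_kernel_cong_AE:
  assumes AE: "AE x in lborel. f x = f' x" and [measurable]: "f \<in> borel_measurable borel" "f' \<in> borel_measurable borel"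
  shows "interaction log_kernel f f = interaction log_kernel f' f'"
proof -
  have pot: "potential log_kernel f x = potential log_kernel f' x" for x
    by (rule potential_cong_AE[OF AE assms(2,3)]) (unfold log_kernel_eq, measurable)
  have "(\<lambda>(x, y). log_kernel x y * f' y) \<in> borel_measurable (borel \<Otimes>\<^sub>M lborel)"
    unfolding log_kernel_eq case_prod_unfold by measurable
  then have [measurable]: "potential log_kernel f' \<in> borel_measurable borel"
    unfolding potential_def by (rule lborel.borel_measurable_lebesgue_integral)
  show ?thesis
    unfolding interaction_def pot
  proof (rule integral_cong_AE)
    show "AE x in lborel. f x * potential log_kernel f' x = f' x * potential log_kernel f' x"
      using AE by eventually_elim simp
  qed measurable
qed

text \<open>The profile is cut off to \<open>cball x1 s\<close> before it is translated. This
  changes it only on a null set, but makes the translate vanish at every point outside the new disc,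
  as \<open>profile\<close> demands.\<close>

lemma recentred_profile:
  assumes f: "profile m lam B f" and B: "bounded B" and supp: "AE x in lborel. x \<notin> cball x1 s \<longrightarrow> f x = 0"
    and s: "s < \<delta>"
  obtains f' where "profile m lam (ball p \<delta>) f'" "\<And>x. f' x \<noteq> 0 \<Longrightarrow> x \<in> cball p s"
    "interaction log_kernel f' f' = interaction log_kernel f f"
proof -
  define f0 where "f0 x = indicator (cball x1 s) x * f x" for x
  define f' where "f' x = f0 ((x1 - p) + x)" for x
  have f_meas[measurable]: "f \<in> borel_measurable borel" using f by (simp add: profile_def)
  have "cball x1 s \<in> sets borel" by simp
  note [measurable] = this
  have f0_meas[measurable]: "f0 \<in> borel_measurable borel" unfolding f0_def by measurable
  have AE: "AE x in lborel. f0 x = f x"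
    using supp by eventually_elim (auto simp: f0_def split: split_indicator)
  have near: "x \<in> cball p s" if "f' x \<noteq> 0" for x
  proof -
    have "(x1 - p) + x \<in> cball x1 s" using that by (auto simp: f'_def f0_def split: split_indicator_asm)
    moreover have "dist x1 ((x1 - p) + x) = dist p x" by (simp add: dist_norm algebra_simps)
    ultimately show ?thesis by simp
  qed
  have "(LINT x|lborel. f' x) = (LINT x|lborel. f0 x)"
    unfolding f'_def by (rule integral_lborel_translate[OF f0_meas])
  also have "\<dots> = (LINT x|lborel. f x)" by (rule integral_cong_AE) (use AE in auto)
  finally have int: "(LINT x|lborel. f' x) = m" using f by (simp add: profile_def)
  have "profile m lam (ball p \<delta>) f'"
    unfolding profile_def
  proof (intro conjI allI impI int)
    show "f' \<in> borel_measurable borel" unfolding f'_def by measurable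
    have b: "0 \<le> f x \<and> f x \<le> lam" for x using f by (simp add: profile_def)
    show "0 \<le> f' x" "f' x \<le> lam" for x
      using b[of "x1 - p + x"] b[of 0] by (auto simp: f'_def f0_def split: split_indicator)
    show "f' x = 0" if "x \<notin> ball p \<delta>" for x using near[of x] that s by auto
  qed
  moreover have "interaction log_kernel f' f' = interaction log_kernel f f"
    unfolding f'_def interaction_log_kernel_translate[OF f0_meas]
    by (rule interaction_log_kernel_cong_AE[OF AE f0_meas f_meas])
  ultimately show thesis using near that by blast
qed

context vortex_domain
begin

lemma continuous_H: "continuous_on (cball p1 \<delta> \<times> cball p2 \<delta>) (\<lambda>(x1, x2). H m1 m2 x1 x2)"
proof -
  have "continuous_on (cball p1 \<delta> \<times> cball p2 \<delta>) (\<lambda>q. m1\<^sup>2 * (\<lambda>(x, y). h x y) (fst q, fst q) + m2\<^sup>2 * (\<lambda>(x, y). h x y) (snd q, snd q) + 2 * m1 * m2 * (\<lambda>(x, y). g x y) q)"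
    using balls_in_D
    by (intro continuous_intros continuous_on_compose2[OF continuous_on_h_joint] continuous_g) auto
  then show ?thesis by (simp add: H_def case_prod_unfold)
qed

text \<open>Pairs at distance at least \<open>r\<close> from the minimum in one component form a
  compact set; the gap \<open>\<gamma>\<close> is the excess of the least value there.\<close>

lemma near_minimum:
  assumes r: "r > 0"
    and min: "\<forall>x1\<in>cball p1 \<delta>. \<forall>x2\<in>cball p2 \<delta>. (x1, x2) \<noteq> (p1, p2) \<longrightarrow> H m1 m2 p1 p2 < H m1 m2 x1 x2"
  obtains \<gamma> where "\<gamma> > 0" "\<And>x1 x2. x1 \<in> cball p1 \<delta> \<Longrightarrow> x2 \<in> cball p2 \<delta> \<Longrightarrow>
    H m1 m2 x1 x2 < H m1 m2 p1 p2 + \<gamma> \<Longrightarrow> dist p1 x1 < r \<and> dist p2 x2 < r"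
proof -
  let ?F = "\<lambda>(x1, x2). H m1 m2 x1 x2"
  define Z where "Z = (cball p1 \<delta> \<times> cball p2 \<delta>) \<inter> {q. r \<le> dist p1 (fst q) \<or> r \<le> dist p2 (snd q)}"
  have "closed {q. r \<le> dist p1 (fst q) \<or> r \<le> dist p2 (snd q)}"
    by (intro closed_Collect_disj closed_Collect_le continuous_intros)
  then have Z: "compact Z" unfolding Z_def by (intro compact_Int_closed compact_Times compact_cball)
  show thesis
  proof (cases "Z = {}")
    case True
    show thesis
    proof (rule that[of 1])
      fix x1 x2 assume "x1 \<in> cball p1 \<delta>" "x2 \<in> cball p2 \<delta>"
      moreover have "(x1, x2) \<notin> Z" using True by simp
      ultimately show "dist p1 x1 < r \<and> dist p2 x2 < r" by (auto simp: Z_def)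
    qed simp
  next
    case False
    have "continuous_on Z ?F" using continuous_H by (rule continuous_on_subset) (auto simp: Z_def)
    then obtain q where q: "q \<in> Z" "\<And>q'. q' \<in> Z \<Longrightarrow> ?F q \<le> ?F q'"
      using continuous_attains_inf[OF Z False] by metis
    have "H m1 m2 p1 p2 < H m1 m2 (fst q) (snd q)"
      using q(1) r by (intro min[rule_format]) (auto simp: Z_def)
    then have pos: "?F q - H m1 m2 p1 p2 > 0" by (simp add: case_prod_unfold)
    show thesis
    proof (rule that[OF pos])
      fix x1 x2 assume x: "x1 \<in> cball p1 \<delta>" "x2 \<in> cball p2 \<delta>" and lt: "H m1 m2 x1 x2 < H m1 m2 p1 p2 + (?F q - H m1 m2 p1 p2)"
      have "(x1, x2) \<notin> Z" using q(2)[of "(x1, x2)"] lt by auto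
      then show "dist p1 x1 < r \<and> dist p2 x2 < r" using x by (auto simp: Z_def)
    qed
  qed
qed

lemma uniform_oscillation:
  fixes F :: "real^2 \<Rightarrow> real^2 \<Rightarrow> real"
  assumes "compact A" "compact B" "continuous_on (A \<times> B) (\<lambda>(x, y). F x y)" "\<eta> > 0"
  obtains s0 where "s0 > 0" "\<And>x y x' y'. x \<in> A \<Longrightarrow> y \<in> B \<Longrightarrow> x' \<in> A \<Longrightarrow> y' \<in> B \<Longrightarrow>
    dist x x' < s0 \<Longrightarrow> dist y y' < s0 \<Longrightarrow> F x' y' - \<eta> \<le> F x y \<and> F x y \<le> F x' y' + \<eta>"
proof -
  have "uniformly_continuous_on (A \<times> B) (\<lambda>(x, y). F x y)"
    using assms by (intro compact_uniformly_continuous compact_Times)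
  then obtain d where d: "d > 0" "\<And>q q'. q \<in> A \<times> B \<Longrightarrow> q' \<in> A \<times> B \<Longrightarrow> dist q' q < d \<Longrightarrow>
      dist ((\<lambda>(x, y). F x y) q') ((\<lambda>(x, y). F x y) q) < \<eta>"
    using assms(4) unfolding uniformly_continuous_on_def by metis
  show thesis
  proof (rule that[of "d / 2"])
    fix x y x' y' assume xy: "x \<in> A" "y \<in> B" "x' \<in> A" "y' \<in> B" "dist x x' < d / 2" "dist y y' < d / 2"
    have "dist (x, y) (x', y') \<le> dist x x' + dist y y'"
      unfolding dist_Pair_Pair by (rule sqrt_sum_squares_le_sum) auto
    then have "dist (F x y) (F x' y') < \<eta>" using d(2)[of "(x', y')" "(x, y)"] xy by auto
    then show "F x' y' - \<eta> \<le> F x y \<and> F x y \<le> F x' y' + \<eta>" by (auto simp: dist_real_def abs_le_iff)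
  qed (use d in simp)
qed

text \<open>Translating the two vortices to \<open>p1\<close> and \<open>p2\<close> leaves the singular part of the energy
  unchanged, so maximality compares only the regular parts, which are close to \<open>H\<close>.\<close>

lemma maximizer_localized:
  assumes m: "m1 > 0" "m2 > 0"
    and min: "\<forall>x1\<in>cball p1 \<delta>. \<forall>x2\<in>cball p2 \<delta>. (x1, x2) \<noteq> (p1, p2) \<longrightarrow> H m1 m2 p1 p2 < H m1 m2 x1 x2"
  shows "\<forall>\<^sub>F lam in at_top. \<forall>a b. pair_maximizer m1 m2 lam a b \<longrightarrow>
    (AE x in lborel. x \<notin> cball p1 (\<delta> / 2) \<longrightarrow> a x = 0) \<and> (AE x in lborel. x \<notin> cball p2 (\<delta> / 2) \<longrightarrow> b x = 0)"
proof -
  have "\<delta> / 4 > 0" using \<delta> by simp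
  then obtain \<gamma> where \<gamma>: "\<gamma> > 0" "\<And>x1 x2. x1 \<in> cball p1 \<delta> \<Longrightarrow> x2 \<in> cball p2 \<delta> \<Longrightarrow>
      H m1 m2 x1 x2 < H m1 m2 p1 p2 + \<gamma> \<Longrightarrow> dist p1 x1 < \<delta> / 4 \<and> dist p2 x2 < \<delta> / 4"
    using near_minimum[OF _ min, of "\<delta> / 4"] by auto
  \<comment> \<open>An error \<open>\<eta>\<close> in each kernel adds up to
    \<open>\<eta> * (m1 + m2)\<^sup>2\<close>, which is \<open>\<gamma> / 4\<close>. It occurs once
    for the maximizer and once for the competitor, and \<open>\<gamma> / 2\<close> is still less
    than the gap.\<close>
  define \<eta> where "\<eta> = \<gamma> / (4 * (m1 + m2)\<^sup>2)"
  have \<eta>: "\<eta> > 0" "\<eta> * (m1 + m2)\<^sup>2 = \<gamma> / 4" using \<gamma> m by (auto simp: \<eta>_def)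
  have cont_h: "continuous_on (cS \<times> cS) (\<lambda>(x, y). h x y)"
    using S_subset(2) by (intro continuous_on_subset[OF continuous_on_h_joint]) auto
  obtain sh where sh: "sh > 0" "\<And>x y x' y'. x \<in> cS \<Longrightarrow> y \<in> cS \<Longrightarrow> x' \<in> cS \<Longrightarrow> y' \<in> cS \<Longrightarrow>
      dist x x' < sh \<Longrightarrow> dist y y' < sh \<Longrightarrow> h x' y' - \<eta> \<le> h x y \<and> h x y \<le> h x' y' + \<eta>"
    by (fact uniform_oscillation[OF compact_cS compact_cS cont_h \<eta>(1)])
  obtain sg where sg: "sg > 0" "\<And>x y x' y'. x \<in> cball p1 \<delta> \<Longrightarrow> y \<in> cball p2 \<delta> \<Longrightarrow> x' \<in> cball p1 \<delta> \<Longrightarrow> y' \<in> cball p2 \<delta> \<Longrightarrow>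
      dist x x' < sg \<Longrightarrow> dist y y' < sg \<Longrightarrow> g x' y' - \<eta> \<le> g x y \<and> g x y \<le> g x' y' + \<eta>"
    by (fact uniform_oscillation[OF compact_cball compact_cball continuous_g \<eta>(1)])
  \<comment> \<open>A centre within \<open>\<delta> / 4\<close> of the minimum point plus a support
    radius of \<open>\<delta> / 4\<close> keeps the support in the disc of radius
    \<open>\<delta> / 2\<close>.\<close>
  define s where "s = min (\<delta> / 4) (min (sh / 2) (sg / 2))"
  have s: "s > 0" "s \<le> \<delta> / 4" "s < sh" "s < sg" using \<delta> sh(1) sg(1) by (auto simp: s_def)
  obtain R where R: "R > 0"
    "\<And>lam a b. lam > 0 \<Longrightarrow> 2 * core_radius m1 lam < \<delta> \<Longrightarrow> 2 * core_radius m2 lam < \<delta> \<Longrightarrow> pair_maximizer m1 m2 lam a b \<Longrightarrow>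
      \<exists>x1\<in>ball p1 \<delta>. \<exists>x2\<in>ball p2 \<delta>.
        (AE x in lborel. x \<notin> cball x1 (R * core_radius m1 lam) \<longrightarrow> a x = 0) \<and>
        (AE x in lborel. x \<notin> cball x2 (R * core_radius m2 lam) \<longrightarrow> b x = 0)"
    by (fact maximizer_concentrates[OF m])
  define e where "e = min (\<delta> / 2) (s / R)"
  have e: "e > 0" using \<delta> s R(1) by (simp add: e_def)
  have main: "(AE x in lborel. x \<notin> cball p1 (\<delta> / 2) \<longrightarrow> a x = 0) \<and> (AE x in lborel. x \<notin> cball p2 (\<delta> / 2) \<longrightarrow> b x = 0)"
    if lam: "lam > 0" and small: "core_radius m1 lam < e" "core_radius m2 lam < e" and max: "pair_maximizer m1 m2 lam a b" for lam a b
  proof -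
    have cr: "2 * core_radius m1 lam < \<delta>" "2 * core_radius m2 lam < \<delta>" using small by (auto simp: e_def)
    have Rs: "R * core_radius m1 lam \<le> s" "R * core_radius m2 lam \<le> s"
      using small R(1) by (auto simp: e_def field_simps)
    obtain x1 x2 where x: "x1 \<in> ball p1 \<delta>" "x2 \<in> ball p2 \<delta>"
      and a0: "AE x in lborel. x \<notin> cball x1 (R * core_radius m1 lam) \<longrightarrow> a x = 0"
      and b0: "AE x in lborel. x \<notin> cball x2 (R * core_radius m2 lam) \<longrightarrow> b x = 0"
      using R(2)[OF lam cr max] by (elim bexE conjE)
    have as: "AE x in lborel. x \<notin> cball x1 s \<longrightarrow> a x = 0" using a0 by eventually_elim (use Rs in auto)
    have bs: "AE x in lborel. x \<notin> cball x2 s \<longrightarrow> b x = 0" using b0 by eventually_elim (use Rs in auto)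
    have pa: "profile m1 lam (ball p1 \<delta>) a" and pb: "profile m2 lam (ball p2 \<delta>) b"
      using max by (auto simp: pair_maximizer_def admissible_def)
    note sa = profile_supported_S(1)[OF pa] and sb = profile_supported_S(2)[OF pb]
    have s\<delta>: "s < \<delta>" using s \<delta> by simp
    obtain a' where a': "profile m1 lam (ball p1 \<delta>) a'" "\<And>x. a' x \<noteq> 0 \<Longrightarrow> x \<in> cball p1 s"
        "interaction log_kernel a' a' = interaction log_kernel a a"
      by (fact recentred_profile[OF pa bounded_ball as s\<delta>])
    obtain b' where b': "profile m2 lam (ball p2 \<delta>) b'" "\<And>x. b' x \<noteq> 0 \<Longrightarrow> x \<in> cball p2 s"
        "interaction log_kernel b' b' = interaction log_kernel b b"
      by (fact recentred_profile[OF pb bounded_ball bs s\<delta>])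
    note sa' = profile_supported_S(1)[OF a'(1)] and sb' = profile_supported_S(2)[OF b'(1)]
    have "pair_energy a' b' \<le> pair_energy a b"
      using max a'(1) b'(1) by (simp add: pair_maximizer_def admissible_def)
    then have le: "interaction h a a + interaction h b b + 2 * interaction g a b
        \<le> interaction h a' a' + interaction h b' b' + 2 * interaction g a' b'"
      unfolding pair_energy_expand[OF sa sb] pair_energy_expand[OF sa' sb'] using a'(3) b'(3) by simp
    have hosc: "h q q - \<eta> \<le> h x y \<and> h x y \<le> h q q + \<eta>"
      if "q \<in> cS" "x \<in> cball q s" "x \<in> S" "y \<in> cball q s" "y \<in> S" for q x y
      using that s S_subset(1) by (intro sh(2)) (auto simp: dist_commute)
    have gosc: "g q1 q2 - \<eta> \<le> g x y \<and> g x y \<le> g q1 q2 + \<eta>"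
      if "q1 \<in> cball p1 \<delta>" "q2 \<in> cball p2 \<delta>" "x \<in> cball q1 s \<inter> ball p1 \<delta>" "y \<in> cball q2 s \<inter> ball p2 \<delta>" for q1 q2 x y
      using that s by (intro sg(2)) (auto simp: dist_commute)
    have xc: "x1 \<in> cS" "x2 \<in> cS" "p1 \<in> cS" "p2 \<in> cS" using x \<delta> by (auto simp: cS_def)
    have AEs: "AE x in lborel. a x \<noteq> 0 \<longrightarrow> x \<in> cball x1 s" "AE x in lborel. b x \<noteq> 0 \<longrightarrow> x \<in> cball x2 s"
      "AE x in lborel. a' x \<noteq> 0 \<longrightarrow> x \<in> cball p1 s" "AE x in lborel. b' x \<noteq> 0 \<longrightarrow> x \<in> cball p2 s"
      using as bs a'(2) b'(2) by auto
    have AEg: "AE x in lborel. a x \<noteq> 0 \<longrightarrow> x \<in> cball x1 s \<inter> ball p1 \<delta>" "AE x in lborel. b x \<noteq> 0 \<longrightarrow> x \<in> cball x2 s \<inter> ball p2 \<delta>"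
      "AE x in lborel. a' x \<noteq> 0 \<longrightarrow> x \<in> cball p1 s \<inter> ball p1 \<delta>" "AE x in lborel. b' x \<noteq> 0 \<longrightarrow> x \<in> cball p2 s \<inter> ball p2 \<delta>"
    proof -
      have conj: "AE x in lborel. f x \<noteq> 0 \<longrightarrow> x \<in> U \<inter> V"
        if "AE x in lborel. f x \<noteq> 0 \<longrightarrow> x \<in> U" "\<And>x. x \<notin> V \<Longrightarrow> f x = 0" for f :: "real^2 \<Rightarrow> real" and U V
        using that(1) by eventually_elim (use that(2) in blast)
      show "AE x in lborel. a x \<noteq> 0 \<longrightarrow> x \<in> cball x1 s \<inter> ball p1 \<delta>" by (rule conj[OF AEs(1) profile_zero[OF pa]])
      show "AE x in lborel. b x \<noteq> 0 \<longrightarrow> x \<in> cball x2 s \<inter> ball p2 \<delta>" by (rule conj[OF AEs(2) profile_zero[OF pb]])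
      show "AE x in lborel. a' x \<noteq> 0 \<longrightarrow> x \<in> cball p1 s \<inter> ball p1 \<delta>" by (rule conj[OF AEs(3) profile_zero[OF a'(1)]])
      show "AE x in lborel. b' x \<noteq> 0 \<longrightarrow> x \<in> cball p2 s \<inter> ball p2 \<delta>" by (rule conj[OF AEs(4) profile_zero[OF b'(1)]])
    qed
    have 1: "(h x1 x1 - \<eta>) * m1\<^sup>2 \<le> interaction h a a"
      using interaction_h_bounds(1)[OF sa profile_nonneg[OF pa] AEs(1), of "h x1 x1 - \<eta>" "h x1 x1 + \<eta>"] hosc[OF xc(1)] profile_integral[OF pa] by auto
    have 2: "(h x2 x2 - \<eta>) * m2\<^sup>2 \<le> interaction h b b"
      using interaction_h_bounds(1)[OF sb profile_nonneg[OF pb] AEs(2), of "h x2 x2 - \<eta>" "h x2 x2 + \<eta>"] hosc[OF xc(2)] profile_integral[OF pb] by auto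
    have 3: "(g x1 x2 - \<eta>) * (m1 * m2) \<le> interaction g a b"
      using interaction_g_bounds(1)[OF sa profile_nonneg[OF pa] AEg(1) sb profile_nonneg[OF pb] AEg(2), of "g x1 x2 - \<eta>" "g x1 x2 + \<eta>"]
        gosc[of x1 x2] x profile_integral[OF pa] profile_integral[OF pb] by auto
    have 4: "interaction h a' a' \<le> (h p1 p1 + \<eta>) * m1\<^sup>2"
      using interaction_h_bounds(2)[OF sa' profile_nonneg[OF a'(1)] AEs(3), of "h p1 p1 - \<eta>" "h p1 p1 + \<eta>"] hosc[OF xc(3)] profile_integral[OF a'(1)] by auto
    have 5: "interaction h b' b' \<le> (h p2 p2 + \<eta>) * m2\<^sup>2"
      using interaction_h_bounds(2)[OF sb' profile_nonneg[OF b'(1)] AEs(4), of "h p2 p2 - \<eta>" "h p2 p2 + \<eta>"] hosc[OF xc(4)] profile_integral[OF b'(1)] by auto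
    have 6: "interaction g a' b' \<le> (g p1 p2 + \<eta>) * (m1 * m2)"
      using interaction_g_bounds(2)[OF sa' profile_nonneg[OF a'(1)] AEg(3) sb' profile_nonneg[OF b'(1)] AEg(4), of "g p1 p2 - \<eta>" "g p1 p2 + \<eta>"]
        gosc[of p1 p2] \<delta> profile_integral[OF a'(1)] profile_integral[OF b'(1)] by auto
    have low: "(h x1 x1 - \<eta>) * m1\<^sup>2 + (h x2 x2 - \<eta>) * m2\<^sup>2 + 2 * ((g x1 x2 - \<eta>) * (m1 * m2)) = H m1 m2 x1 x2 - \<eta> * (m1 + m2)\<^sup>2"
      by (simp add: H_def algebra_simps power2_eq_square)
    have up: "(h p1 p1 + \<eta>) * m1\<^sup>2 + (h p2 p2 + \<eta>) * m2\<^sup>2 + 2 * ((g p1 p2 + \<eta>) * (m1 * m2)) = H m1 m2 p1 p2 + \<eta> * (m1 + m2)\<^sup>2"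
      by (simp add: H_def algebra_simps power2_eq_square)
    have "H m1 m2 x1 x2 \<le> H m1 m2 p1 p2 + 2 * (\<gamma> / 4)"
      using le 1 2 3 4 5 6 low up \<eta>(2) by linarith
    then have "H m1 m2 x1 x2 < H m1 m2 p1 p2 + \<gamma>" using \<gamma>(1) by linarith
    then have d: "dist p1 x1 < \<delta> / 4" "dist p2 x2 < \<delta> / 4" using \<gamma>(2)[of x1 x2] x by auto
    have sub: "cball x1 s \<subseteq> cball p1 (\<delta> / 2)" "cball x2 s \<subseteq> cball p2 (\<delta> / 2)"
    proof -
      show "cball x1 s \<subseteq> cball p1 (\<delta> / 2)"
      proof
        fix y assume "y \<in> cball x1 s"
        then show "y \<in> cball p1 (\<delta> / 2)" using dist_triangle[of p1 y x1] d s by simp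
      qed
      show "cball x2 s \<subseteq> cball p2 (\<delta> / 2)"
      proof
        fix y assume "y \<in> cball x2 s"
        then show "y \<in> cball p2 (\<delta> / 2)" using dist_triangle[of p2 y x2] d s by simp
      qed
    qed
    show ?thesis
    proof
      show "AE x in lborel. x \<notin> cball p1 (\<delta> / 2) \<longrightarrow> a x = 0" using as by eventually_elim (use sub in blast)
      show "AE x in lborel. x \<notin> cball p2 (\<delta> / 2) \<longrightarrow> b x = 0" using bs by eventually_elim (use sub in blast)
    qed
  qed
  show ?thesis
    using eventually_gt_at_top[of 0] core_radius_eventually_small[OF m(1) e] core_radius_eventually_small[OF m(2) e]
    by eventually_elim (use main in blast)
qed

section \<open>The weak equation for a localized pair\<close>

lemma jacobian_minus:
  assumes "\<And>i. ((\<lambda>t. v (x + t *\<^sub>R axis i 1)) has_real_derivative partial_deriv i v x) (at 0)"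
  shows "jacobian f (\<lambda>x. - v x) x = - jacobian f v x"
proof -
  have "partial_deriv i (\<lambda>x. - v x) x = - partial_deriv i v x" for i
    unfolding partial_deriv_def[of i "\<lambda>x. - v x"] by (rule DERIV_imp_deriv) (rule DERIV_minus[OF assms])
  then show ?thesis by (simp add: jacobian_def)
qed

lemma partial_deriv_g_potential:
  assumes "bounded_supported S f" "x \<in> S"
  shows "((\<lambda>t. potential g f (x + t *\<^sub>R axis i 1)) has_real_derivative partial_deriv i (potential g f) x) (at 0)"
proof -
  obtain c where c: "((\<lambda>t. potential g f (x + t *\<^sub>R axis i 1)) has_real_derivative c) (at 0)"
    using g_potential_has_derivative[OF assms] by blast
  then have "partial_deriv i (potential g f) x = c" unfolding partial_deriv_def by (rule DERIV_imp_deriv)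
  then show ?thesis using c by simp
qed

text \<open>The patch equation is applied to \<open>a\<close> with the stream function and to
  \<open>b\<close> with its negative; the two minus signs cancel in the Jacobian, so the
  contributions add up.\<close>

lemma localized_maximizer_weak_solution:
  assumes max: "pair_maximizer m1 m2 lam a b" and lam: "lam > 0"
    and m: "0 < m1" "m1 < lam * (pi * \<delta>\<^sup>2)" "0 < m2" "m2 < lam * (pi * \<delta>\<^sup>2)"
    and loc: "AE x in lborel. x \<notin> cball p1 (\<delta> / 2) \<longrightarrow> a x = 0" "AE x in lborel. x \<notin> cball p2 (\<delta> / 2) \<longrightarrow> b x = 0"
    and \<xi>: "test_function D' \<xi>"
  shows "\<exists>F. integrable lborel F \<and> (LINT x|lborel. F x) = 0 \<and>
     (AE x in lborel. (a x - b x) * jacobian \<xi> (potential g (\<lambda>x. a x - b x)) x = F x)"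
proof -
  have pa: "profile m1 lam (ball p1 \<delta>) a" and pb: "profile m2 lam (ball p2 \<delta>) b"
    using max by (auto simp: pair_maximizer_def admissible_def)
  note sa = profile_supported_S(1)[OF pa] and sb = profile_supported_S(2)[OF pb]
  have sab: "bounded_supported S (\<lambda>x. a x - b x)" and sba: "bounded_supported S (\<lambda>x. b x - a x)"
    using bounded_supported_diff sa sb by auto
  obtain \<mu>1 \<mu>2 where lev:
    "measure lborel {x \<in> ball p1 \<delta>. potential g (\<lambda>x. a x - b x) x > \<mu>1} \<le> m1 / lam"
    "AE x in lborel. x \<in> ball p1 \<delta> \<longrightarrow> potential g (\<lambda>x. a x - b x) x > \<mu>1 \<longrightarrow> a x = lam"
    "AE x in lborel. x \<in> ball p1 \<delta> \<longrightarrow> potential g (\<lambda>x. a x - b x) x < \<mu>1 \<longrightarrow> a x = 0"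
    "measure lborel {x \<in> ball p2 \<delta>. potential g (\<lambda>x. b x - a x) x > \<mu>2} \<le> m2 / lam"
    "AE x in lborel. x \<in> ball p2 \<delta> \<longrightarrow> potential g (\<lambda>x. b x - a x) x > \<mu>2 \<longrightarrow> b x = lam"
    "AE x in lborel. x \<in> ball p2 \<delta> \<longrightarrow> potential g (\<lambda>x. b x - a x) x < \<mu>2 \<longrightarrow> b x = 0"
    by (rule maximizer_levels[OF max lam m])
  have half: "\<delta> / 2 < \<delta>" using \<delta> by simp
  obtain L1 where L1: "L1 \<ge> 0" "\<And>x x'. x \<in> S \<Longrightarrow> x' \<in> S \<Longrightarrow> \<bar>potential g (\<lambda>x. a x - b x) x - potential g (\<lambda>x. a x - b x) x'\<bar> \<le> L1 * norm (x - x')"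
    using g_potential_lipschitz[OF sab] by metis
  obtain L2 where L2: "L2 \<ge> 0" "\<And>x x'. x \<in> S \<Longrightarrow> x' \<in> S \<Longrightarrow> \<bar>potential g (\<lambda>x. b x - a x) x - potential g (\<lambda>x. b x - a x) x'\<bar> \<le> L2 * norm (x - x')"
    using g_potential_lipschitz[OF sba] by metis
  have "\<exists>F. integrable lborel F \<and> (LINT x|lborel. F x) = 0 \<and>
     (AE x in lborel. a x * jacobian \<xi> (potential g (\<lambda>x. a x - b x)) x = F x)"
    unfolding jacobian_def
  proof (rule weak_patch_equation[OF \<xi> half lam L1(1) _ _ _ lev(2,3) loc(1)])
    show "\<bar>potential g (\<lambda>x. a x - b x) x - potential g (\<lambda>x. a x - b x) y\<bar> \<le> L1 * norm (x - y)"
      if "x \<in> ball p1 \<delta>" "y \<in> ball p1 \<delta>" for x y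
      using that ball_subset_S(1) by (intro L1(2)) auto
    show "((\<lambda>t. potential g (\<lambda>x. a x - b x) (x + t *\<^sub>R axis i 1)) has_real_derivative partial_deriv i (potential g (\<lambda>x. a x - b x)) x) (at 0)"
      if "x \<in> ball p1 \<delta>" for x i
      using that ball_subset_S(1) by (intro partial_deriv_g_potential[OF sab]) auto
    show "a x = 0" if "x \<notin> ball p1 \<delta>" for x using that by (rule profile_zero[OF pa])
  qed
  then obtain F1 where F1: "integrable lborel F1" "(LINT x|lborel. F1 x) = 0"
    "AE x in lborel. a x * jacobian \<xi> (potential g (\<lambda>x. a x - b x)) x = F1 x" by blast
  have "\<exists>F. integrable lborel F \<and> (LINT x|lborel. F x) = 0 \<and>
     (AE x in lborel. b x * jacobian \<xi> (potential g (\<lambda>x. b x - a x)) x = F x)"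
    unfolding jacobian_def
  proof (rule weak_patch_equation[OF \<xi> half lam L2(1) _ _ _ lev(5,6) loc(2)])
    show "\<bar>potential g (\<lambda>x. b x - a x) x - potential g (\<lambda>x. b x - a x) y\<bar> \<le> L2 * norm (x - y)"
      if "x \<in> ball p2 \<delta>" "y \<in> ball p2 \<delta>" for x y
      using that ball_subset_S(2) by (intro L2(2)) auto
    show "((\<lambda>t. potential g (\<lambda>x. b x - a x) (x + t *\<^sub>R axis i 1)) has_real_derivative partial_deriv i (potential g (\<lambda>x. b x - a x)) x) (at 0)"
      if "x \<in> ball p2 \<delta>" for x i
      using that ball_subset_S(2) by (intro partial_deriv_g_potential[OF sba]) auto
    show "b x = 0" if "x \<notin> ball p2 \<delta>" for x using that by (rule profile_zero[OF pb])
  qed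
  then obtain F2 where F2: "integrable lborel F2" "(LINT x|lborel. F2 x) = 0"
    "AE x in lborel. b x * jacobian \<xi> (potential g (\<lambda>x. b x - a x)) x = F2 x" by blast
  have neg: "potential g (\<lambda>x. b x - a x) = (\<lambda>x. - potential g (\<lambda>x. a x - b x) x)"
    using potential_minus[of g "\<lambda>x. a x - b x"] by (simp add: fun_eq_iff)
  have "AE x in lborel. (a x - b x) * jacobian \<xi> (potential g (\<lambda>x. a x - b x)) x = F1 x + F2 x"
    using F1(3) F2(3)
  proof eventually_elim
    case (elim x)
    show ?case
    proof (cases "x \<in> S")
      case True
      have "jacobian \<xi> (potential g (\<lambda>x. b x - a x)) x = - jacobian \<xi> (potential g (\<lambda>x. a x - b x)) x"
        unfolding neg by (rule jacobian_minus[OF partial_deriv_g_potential[OF sab True]])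
      then show ?thesis using elim by (simp add: left_diff_distrib)
    next
      case False
      then have "a x = 0" "b x = 0" using sa sb by (auto simp: bounded_supported_def)
      then show ?thesis using elim by simp
    qed
  qed
  then show ?thesis using F1 F2 by (intro exI[of _ "\<lambda>x. F1 x + F2 x"]) auto
qed

end

section \<open>Passing to Borel representatives\<close>

text \<open>Completeness of Lebesgue measure: functions built from \<open>G\<close> or from partial
  derivatives inherit measurability from a Borel function that agrees with them almost
  everywhere.\<close>

lemma borel_measurable_lebesgue_AE:
  fixes f q :: "real^2 \<Rightarrow> real"
  assumes f: "f \<in> borel_measurable lebesgue" and AE: "AE x in lebesgue. q x = f x"
  shows "q \<in> borel_measurable lebesgue"
proof (rule measurableI)
  fix A :: "real set" assume A: "A \<in> sets borel"
  show "q -` A \<inter> space lebesgue \<in> sets lebesgue"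
  proof (rule completion.in_sets_AE)
    show "AE x in lebesgue. x \<in> f -` A \<inter> space lebesgue \<longleftrightarrow> x \<in> q -` A \<inter> space lebesgue"
      using AE by eventually_elim simp
    show "f -` A \<inter> space lebesgue \<in> sets lebesgue" using f A by (rule measurable_sets)
  qed simp
qed simp

text \<open>The bridge between the integrals over \<open>D\<close> and those over the plane. Nothing
  is asked of \<open>q\<close> beyond agreement with \<open>f\<close> almost everywhere, so
  unspecified values of \<open>G\<close> on the diagonal do no harm.\<close>

lemma integral_lebesgue_on_eq_lborel:
  fixes f q :: "real^2 \<Rightarrow> real"
  assumes D: "D \<in> sets borel" and f: "f \<in> borel_measurable borel"
    and off: "AE x in lborel. x \<notin> D \<longrightarrow> f x = 0" and AE: "AE x in lebesgue_on D. q x = f x"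
  shows "(LINT x|lebesgue_on D. q x) = (LINT x|lborel. f x)"
proof -
  have Dl: "D \<inter> space lebesgue \<in> sets lebesgue" using D by (simp add: sets_completionI_sets)
  have AE': "AE x in lebesgue. indicator D x *\<^sub>R q x = f x"
  proof -
    have "AE x in lebesgue. x \<in> D \<longrightarrow> q x = f x" using AE by (subst (asm) AE_restrict_space_iff[OF Dl])
    moreover have "AE x in lebesgue. x \<notin> D \<longrightarrow> f x = 0" using off by (rule AE_completion)
    ultimately show ?thesis by eventually_elim (simp split: split_indicator)
  qed
  have fl: "f \<in> borel_measurable lebesgue" using f by (simp add: measurable_completion)
  have "(LINT x|lebesgue_on D. q x) = (LINT x|lebesgue. indicator D x *\<^sub>R q x)"
    by (rule integral_restrict_space[OF Dl])
  also have "\<dots> = (LINT x|lebesgue. f x)"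
    by (rule integral_cong_AE[OF borel_measurable_lebesgue_AE[OF fl AE'] fl AE'])
  also have "\<dots> = (LINT x|lborel. f x)" by (rule integral_completion) (use f in simp)
  finally show ?thesis .
qed

lemma AE_lborel_imp_AE_lebesgue_on:
  assumes "D \<in> sets borel" "AE x in lborel. P x"
  shows "AE x in lebesgue_on D. P x"
proof -
  have "D \<inter> space lebesgue \<in> sets lebesgue" using assms(1) by (simp add: sets_completionI_sets)
  moreover have "AE x in lebesgue. P x" using assms(2) by (rule AE_completion)
  ultimately show ?thesis by (subst AE_restrict_space_iff) auto
qed

text \<open>A Borel representative is corrected on a null set so that the sign, the bound and the
  support condition hold at every point.\<close>

lemma vortex_component_imp_profile:
  assumes D: "D \<in> sets borel" and B: "B \<in> sets borel" "B \<subseteq> D" and lam: "lam \<ge> 0"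
    and f: "f \<in> vortex_component D lam \<kappa> B" and \<kappa>: "\<kappa> \<noteq> 0"
  obtains a where "profile \<bar>\<kappa>\<bar> lam B a" "AE x in lebesgue_on D. f x = sgn \<kappa> * a x"
proof -
  have Dl: "D \<in> sets lebesgue" using D by (simp add: sets_completionI_sets)
  have fm: "f \<in> borel_measurable (lebesgue_on D)"
    and fb: "AE x in lebesgue_on D. 0 \<le> sgn \<kappa> * f x \<and> sgn \<kappa> * f x \<le> lam"
    and fi: "(LINT x|lebesgue_on D. f x) = \<kappa>"
    and fo: "AE x in lebesgue_on D. x \<notin> B \<longrightarrow> f x = 0"
    using f by (auto simp: vortex_component_def Linfty_def)
  have "(\<lambda>x. if x \<in> D then f x else 0) \<in> borel_measurable lebesgue"
    using fm Dl by (rule borel_measurable_if_I)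
  then obtain f' where f': "f' \<in> borel_measurable borel" "AE x in lborel. (if x \<in> D then f x else 0) = f' x"
    using completion_ex_borel_measurable_real[of _ lborel] by fastforce
  \<comment> \<open>Clamping to \<open>[0, lam]\<close> and cutting off to \<open>B\<close> enforce
    the pointwise conditions; almost everywhere in \<open>D\<close> they change nothing.\<close>
  define a where "a x = indicator B x * max 0 (min lam (sgn \<kappa> * f' x))" for x
  have s2: "sgn \<kappa> * sgn \<kappa> = 1" using \<kappa> by (simp add: sgn_real_def)
  note [measurable] = f'(1) B(1)
  have am: "a \<in> borel_measurable borel" unfolding a_def by measurable
  have inD: "AE x in lebesgue_on D. x \<in> D" using AE_space[of "lebesgue_on D"] by simp
  have AE: "AE x in lebesgue_on D. sgn \<kappa> * f x = a x"
    using fb fo AE_lborel_imp_AE_lebesgue_on[OF D f'(2)] inD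
    by eventually_elim (auto simp: a_def split: split_indicator)
  have "(LINT x|lborel. a x) = (LINT x|lebesgue_on D. sgn \<kappa> * f x)"
    by (rule integral_lebesgue_on_eq_lborel[symmetric, OF D am _ AE]) (use B in \<open>auto simp: a_def split: split_indicator\<close>)
  also have "\<dots> = \<bar>\<kappa>\<bar>" using fi \<kappa> by (simp add: abs_sgn mult.commute)
  finally have int: "(LINT x|lborel. a x) = \<bar>\<kappa>\<bar>" .
  have "0 \<le> a x \<and> a x \<le> lam" for x using lam by (simp add: a_def split: split_indicator)
  then have "profile \<bar>\<kappa>\<bar> lam B a" using am int by (auto simp: profile_def a_def)
  moreover have "AE x in lebesgue_on D. f x = sgn \<kappa> * a x"
    using AE
  proof eventually_elim
    case (elim x)
    have "f x = (sgn \<kappa> * sgn \<kappa>) * f x" unfolding s2 by simp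
    also have "\<dots> = sgn \<kappa> * a x" unfolding mult.assoc elim ..
    finally show ?case .
  qed
  ultimately show thesis by (rule that)
qed

lemma profile_imp_vortex_component:
  assumes D: "D \<in> sets borel" and B: "B \<subseteq> D" and a: "profile \<bar>\<kappa>\<bar> lam B a" and \<kappa>: "\<kappa> \<noteq> 0"
  shows "(\<lambda>x. sgn \<kappa> * a x) \<in> vortex_component D lam \<kappa> B"
proof -
  have am: "a \<in> borel_measurable borel" and ab: "\<And>x. 0 \<le> a x \<and> a x \<le> lam" and ao: "\<And>x. x \<notin> B \<Longrightarrow> a x = 0"
    and ai: "(LINT x|lborel. a x) = \<bar>\<kappa>\<bar>"
    using a by (auto simp: profile_def)
  have al: "(\<lambda>x. sgn \<kappa> * a x) \<in> borel_measurable (lebesgue_on D)"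
    using am by (intro measurable_restrict_space1 measurable_completion) simp
  have s2: "sgn \<kappa> * (sgn \<kappa> * v) = v" for v using \<kappa> by (simp add: sgn_real_def)
  have "(LINT x|lebesgue_on D. sgn \<kappa> * a x) = (LINT x|lborel. sgn \<kappa> * a x)"
    by (rule integral_lebesgue_on_eq_lborel[OF D]) (use am ao B in auto)
  also have "\<dots> = \<kappa>" using ai by (simp add: mult_sgn_abs)
  finally have int: "(LINT x|lebesgue_on D. sgn \<kappa> * a x) = \<kappa>" .
  have "\<bar>sgn \<kappa> * a x\<bar> \<le> lam" for x using ab[of x] \<kappa> by (simp add: sgn_real_def)
  then have "\<exists>C. AE x in lebesgue_on D. \<bar>sgn \<kappa> * a x\<bar> \<le> C" by (intro exI[of _ lam]) simp
  then show ?thesis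
    unfolding vortex_component_def Linfty_def mem_Collect_eq s2 using al int ab ao by (intro conjI) auto
qed

section \<open>Transfer of maximizers and stream functions to Borel profiles\<close>

context vortex_domain
begin

lemma D_sets: "D \<in> sets borel" using open_D by simp

text \<open>For \<open>x\<close> in the discs the integrands differ only at \<open>y = x\<close> and
  on the null set where \<open>\<omega>\<close> and \<open>u\<close> disagree.\<close>

lemma stream_function_eq:
  assumes u: "bounded_supported S u" and AE: "AE y in lebesgue_on D. \<omega> y = u y" and x: "x \<in> S"
  shows "stream_function D G \<omega> x = potential g u x"
  unfolding stream_function_def potential_def
proof (rule integral_lebesgue_on_eq_lborel[OF D_sets])
  obtain C where "weakly_singular_kernel S g C diam" using weakly_singular_g .
  then interpret weakly_singular_kernel S g C diam .
  show "(\<lambda>y. g x y * u y) \<in> borel_measurable borel" using K_integrand_measurable[OF x u] by simp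
  show "AE y in lborel. y \<notin> D \<longrightarrow> g x y * u y = 0"
    using u S_subset(3) by (auto simp: bounded_supported_def)
  have inD: "AE y in lebesgue_on D. y \<in> D" using AE_space[of "lebesgue_on D"] by simp
  show "AE y in lebesgue_on D. G x y * \<omega> y = g x y * u y"
    using AE inD AE_lborel_imp_AE_lebesgue_on[OF D_sets AE_lborel_singleton[of x]]
  proof eventually_elim
    case (elim y)
    then show ?case using G_eq[of x y] x S_subset(3) closure_subset[of D] by (auto simp: g_def)
  qed
qed

lemma kinetic_energy_eq:
  assumes u: "bounded_supported S u" and AE: "AE y in lebesgue_on D. \<omega> y = u y"
  shows "kinetic_energy D G \<omega> = interaction g u u / 2"
proof -
  obtain C where "weakly_singular_kernel S g C diam" using weakly_singular_g .
  then interpret weakly_singular_kernel S g C diam .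
  have "(LINT x|lebesgue_on D. (LINT y|lebesgue_on D. G x y * \<omega> x * \<omega> y)) = (LINT x|lborel. u x * potential g u x)"
  proof (rule integral_lebesgue_on_eq_lborel[OF D_sets])
    show "(\<lambda>x. u x * potential g u x) \<in> borel_measurable borel"
      using borel_measurable_integrable[OF interaction_integrable[OF u u]] by simp
    show "AE x in lborel. x \<notin> D \<longrightarrow> u x * potential g u x = 0"
      using u S_subset(3) by (auto simp: bounded_supported_def)
    show "AE x in lebesgue_on D. (LINT y|lebesgue_on D. G x y * \<omega> x * \<omega> y) = u x * potential g u x"
      using AE
    proof eventually_elim
      case (elim x)
      have "(LINT y|lebesgue_on D. G x y * \<omega> x * \<omega> y) = (LINT y|lebesgue_on D. u x * (G x y * \<omega> y))"
        by (intro Bochner_Integration.integral_cong refl) (simp add: elim mult_ac)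
      then have "(LINT y|lebesgue_on D. G x y * \<omega> x * \<omega> y) = u x * stream_function D G \<omega> x"
        by (simp add: stream_function_def)
      then show ?case using stream_function_eq[OF u AE, of x] u
        by (cases "x \<in> S") (auto simp: bounded_supported_def)
    qed
  qed
  then show ?thesis by (simp add: kinetic_energy_def interaction_def)
qed

lemma jacobian_cong:
  assumes "x \<in> S" "\<And>y. y \<in> S \<Longrightarrow> v y = v' y"
  shows "jacobian f v x = jacobian f v' x"
proof -
  obtain e where e: "e > 0" "ball x e \<subseteq> S" using open_S assms(1) openE by blast
  have "partial_deriv i v x = partial_deriv i v' x" for i
  proof -
    have "\<forall>\<^sub>F t in nhds (0::real). \<bar>t\<bar> < e" using e by (auto simp: eventually_nhds_metric dist_norm)
    then have ev: "\<forall>\<^sub>F t in nhds 0. v (x + t *\<^sub>R axis i 1) = v' (x + t *\<^sub>R axis i 1)"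
    proof eventually_elim
      case (elim t)
      have "x + t *\<^sub>R axis i 1 \<in> S" by (rule subsetD[OF e(2)]) (use elim in \<open>simp add: dist_norm\<close>)
      then show ?case by (rule assms(2))
    qed
    show ?thesis unfolding partial_deriv_def by (rule deriv_cong_ev[OF ev refl])
  qed
  then show ?thesis by (simp add: jacobian_def)
qed

text \<open>Both directions of the correspondence are used: the maximizer yields a pair of profiles,
  and every admissible pair yields a competitor in \<open>K_class\<close>.\<close>

lemma energy_maximizer_imp_pair_maximizer:
  assumes \<kappa>: "\<kappa>1 > 0" "\<kappa>2 < 0" and lam: "lam \<ge> 0"
    and max: "energy_maximizer D G \<kappa>1 \<kappa>2 (ball p1 \<delta>) (ball p2 \<delta>) lam \<omega>"
  obtains a b where "pair_maximizer \<kappa>1 (- \<kappa>2) lam a b" "AE x in lebesgue_on D. \<omega> x = a x - b x"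
proof -
  have sub: "ball p1 \<delta> \<subseteq> D" "ball p2 \<delta> \<subseteq> D" using balls_in_D by auto
  have "\<omega> \<in> K_class D \<kappa>1 \<kappa>2 (ball p1 \<delta>) (ball p2 \<delta>) lam"
    and opt: "\<And>\<omega>'. \<omega>' \<in> K_class D \<kappa>1 \<kappa>2 (ball p1 \<delta>) (ball p2 \<delta>) lam \<Longrightarrow> kinetic_energy D G \<omega>' \<le> kinetic_energy D G \<omega>"
    using max by (auto simp: energy_maximizer_def is_arg_max_def not_less)
  then obtain \<omega>1 \<omega>2 where \<omega>: "\<omega> = (\<lambda>x. \<omega>1 x + \<omega>2 x)"
    "\<omega>1 \<in> vortex_component D lam \<kappa>1 (ball p1 \<delta>)" "\<omega>2 \<in> vortex_component D lam \<kappa>2 (ball p2 \<delta>)"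
    by (auto simp: K_class_def)
  obtain a where a: "profile \<bar>\<kappa>1\<bar> lam (ball p1 \<delta>) a" "AE x in lebesgue_on D. \<omega>1 x = sgn \<kappa>1 * a x"
    by (rule vortex_component_imp_profile[OF D_sets _ sub(1) lam \<omega>(2)]) (use \<kappa> in auto)
  obtain b where b: "profile \<bar>\<kappa>2\<bar> lam (ball p2 \<delta>) b" "AE x in lebesgue_on D. \<omega>2 x = sgn \<kappa>2 * b x"
    by (rule vortex_component_imp_profile[OF D_sets _ sub(2) lam \<omega>(3)]) (use \<kappa> in auto)
  have AE: "AE x in lebesgue_on D. \<omega> x = a x - b x"
    using a(2) b(2) by eventually_elim (use \<kappa> in \<open>simp add: \<omega>(1)\<close>)
  have adm: "admissible \<kappa>1 (- \<kappa>2) lam a b" using a(1) b(1) \<kappa> by (simp add: admissible_def)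
  have supp: "bounded_supported S (\<lambda>x. a x - b x)" if "admissible \<kappa>1 (- \<kappa>2) lam a b" for a b
    using that profile_supported_S by (auto simp: admissible_def intro!: bounded_supported_diff)
  have "pair_energy a' b' \<le> pair_energy a b" if adm': "admissible \<kappa>1 (- \<kappa>2) lam a' b'" for a' b'
  proof -
    have "profile \<bar>\<kappa>1\<bar> lam (ball p1 \<delta>) a'" "profile \<bar>\<kappa>2\<bar> lam (ball p2 \<delta>) b'"
      using adm' \<kappa> by (auto simp: admissible_def)
    then have "(\<lambda>x. sgn \<kappa>1 * a' x) \<in> vortex_component D lam \<kappa>1 (ball p1 \<delta>)"
      "(\<lambda>x. sgn \<kappa>2 * b' x) \<in> vortex_component D lam \<kappa>2 (ball p2 \<delta>)"
      by (intro profile_imp_vortex_component[OF D_sets] sub; use \<kappa> in simp)+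
    then have "(\<lambda>x. sgn \<kappa>1 * a' x + sgn \<kappa>2 * b' x) \<in> K_class D \<kappa>1 \<kappa>2 (ball p1 \<delta>) (ball p2 \<delta>) lam"
      unfolding K_class_def mem_Collect_eq
      by (intro exI[of _ "\<lambda>x. sgn \<kappa>1 * a' x"] exI[of _ "\<lambda>x. sgn \<kappa>2 * b' x"] conjI refl)
    then have "(\<lambda>x. a' x - b' x) \<in> K_class D \<kappa>1 \<kappa>2 (ball p1 \<delta>) (ball p2 \<delta>) lam"
      using \<kappa> by simp
    from opt[OF this] show ?thesis
      using kinetic_energy_eq[OF supp[OF adm'], of "\<lambda>x. a' x - b' x"] kinetic_energy_eq[OF supp[OF adm] AE]
      by (simp add: pair_energy_def)
  qed
  then have "pair_maximizer \<kappa>1 (- \<kappa>2) lam a b" using adm by (simp add: pair_maximizer_def)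
  then show thesis using AE by (rule that)
qed

lemma kirchhoff_routh_eq:
  assumes "x1 \<in> cball p1 \<delta>" "x2 \<in> cball p2 \<delta>"
  shows "kirchhoff_routh G h \<kappa>1 \<kappa>2 (x1, x2) = H \<kappa>1 (- \<kappa>2) x1 x2"
proof -
  have "G x1 x2 = g x1 x2"
  proof -
    have "x1 \<in> D" "x2 \<in> D" "x2 \<noteq> x1" using assms balls_in_D disjoint_balls by blast+
    then show ?thesis using G_eq[of x1 x2] closure_subset[of D] by (auto simp: g_def)
  qed
  then show ?thesis by (simp add: kirchhoff_routh_def H_def)
qed

lemma weak_steady_solution_if_localized:
  assumes max: "pair_maximizer m1 m2 lam a b" and AE: "AE x in lebesgue_on D. \<omega> x = a x - b x" and lam: "lam > 0"
    and m: "0 < m1" "m1 < lam * (pi * \<delta>\<^sup>2)" "0 < m2" "m2 < lam * (pi * \<delta>\<^sup>2)"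
    and loc: "AE x in lborel. x \<notin> cball p1 (\<delta> / 2) \<longrightarrow> a x = 0" "AE x in lborel. x \<notin> cball p2 (\<delta> / 2) \<longrightarrow> b x = 0"
  shows "weak_steady_solution D G \<omega>"
  unfolding weak_steady_solution_def
proof (intro allI impI)
  fix \<xi> assume \<xi>: "test_function D \<xi>"
  let ?u = "\<lambda>x. a x - b x"
  have u: "bounded_supported S ?u"
    using max profile_supported_S by (auto simp: pair_maximizer_def admissible_def intro!: bounded_supported_diff)
  obtain F where F: "integrable lborel F" "(LINT x|lborel. F x) = 0"
    "AE x in lborel. ?u x * jacobian \<xi> (potential g ?u) x = F x"
    using localized_maximizer_weak_solution[OF max lam m loc \<xi>] by (elim exE conjE)
  have "(LINT x|lebesgue_on D. \<omega> x * jacobian \<xi> (stream_function D G \<omega>) x) = (LINT x|lborel. F x)"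
  proof (rule integral_lebesgue_on_eq_lborel[OF D_sets])
    show "F \<in> borel_measurable borel" using borel_measurable_integrable[OF F(1)] by simp
    have u0: "?u x = 0" if "x \<notin> S" for x using u that by (simp add: bounded_supported_def)
    show "AE x in lborel. x \<notin> D \<longrightarrow> F x = 0"
      using F(3)
    proof eventually_elim
      case (elim x)
      show ?case
      proof
        assume "x \<notin> D"
        then have "?u x = 0" using u0[of x] S_subset(3) by blast
        then show "F x = 0" using elim by simp
      qed
    qed
    show "AE x in lebesgue_on D. \<omega> x * jacobian \<xi> (stream_function D G \<omega>) x = F x"
      using AE AE_lborel_imp_AE_lebesgue_on[OF D_sets F(3)]
    proof eventually_elim
      case (elim x)
      show ?case
      proof (cases "x \<in> S")
        case True
        have "jacobian \<xi> (stream_function D G \<omega>) x = jacobian \<xi> (potential g ?u) x"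
          using True stream_function_eq[OF u AE] by (rule jacobian_cong)
        then show ?thesis using elim by simp
      next
        case False
        then show ?thesis using elim u0[OF False] by simp
      qed
    qed
  qed
  then show "(LINT x|lebesgue_on D. \<omega> x * jacobian \<xi> (stream_function D G \<omega>) x) = 0" using F(2) by simp
qed

end

theorem theorem3p9:
  fixes D :: "(real^2) set"
    and G h :: "real^2 \<Rightarrow> real^2 \<Rightarrow> real"
    and \<kappa>1 \<kappa>2 \<delta> :: real
    and xb1 xb2 :: "real^2"
  assumes "open D" and "bounded D" and "simply_connected D" and "smooth_boundary D"
    and "is_green_function D G h"
    and "\<kappa>1 > 0" and "\<kappa>2 < 0"
    and "strict_local_min_on {(x1, x2). x1 \<in> D \<and> x2 \<in> D \<and> x1 \<noteq> x2}
           (kirchhoff_routh G h \<kappa>1 \<kappa>2) (xb1, xb2)"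
    and "\<delta> > 0"
    and "cball xb1 \<delta> \<subseteq> D" and "cball xb2 \<delta> \<subseteq> D" and "cball xb1 \<delta> \<inter> cball xb2 \<delta> = {}"
    and "unique_min_on (cball xb1 \<delta> \<times> cball xb2 \<delta>) (kirchhoff_routh G h \<kappa>1 \<kappa>2) (xb1, xb2)"
    and "\<exists>\<Lambda>. \<forall>lam\<ge>\<Lambda>. \<forall>\<omega>.
           energy_maximizer D G \<kappa>1 \<kappa>2 (ball xb1 \<delta>) (ball xb2 \<delta>) lam \<omega> \<longrightarrow>
           (\<forall>\<mu>. is_patch_level D G lam \<omega> \<kappa>1 (ball xb1 \<delta>) \<mu> \<longrightarrow> \<mu> > 0) \<and>
           (\<forall>\<mu>. is_patch_level D G lam \<omega> \<kappa>2 (ball xb2 \<delta>) \<mu> \<longrightarrow> \<mu> > 0)"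
  shows "\<exists>lam0>0. \<forall>lam\<ge>lam0. \<forall>\<omega>.
           energy_maximizer D G \<kappa>1 \<kappa>2 (ball xb1 \<delta>) (ball xb2 \<delta>) lam \<omega> \<longrightarrow>
           weak_steady_solution D G \<omega>"
proof -
  interpret vortex_domain D G h xb1 xb2 \<delta>
    using assms by unfold_locales auto
  have min: "\<forall>x1\<in>cball xb1 \<delta>. \<forall>x2\<in>cball xb2 \<delta>. (x1, x2) \<noteq> (xb1, xb2) \<longrightarrow> H \<kappa>1 (- \<kappa>2) xb1 xb2 < H \<kappa>1 (- \<kappa>2) x1 x2"
  proof (intro ballI impI)
    fix x1 x2 assume x: "x1 \<in> cball xb1 \<delta>" "x2 \<in> cball xb2 \<delta>" "(x1, x2) \<noteq> (xb1, xb2)"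
    have "kirchhoff_routh G h \<kappa>1 \<kappa>2 (xb1, xb2) < kirchhoff_routh G h \<kappa>1 \<kappa>2 (x1, x2)"
      using assms(13) x by (auto simp: unique_min_on_def)
    then show "H \<kappa>1 (- \<kappa>2) xb1 xb2 < H \<kappa>1 (- \<kappa>2) x1 x2"
      using kirchhoff_routh_eq[of x1 x2] kirchhoff_routh_eq[of xb1 xb2] x \<delta> by simp
  qed
  have \<kappa>: "\<kappa>1 > 0" "- \<kappa>2 > 0" using assms(6,7) by auto
  define c where "c = pi * \<delta>\<^sup>2"
  have c: "c > 0" using \<delta> by (simp add: c_def)
  \<comment> \<open>The last two bounds say that a disc of radius \<open>\<delta>\<close> at full
    density holds strictly more than the required masses, as the bathtub principle needs.\<close>
  have "\<forall>\<^sub>F lam in at_top. lam > 0 \<and> lam > \<kappa>1 / c \<and> lam > - \<kappa>2 / c"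
    by (intro eventually_conj eventually_gt_at_top)
  with maximizer_localized[OF \<kappa> min]
  have "\<forall>\<^sub>F lam in at_top. \<forall>\<omega>. energy_maximizer D G \<kappa>1 \<kappa>2 (ball xb1 \<delta>) (ball xb2 \<delta>) lam \<omega> \<longrightarrow> weak_steady_solution D G \<omega>"
  proof eventually_elim
    case (elim lam)
    show ?case
    proof (intro allI impI)
      fix \<omega> assume max: "energy_maximizer D G \<kappa>1 \<kappa>2 (ball xb1 \<delta>) (ball xb2 \<delta>) lam \<omega>"
      have lam: "lam \<ge> 0" "lam > 0" "\<kappa>1 < lam * (pi * \<delta>\<^sup>2)" "- \<kappa>2 < lam * (pi * \<delta>\<^sup>2)"
        using elim(2) c unfolding c_def[symmetric] by (auto simp: field_simps)
      obtain a b where ab: "pair_maximizer \<kappa>1 (- \<kappa>2) lam a b" "AE x in lebesgue_on D. \<omega> x = a x - b x"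
        by (rule energy_maximizer_imp_pair_maximizer[OF assms(6,7) lam(1) max])
      have loc: "AE x in lborel. x \<notin> cball xb1 (\<delta> / 2) \<longrightarrow> a x = 0" "AE x in lborel. x \<notin> cball xb2 (\<delta> / 2) \<longrightarrow> b x = 0"
        using elim(1) ab(1) by simp_all
      show "weak_steady_solution D G \<omega>"
        by (rule weak_steady_solution_if_localized[OF ab lam(2) \<kappa>(1) lam(3) \<kappa>(2) lam(4) loc])
    qed
  qed
  then obtain N where N: "\<And>lam. lam \<ge> N \<Longrightarrow> \<forall>\<omega>. energy_maximizer D G \<kappa>1 \<kappa>2 (ball xb1 \<delta>) (ball xb2 \<delta>) lam \<omega> \<longrightarrow> weak_steady_solution D G \<omega>"
    unfolding eventually_at_top_linorder by blast
  show ?thesis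
    by (intro exI[of _ "max N 1"] conjI allI impI) (use N in auto)
qed

end
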